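(* Let $\Omega$ be a John domain on the Riemann sphere $\bar{\mathbf C}$ with John center $\infty$, and let $K=\partial\Omega$ (a compact subset of $\mathbf C=\mathbf R^2$). Then $K$ is removable for $W^{1,2}$: every function $f$ which is continuous on $\mathbf R^2$ and belongs to $W^{1,2}(\mathbf R^2\setminus K)$ also belongs to $W^{1,2}(\mathbf R^2)$.
   Context: John domain: let $\Omega$ be a domain (open connected set, with nonempty boundary) on the Riemann sphere $\bar{\mathbf C}$ and let $z_0\in\Omega$. $\Omega$ is a John domain with center $z_0$ if there is $\varepsilon>0$ such that for all $z_1\in\Omega$ there is an arc $\gamma\subset\Omega$ connecting $z_0$ to $z_1$ with $d(z)\ge\varepsilon\, d(z,z_1)$ for all $z\in\gamma$, where $d(z,z_1)$ is the chordal distance from $z$ to $z_1$ and $d(z)$ is the chordal distance from $z$ to $\partial\Omega$. (When $z_0=\infty$ one may use Euclidean distances instead.) No simple connectivity of $\Omega$ is assumed, and nothing is assumed about the other components of $\bar{\mathbf C}\setminus K$. Sobolev convention: for an open set $U\subset\mathbf R^2$ and a continuous function $f$, "$f\in W^{1,2}(U)$" means that $f$ has one derivative in $L^2$ on $U$, i.e. the first-order distributional partial derivatives of $f$ on $U$ are functions in $L^2(U)$ (no global $L^2$ integrability of $f$ itself is required). *)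

theory Defs
  imports "HOL-Analysis.Analysis"
begin

section \<open>The Riemann sphere with the chordal metric\<close>

datatype riemann_sphere = Finite complex | Infinity

text \<open>Inverse stereographic projection onto the unit sphere of \<open>complex \<times> real\<close>, with
  \<open>Infinity\<close> as north pole. Its image is the unit sphere, and the chordal
  distance is the length of the chord between the two image points.\<close>

fun stereo :: "riemann_sphere \<Rightarrow> complex \<times> real" where
  "stereo (Finite z) =
     ((2 / ((cmod z)\<^sup>2 + 1)) *\<^sub>R z, ((cmod z)\<^sup>2 - 1) / ((cmod z)\<^sup>2 + 1))"
| "stereo Infinity = (0, 1)"

lemma inj_stereo: "inj stereo"
proof (rule injI)
  have pos: "(cmod z)\<^sup>2 + 1 \<noteq> 0" for z
    by (rule less_imp_neq[symmetric]) (simp add: add_nonneg_pos)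
  have ne1: "((cmod z)\<^sup>2 - 1) / ((cmod z)\<^sup>2 + 1) \<noteq> 1" for z
    using pos[of z] by (simp add: divide_eq_eq)
  have inj: "z = w" if "stereo (Finite z) = stereo (Finite w)" for z w
  proof -
    have "((cmod z)\<^sup>2 - 1) / ((cmod z)\<^sup>2 + 1) = ((cmod w)\<^sup>2 - 1) / ((cmod w)\<^sup>2 + 1)"
      using that by simp
    then have "((cmod z)\<^sup>2 - 1) * ((cmod w)\<^sup>2 + 1) = ((cmod w)\<^sup>2 - 1) * ((cmod z)\<^sup>2 + 1)"
      using pos[of z] pos[of w] by (simp add: frac_eq_eq)
    then have eq: "(cmod z)\<^sup>2 = (cmod w)\<^sup>2"
      by (simp add: algebra_simps)
    have "(2 / ((cmod w)\<^sup>2 + 1)) *\<^sub>R z = (2 / ((cmod w)\<^sup>2 + 1)) *\<^sub>R w"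
      using that eq by simp
    then show ?thesis using pos[of w] by simp
  qed
  fix x y assume "stereo x = stereo y"
  then show "x = y"
  proof (cases x; cases y)
    fix z w assume "x = Finite z" "y = Finite w"
    then show ?thesis using \<open>stereo x = stereo y\<close> inj by blast
  next
    fix z assume "x = Finite z" "y = Infinity"
    then show ?thesis using \<open>stereo x = stereo y\<close> ne1[of z] by simp
  next
    fix w assume "x = Infinity" "y = Finite w"
    then show ?thesis using \<open>stereo x = stereo y\<close> ne1[of w] by simp
  qed simp
qed

instantiation riemann_sphere :: metric_space
begin

definition dist_riemann_sphere :: "riemann_sphere \<Rightarrow> riemann_sphere \<Rightarrow> real" where
  "dist x y = dist (stereo x) (stereo y)"

definition uniformity_riemann_sphere :: "(riemann_sphere \<times> riemann_sphere) filter" where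
  "(uniformity :: (riemann_sphere \<times> riemann_sphere) filter) =
     (INF e\<in>{0<..}. principal {(x::riemann_sphere, y). dist x y < e})"

definition open_riemann_sphere :: "riemann_sphere set \<Rightarrow> bool" where
  "open (U :: riemann_sphere set) \<longleftrightarrow> (\<forall>x\<in>U. \<forall>\<^sub>F (x', y) in uniformity. x' = x \<longrightarrow> y \<in> U)"

instance
proof
  fix x y z :: riemann_sphere
  show "dist x y = 0 \<longleftrightarrow> x = y"
    unfolding dist_riemann_sphere_def using inj_stereo by (simp add: inj_eq)
  show "dist x y \<le> dist x z + dist y z"
    unfolding dist_riemann_sphere_def by (rule dist_triangle2)
qed (fact uniformity_riemann_sphere_def open_riemann_sphere_def)+

end

lemma norm_stereo: "norm (stereo x) = 1"
proof (cases x)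
  case (Finite z)
  define s where "s = (cmod z)\<^sup>2 + 1"
  have s: "s > 0" unfolding s_def by (simp add: add_nonneg_pos)
  have st: "stereo x = ((2 / s) *\<^sub>R z, (s - 2) / s)"
    by (simp add: Finite s_def)
  have "(norm (stereo x))\<^sup>2 = (2 / s * cmod z)\<^sup>2 + ((s - 2) / s)\<^sup>2"
    unfolding st norm_prod_def using s by (simp add: power_divide)
  also have "\<dots> = (4 * (s - 1) + (s - 2)\<^sup>2) / s\<^sup>2"
    by (simp add: s_def power_mult_distrib power_divide add_divide_distrib)
  also have "\<dots> = 1" using s by (simp add: power2_eq_square algebra_simps)
  finally show ?thesis using norm_ge_zero[of "stereo x"] unfolding power2_eq_1_iff by linarith
qed (simp add: norm_prod_def)

lemma chordal_dist_Infinity: "dist (Finite z) Infinity = 2 / sqrt ((cmod z)\<^sup>2 + 1)"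
proof -
  define s where "s = (cmod z)\<^sup>2 + 1"
  have s: "s > 0" unfolding s_def by (simp add: add_nonneg_pos)
  have st: "stereo (Finite z) = ((2 / s) *\<^sub>R z, (s - 2) / s)"
    by (simp add: s_def)
  have "(dist (Finite z) Infinity)\<^sup>2 = (2 / s * cmod z)\<^sup>2 + ((s - 2) / s - 1)\<^sup>2"
    unfolding dist_riemann_sphere_def st stereo.simps(2) dist_prod_def using s
    by (simp add: dist_norm power2_commute)
  also have "(s - 2) / s - 1 = - 2 / s" using s by (simp add: field_simps)
  also have "(2 / s * cmod z)\<^sup>2 + (- 2 / s)\<^sup>2 = 4 * s / s\<^sup>2"
    by (simp add: s_def power_mult_distrib power_divide add_divide_distrib algebra_simps)
  also have "\<dots> = (2 / sqrt s)\<^sup>2" using s by (simp add: power_divide power2_eq_square)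
  finally show ?thesis unfolding s_def[symmetric] using s by (simp add: power2_eq_iff_nonneg)
qed

lemma chordal_dist_Finite:
  "dist (Finite z) (Finite w) = 2 * cmod (z - w) / (sqrt ((cmod z)\<^sup>2 + 1) * sqrt ((cmod w)\<^sup>2 + 1))"
proof -
  define s t where "s = (cmod z)\<^sup>2 + 1" and "t = (cmod w)\<^sup>2 + 1"
  have s: "s > 0" and t: "t > 0" unfolding s_def t_def by (simp_all add: add_nonneg_pos)
  define p where "p = z \<bullet> w"
  have zz: "z \<bullet> z = s - 1" "w \<bullet> w = t - 1"
    by (simp_all add: s_def t_def power2_norm_eq_inner)
  have st: "stereo (Finite z) = ((2 / s) *\<^sub>R z, (s - 2) / s)"
    "stereo (Finite w) = ((2 / t) *\<^sub>R w, (t - 2) / t)"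
    by (simp_all add: s_def t_def)
  have "(dist (Finite z) (Finite w))\<^sup>2
      = (norm (stereo (Finite z)))\<^sup>2 + (norm (stereo (Finite w)))\<^sup>2 - 2 * (stereo (Finite z) \<bullet> stereo (Finite w))"
    unfolding dist_riemann_sphere_def dist_norm power2_norm_eq_inner
    by (simp add: inner_diff_left inner_diff_right inner_commute del: stereo.simps)
  also have "\<dots> = 2 - 2 * (4 * p / (s * t) + (s - 2) * (t - 2) / (s * t))"
    unfolding norm_stereo unfolding st by (simp add: p_def)
  also have "\<dots> = 4 * (s - 1 + (t - 1) - 2 * p) / (s * t)"
    using s t by (simp add: field_simps)
  also have "s - 1 + (t - 1) - 2 * p = (cmod (z - w))\<^sup>2"
    unfolding power2_norm_eq_inner by (simp add: p_def zz inner_diff_left inner_diff_right inner_commute)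
  also have "4 * (cmod (z - w))\<^sup>2 / (s * t) = (2 * cmod (z - w) / (sqrt s * sqrt t))\<^sup>2"
    using s t by (simp add: power_divide power_mult_distrib)
  finally show ?thesis unfolding s_def[symmetric] t_def[symmetric]
    using s t by (simp add: power2_eq_iff_nonneg)
qed

lemma continuous_on_Finite: "continuous_on UNIV Finite"
proof -
  have pos: "(cmod z)\<^sup>2 + 1 \<noteq> 0" for z
    by (rule less_imp_neq[symmetric]) (simp add: add_nonneg_pos)
  have "continuous_on UNIV (\<lambda>z. stereo (Finite z))"
    by (auto intro!: continuous_intros simp: pos)
  then show ?thesis
    unfolding continuous_on_iff dist_riemann_sphere_def .
qed

section \<open>John domains\<close>

text \<open>The case \<open>z1 = z0\<close> is left out because \<^const>\<open>arc\<close> is injective; the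
  degenerate arc \<open>{z0}\<close> satisfies the inequality trivially.\<close>

definition john_domain :: "riemann_sphere set \<Rightarrow> riemann_sphere \<Rightarrow> bool" where
  "john_domain \<Omega> z0 \<longleftrightarrow>
     open \<Omega> \<and> connected \<Omega> \<and> frontier \<Omega> \<noteq> {} \<and> z0 \<in> \<Omega> \<and>
     (\<exists>\<epsilon>>0. \<forall>z1\<in>\<Omega> - {z0}. \<exists>\<gamma>. arc \<gamma> \<and> path_image \<gamma> \<subseteq> \<Omega> \<and>
        pathstart \<gamma> = z0 \<and> pathfinish \<gamma> = z1 \<and>
        (\<forall>z\<in>path_image \<gamma>. infdist z (frontier \<Omega>) \<ge> \<epsilon> * dist z z1))"

text \<open>If \<^const>\<open>Infinity\<close> lies in the open set \<open>\<Omega>\<close>, then passing from the frontier of \<open>\<Omega>\<close> to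
  its preimage in the plane loses nothing, and this preimage is compact.\<close>

lemma frontier_eq_Finite_image:
  assumes "open \<Omega>" "Infinity \<in> \<Omega>"
  shows "frontier \<Omega> = Finite ` (Finite -` frontier \<Omega>)"
proof -
  have "Infinity \<notin> frontier \<Omega>"
    using assms by (simp add: frontier_def interior_open)
  then have "x \<in> range Finite" if "x \<in> frontier \<Omega>" for x
    using that by (cases x) auto
  then show ?thesis by blast
qed

lemma compact_vimage_frontier:
  assumes "open \<Omega>" "Infinity \<in> \<Omega>"
  shows "compact (Finite -` frontier \<Omega>)"
proof -
  have "closed (Finite -` frontier \<Omega>)"
    using continuous_on_Finite frontier_closed by (rule closed_vimage[rotated])
  moreover have "bounded (Finite -` frontier \<Omega>)"
  proof -
    obtain e where e: "e > 0" "\<And>x. dist x Infinity < e \<Longrightarrow> x \<in> \<Omega>"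
      using assms unfolding open_dist by blast
    have "cmod z \<le> 2 / e" if "Finite z \<in> frontier \<Omega>" for z
    proof -
      have "Finite z \<notin> \<Omega>" using that assms by (simp add: frontier_def interior_open)
      then have "e \<le> 2 / sqrt ((cmod z)\<^sup>2 + 1)"
        using e(2) chordal_dist_Infinity by (metis not_le)
      moreover have "sqrt ((cmod z)\<^sup>2 + 1) > 0" by (simp add: add_nonneg_pos)
      ultimately have "sqrt ((cmod z)\<^sup>2 + 1) \<le> 2 / e"
        using e(1) by (simp add: field_simps)
      moreover have "cmod z \<le> sqrt ((cmod z)\<^sup>2 + 1)" by (rule real_le_rsqrt) simp
      ultimately show ?thesis by linarith
    qed
    then show ?thesis by (auto simp: bounded_iff)
  qed
  ultimately show ?thesis by (simp add: compact_eq_bounded_closed)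
qed

section \<open>Weak derivatives\<close>

abbreviation partial_deriv ::
    "'a \<Rightarrow> ('a::euclidean_space \<Rightarrow> real) \<Rightarrow> 'a \<Rightarrow> real" where
  "partial_deriv b \<phi> \<equiv> (\<lambda>x. frechet_derivative \<phi> (at x) b)"

primrec C_k :: "nat \<Rightarrow> ('a::euclidean_space \<Rightarrow> real) \<Rightarrow> bool" where
  "C_k 0 \<phi> \<longleftrightarrow> continuous_on UNIV \<phi>"
| "C_k (Suc k) \<phi> \<longleftrightarrow>
     (\<forall>x. \<phi> differentiable (at x)) \<and> (\<forall>b\<in>Basis. C_k k (partial_deriv b \<phi>))"

definition test_function :: "'a::euclidean_space set \<Rightarrow> ('a \<Rightarrow> real) \<Rightarrow> bool" where
  "test_function U \<phi> \<longleftrightarrow>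
     (\<forall>k. C_k k \<phi>) \<and> compact (closure {x. \<phi> x \<noteq> 0}) \<and> closure {x. \<phi> x \<noteq> 0} \<subseteq> U"

text \<open>The following is meant for open \<open>U\<close> and for \<open>f\<close>, \<open>g\<close> that are locally integrable on \<open>U\<close>, so
  that both integrals exist.\<close>

definition has_weak_partial_deriv ::
    "'a set \<Rightarrow> 'a \<Rightarrow> ('a::euclidean_space \<Rightarrow> 'b::euclidean_space) \<Rightarrow> ('a \<Rightarrow> 'b) \<Rightarrow> bool" where
  "has_weak_partial_deriv U b f g \<longleftrightarrow>
     (\<forall>\<phi>. test_function U \<phi> \<longrightarrow>
        (LINT x:U|lborel. partial_deriv b \<phi> x *\<^sub>R f x) = - (LINT x:U|lborel. \<phi> x *\<^sub>R g x))"

definition L2_on :: "'a::euclidean_space set \<Rightarrow> ('a \<Rightarrow> 'b::euclidean_space) \<Rightarrow> bool" where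
  "L2_on U g \<longleftrightarrow> set_borel_measurable lborel U g \<and> set_integrable lborel U (\<lambda>x. (norm (g x))\<^sup>2)"

text \<open>Only the first derivatives of \<open>f\<close> are required to be square integrable, not \<open>f\<close> itself.\<close>

definition W12 :: "'a::euclidean_space set \<Rightarrow> ('a \<Rightarrow> 'b::euclidean_space) \<Rightarrow> bool" where
  "W12 U f \<longleftrightarrow> (\<forall>b\<in>Basis. \<exists>g. L2_on U g \<and> has_weak_partial_deriv U b f g)"

end

theory Submission
  imports Defs
begin

text \<open>
  By Fubini it suffices to treat almost every line \<open>L\<close> parallel to an axis. Off \<open>K\<close> the function
  \<open>f\<close> is absolutely continuous on \<open>L\<close>, so it remains to see that \<open>f\<close> maps \<open>K \<inter> L\<close> to a set of
  measure zero; then \<open>f\<close> is absolutely continuous on all of \<open>L\<close>, with derivative zero almost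
  everywhere on \<open>K \<inter> L\<close>, and integrating by parts on \<open>L\<close> finishes the proof.

  Cover the complement of \<open>K\<close> by dyadic squares \<open>Q\<close> of side comparable to their distance to \<open>K\<close>.
  In each \<open>Q\<close> a horizontal and a vertical segment through a common point, of length
  \<open>5 * side Q\<close>, can be chosen on which \<open>f\<close> oscillates by at most
  \<open>(2 / side Q) * \<integral>\<bar>\<nabla>f\<bar>\<close>, the integral being taken over the five times larger square;
  the resulting crosses of neighbouring squares meet. By the John condition, \<open>x \<in> K \<inter> L\<close> is a limit
  of curves inside \<open>{z. dist z x \<le> M * dist z K}\<close>, so \<open>f x\<close> lies in the closure of
  the image of a connected component of a union of crosses, taken over arbitrarily small squares
  whose distance to \<open>L\<close> is at most a multiple of their side. Integrated over all parallel lines,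
  the sum of the oscillations over these crosses is bounded by a multiple of \<open>\<integral>\<bar>\<nabla>f\<bar>\<close> over a
  bounded set, so for almost every \<open>L\<close> its tails tend to zero.
\<close>

section \<open>Null images and absolute continuity on the line\<close>

text \<open>A chaining argument would sum oscillations along one chain of squares for each point of
  \<open>K\<close>. Here only the length of an image matters, and it is estimated for all points of
  a line at once: the image of the union of crosses is covered with total length at most the sum of
  the oscillations, so it does not matter how long or how entangled the curves are. Crosses replace
  full squares because even a square integrable gradient does not bound the oscillation of
  \<open>f\<close> on a square; averaging over parallel segments bounds it on suitable ones. The sum
  over crosses converges for a reason of scaling: the factor \<open>1 / side\<close> in the
  oscillation bound cancels against the length, a multiple of \<open>side\<close>, of the set of
  heights \<open>t\<close> whose line passes close to the square. What remains is a sum of gradient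
  integrals over enlarged squares of bounded overlap. The area of \<open>K\<close> is never
  estimated: the candidate derivative is set to zero on \<open>K\<close>, and the null image on
  almost every line justifies this choice.\<close>

lemma borel_cover_diam:
  fixes J :: "real set" and c :: ennreal
  assumes "\<And>x y. x \<in> J \<Longrightarrow> y \<in> J \<Longrightarrow> x \<le> y \<Longrightarrow> ennreal (y - x) \<le> c"
  obtains B where "B \<in> sets borel" "J \<subseteq> B" "emeasure lborel B \<le> c"
proof (cases "J = {} \<or> c = top")
  case True
  then show ?thesis using that[of "{}"] that[of UNIV] by auto
next
  case False
  then obtain r where r: "c = ennreal r" "0 \<le> r" by (cases c) auto
  have d: "y - x \<le> r" if "x \<in> J" "y \<in> J" for x y
  proof (cases "x \<le> y")
    case True
    then show ?thesis using assms[OF that True] r by simp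
  qed (use r in auto)
  obtain x0 where x0: "x0 \<in> J" using False by blast
  have bb: "bdd_below J" and ba: "bdd_above J"
    using d x0 by (force intro!: bdd_belowI[of _ "x0 - r"] bdd_aboveI[of _ "x0 + r"] simp: algebra_simps)+
  have "J \<subseteq> {Inf J..Sup J}"
    using bb ba by (auto intro: cInf_lower cSup_upper)
  moreover have "Sup J \<le> Inf J + r"
  proof (rule cSup_least)
    fix y assume y: "y \<in> J"
    have "y - r \<le> Inf J"
      using x0 d y by (intro cInf_greatest) (auto simp: algebra_simps)
    then show "y \<le> Inf J + r" by simp
  qed (use x0 in auto)
  moreover have "Inf J \<le> Sup J" using bb ba x0 by (meson cInf_lower cSup_upper order_trans)
  ultimately show ?thesis
    using that[of "{Inf J..Sup J}"] r by (simp add: ennreal_leI)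
qed

text \<open>Sums over countable index sets are written as integrals over \<open>count_space\<close>.
  Subadditivity then follows by exchanging two integrals, since the indicator of the union is at
  most the sum of the indicators.\<close>

lemma emeasure_UN_countable_le:
  assumes "countable I" "\<And>i. i \<in> I \<Longrightarrow> A i \<in> sets M"
  shows "emeasure M (\<Union>i\<in>I. A i) \<le> (\<integral>\<^sup>+i. emeasure M (A i) \<partial>count_space I)"
proof (cases "I = {}")
  case False
  have "emeasure M (\<Union>i\<in>I. A i) = (\<integral>\<^sup>+x. indicator (\<Union>i\<in>I. A i) x \<partial>M)"
    using assms by (subst nn_integral_indicator) (auto intro!: sets.countable_UN')
  also have "\<dots> \<le> (\<integral>\<^sup>+x. (\<integral>\<^sup>+i. indicator (A i) x \<partial>count_space I) \<partial>M)"
  proof (rule nn_integral_mono)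
    fix x
    show "indicator (\<Union>i\<in>I. A i) x \<le> (\<integral>\<^sup>+i. indicator (A i) x \<partial>count_space I)"
    proof (cases "\<exists>i\<in>I. x \<in> A i")
      case True
      then obtain i where i: "i \<in> I" "x \<in> A i" by blast
      have "1 = (\<integral>\<^sup>+j. indicator {i} j \<partial>count_space I)"
        using i by (subst nn_integral_indicator) auto
      also have "\<dots> \<le> (\<integral>\<^sup>+j. indicator (A j) x \<partial>count_space I)"
        using i by (intro nn_integral_mono) (auto simp: indicator_def)
      finally show ?thesis by (auto simp: indicator_def)
    qed (auto simp: indicator_def)
  qed
  also have "\<dots> = (\<integral>\<^sup>+i. (\<integral>\<^sup>+x. indicator (A i) x \<partial>M) \<partial>count_space I)"
    using assms(2) by (intro nn_integral_count_space_nn_integral assms(1)) auto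
  also have "\<dots> = (\<integral>\<^sup>+i. emeasure M (A i) \<partial>count_space I)"
    using assms by (intro nn_integral_cong) auto
  finally show ?thesis .
qed auto

text \<open>The conclusion provides a Borel superset, so that no measurability of the sets
  \<open>J i\<close>, in the applications images under a continuous function, has to be
  discussed.\<close>

lemma borel_cover_UN:
  fixes J :: "'i \<Rightarrow> real set" and c :: "'i \<Rightarrow> ennreal"
  assumes "countable I"
    and "\<And>i x y. i \<in> I \<Longrightarrow> x \<in> J i \<Longrightarrow> y \<in> J i \<Longrightarrow> x \<le> y \<Longrightarrow> ennreal (y - x) \<le> c i"
  obtains B where "B \<in> sets borel" "(\<Union>i\<in>I. J i) \<subseteq> B"
    "emeasure lborel B \<le> (\<integral>\<^sup>+i. c i \<partial>count_space I)"
proof -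
  have "\<exists>B. B \<in> sets borel \<and> J i \<subseteq> B \<and> emeasure lborel B \<le> c i" if "i \<in> I" for i
    using borel_cover_diam[of "J i" "c i"] assms(2)[OF that] by metis
  then obtain B where B: "\<And>i. i \<in> I \<Longrightarrow> B i \<in> sets borel \<and> J i \<subseteq> B i \<and> emeasure lborel (B i) \<le> c i"
    by metis
  show ?thesis
  proof (rule that[of "\<Union>i\<in>I. B i"])
    show "(\<Union>i\<in>I. B i) \<in> sets borel" using B assms(1) by (auto intro!: sets.countable_UN')
    show "(\<Union>i\<in>I. J i) \<subseteq> (\<Union>i\<in>I. B i)" using B by blast
    have "emeasure lborel (\<Union>i\<in>I. B i) \<le> (\<integral>\<^sup>+i. emeasure lborel (B i) \<partial>count_space I)"
      using B assms(1) by (intro emeasure_UN_countable_le) auto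
    also have "\<dots> \<le> (\<integral>\<^sup>+i. c i \<partial>count_space I)"
      using B by (intro nn_integral_mono) auto
    finally show "emeasure lborel (\<Union>i\<in>I. B i) \<le> (\<integral>\<^sup>+i. c i \<partial>count_space I)" .
  qed
qed

text \<open>The components of \<open>V\<close> are disjoint open intervals. On each of them the
  hypothesis bounds the diameter of the image by the \<open>\<nu>\<close>-mass of the component, and
  by disjointness these masses add up to the mass of \<open>V\<close>.\<close>

lemma borel_cover_image_open:
  fixes u :: "real \<Rightarrow> real"
  assumes V: "open V" and \<nu>: "sets \<nu> = sets borel"
    and u: "\<And>p q. p \<le> q \<Longrightarrow> {p..q} \<subseteq> V \<Longrightarrow> ennreal \<bar>u q - u p\<bar> \<le> emeasure \<nu> {p..q}"
  obtains B where "B \<in> sets borel" "u ` V \<subseteq> B" "emeasure lborel B \<le> emeasure \<nu> V"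
proof -
  define I where "I = components V"
  have op: "open C" if "C \<in> I" for C using that V unfolding I_def by (rule open_components[rotated])
  have dis: "pairwise disjnt I" unfolding I_def pairwise_def disjnt_def
    using components_nonoverlap by blast
  have cI: "countable I" using op dis by (rule countable_disjoint_open_subsets)
  have V_eq: "V = \<Union>I" unfolding I_def by simp
  have osc: "ennreal (y - x) \<le> emeasure \<nu> C" if C: "C \<in> I" and xy: "x \<in> u ` C" "y \<in> u ` C" "x \<le> y" for C x y
  proof -
    have *: "ennreal \<bar>u q - u p\<bar> \<le> emeasure \<nu> C" if pq: "p \<in> C" "q \<in> C" "p \<le> q" for p q
    proof -
      have "connected C" using C unfolding I_def by (rule in_components_connected)
      then have sub: "{p..q} \<subseteq> C" using pq by (intro connected_contains_Icc)
      then have "ennreal \<bar>u q - u p\<bar> \<le> emeasure \<nu> {p..q}"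
        using pq C V_eq by (intro u) auto
      also have "\<dots> \<le> emeasure \<nu> C" using sub op[OF C] \<nu> by (intro emeasure_mono) auto
      finally show ?thesis .
    qed
    obtain p q where pq: "p \<in> C" "q \<in> C" "x = u p" "y = u q" using xy by blast
    show ?thesis
    proof (cases "p \<le> q")
      case True
      then show ?thesis using *[OF pq(1,2) True] pq xy by simp
    next
      case False
      then show ?thesis using *[OF pq(2,1)] pq xy by (simp add: abs_minus_commute)
    qed
  qed
  obtain B where B: "B \<in> sets borel" "(\<Union>C\<in>I. u ` C) \<subseteq> B"
    "emeasure lborel B \<le> (\<integral>\<^sup>+C. emeasure \<nu> C \<partial>count_space I)"
    by (rule borel_cover_UN[OF cI, where J = "\<lambda>C. u ` C" and c = "emeasure \<nu>"]) (use osc in auto)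
  have "(\<integral>\<^sup>+C. emeasure \<nu> C \<partial>count_space I) = emeasure \<nu> (\<Union>C\<in>I. C)"
    using op dis cI \<nu> by (intro emeasure_UN_countable[symmetric])
      (auto simp: disjoint_family_on_def pairwise_def disjnt_def)
  also have "(\<Union>C\<in>I. C) = V" using V_eq by simp
  finally have "emeasure lborel B \<le> emeasure \<nu> V" using B(3) by simp
  moreover have "u ` V \<subseteq> B" using B(2) unfolding V_eq image_Union .
  ultimately show ?thesis using that B(1) by simp
qed

lemma negligible_if_borel_covers:
  fixes S :: "real set"
  assumes "\<And>e. e > 0 \<Longrightarrow> \<exists>B\<in>sets borel. S \<subseteq> B \<and> emeasure lborel B \<le> ennreal e"
  shows "negligible S"
  unfolding negligible_outer_le
proof (intro allI impI)
  fix e :: real assume "e > 0"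
  then obtain B where B: "B \<in> sets borel" "S \<subseteq> B" "emeasure lborel B \<le> ennreal e" using assms by blast
  have "emeasure lebesgue B = emeasure lborel B" using B by simp
  then have "B \<in> lmeasurable" using B by (auto simp: fmeasurable_def intro: le_less_trans)
  moreover have "measure lebesgue B \<le> e"
    using \<open>emeasure lebesgue B = emeasure lborel B\<close> B \<open>e > 0\<close> by (metis enn2real_leI less_imp_le measure_def)
  ultimately show "\<exists>T. S \<subseteq> T \<and> T \<in> lmeasurable \<and> measure lebesgue T \<le> e" using B by blast
qed

lemma emeasure_le_if_subset_Un_negligible:
  fixes S :: "real set"
  assumes "S \<in> sets borel" "B \<in> sets borel" "negligible N" "S \<subseteq> B \<union> N"
  shows "emeasure lborel S \<le> emeasure lborel B"
proof -
  have "N \<in> null_sets lebesgue" using assms(3) by (simp add: negligible_iff_null_sets)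
  then have "emeasure lebesgue (B \<union> N) = emeasure lebesgue B"
    using assms(2) by (intro emeasure_Un_null_set) auto
  moreover have "emeasure lebesgue S \<le> emeasure lebesgue (B \<union> N)"
    using assms \<open>N \<in> null_sets lebesgue\<close> by (intro emeasure_mono) auto
  ultimately show ?thesis using assms by simp
qed

text \<open>First the null image of \<open>K\<close> gives \<open>\<bar>f q - f p\<bar> \<le> \<integral>\<bar>G\<bar>\<close>; then the function
  \<open>u = f - \<integral>G\<close>, which is locally constant off \<open>K\<close>, maps \<open>K\<close> to a null set because
  \<open>G\<close> vanishes there, so its image is a null interval.\<close>

lemma integral_eq_if_negligible_image:
  fixes f G :: "real \<Rightarrow> real"
  assumes f: "continuous_on UNIV f" and K: "closed K"
    and G: "\<And>a b. set_integrable lborel {a..b} G"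
    and G0: "\<And>x. x \<in> K \<Longrightarrow> G x = 0"
    and fG: "\<And>p q. p \<le> q \<Longrightarrow> {p..q} \<inter> K = {} \<Longrightarrow> f q - f p = (LINT x:{p..q}|lborel. G x)"
    and neg: "negligible (f ` K)"
    and ab: "a \<le> b"
  shows "f b - f a = (LINT x:{a..b}|lborel. G x)"
proof -
  \<comment> \<open>Only truncations of \<open>G\<close> to bounded intervals are known to be
    integrable; \<open>G\<close> is their pointwise limit.\<close>
  have Gm[measurable]: "G \<in> borel_measurable borel"
  proof (rule borel_measurable_LIMSEQ_metric)
    fix n :: nat
    show "(\<lambda>x. indicator {-real n..real n} x *\<^sub>R G x) \<in> borel_measurable borel"
      using G[of "-real n" "real n"] by (simp add: set_integrable_def integrable_iff_bounded)
  next
    fix x :: real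
    have "\<forall>\<^sub>F n in sequentially. indicator {-real n..real n} x *\<^sub>R G x = G x"
    proof (rule eventually_sequentiallyI[of "nat \<lceil>\<bar>x\<bar>\<rceil>"])
      fix n assume "nat \<lceil>\<bar>x\<bar>\<rceil> \<le> n"
      then have "\<bar>x\<bar> \<le> real n" by linarith
      then show "indicator {-real n..real n} x *\<^sub>R G x = G x" by (auto simp: indicator_def)
    qed
    then show "(\<lambda>n. indicator {-real n..real n} x *\<^sub>R G x) \<longlonglongrightarrow> G x"
      by (rule tendsto_eventually)
  qed
  have Gint: "G integrable_on {p..q}" for p q
    using set_borel_integral_eq_integral(1)[OF G] .
  have GI: "(LINT x:{p..q}|lborel. G x) = integral {p..q} G" for p q
    using set_borel_integral_eq_integral(2)[OF G] .
  define \<nu> where "\<nu> = density lborel (\<lambda>x. ennreal \<bar>G x\<bar>)"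
  have s\<nu>[simp]: "sets \<nu> = sets borel" by (simp add: \<nu>_def)
  have em\<nu>: "emeasure \<nu> A = (\<integral>\<^sup>+x\<in>A. ennreal \<bar>G x\<bar> \<partial>lborel)" if "A \<in> sets borel" for A
    unfolding \<nu>_def using that by (intro emeasure_density) auto
  have \<nu>fin: "emeasure \<nu> {p..q} < \<infinity>" for p q
  proof -
    have "emeasure \<nu> {p..q} = (\<integral>\<^sup>+x. ennreal (norm (indicator {p..q} x *\<^sub>R G x)) \<partial>lborel)"
      unfolding em\<nu>[OF atLeastAtMost_borel] by (intro nn_integral_cong) (auto simp: indicator_def)
    then show ?thesis using G[of p q] unfolding set_integrable_def integrable_iff_bounded by simp
  qed
  have int_le: "ennreal \<bar>LINT x:{p..q}|lborel. G x\<bar> \<le> emeasure \<nu> {p..q}" for p q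
  proof -
    have "ennreal (norm (LINT x:{p..q}|lborel. G x)) \<le> (\<integral>\<^sup>+x. ennreal (norm (indicator {p..q} x *\<^sub>R G x)) \<partial>lborel)"
      unfolding set_lebesgue_integral_def using G[of p q] unfolding set_integrable_def
      by (rule integral_norm_bound_ennreal)
    also have "\<dots> = emeasure \<nu> {p..q}"
      unfolding em\<nu>[OF atLeastAtMost_borel] by (intro nn_integral_cong) (auto simp: indicator_def)
    finally show ?thesis by simp
  qed
  have step1: "ennreal \<bar>f q - f p\<bar> \<le> emeasure \<nu> {p..q}" if pq: "p \<le> q" for p q
  proof -
    define V where "V = {p<..<q} - K"
    have "open V" unfolding V_def using K by (intro open_Diff) auto
    moreover have "ennreal \<bar>f s - f r\<bar> \<le> emeasure \<nu> {r..s}" if "r \<le> s" "{r..s} \<subseteq> V" for r s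
    proof -
      have "{r..s} \<inter> K = {}" using that unfolding V_def by auto
      then show ?thesis using fG[OF that(1)] int_le by simp
    qed
    ultimately obtain B where B: "B \<in> sets borel" "f ` V \<subseteq> B" "emeasure lborel B \<le> emeasure \<nu> V"
      using borel_cover_image_open[of V \<nu> f] by auto
    \<comment> \<open>By the intermediate value theorem the image contains the interval between the
      end values. The part over \<open>V\<close> is covered by \<open>B\<close>, and what is left,
      the image of \<open>K\<close> and two points, is null.\<close>
    have "connected (f ` {p..q})"
      using f by (intro connected_continuous_image) (auto intro: continuous_on_subset)
    then have "{min (f p) (f q)..max (f p) (f q)} \<subseteq> f ` {p..q}"
      using pq by (intro connected_contains_Icc) (auto simp: min_def max_def)
    also have "\<dots> \<subseteq> B \<union> (f ` K \<union> {f p, f q})"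
    proof -
      have "{p..q} \<subseteq> V \<union> K \<union> {p, q}" unfolding V_def by auto
      then have "f ` {p..q} \<subseteq> f ` V \<union> f ` K \<union> f ` {p, q}" by (metis image_Un image_mono)
      then show ?thesis using B(2) by auto
    qed
    finally have "emeasure lborel {min (f p) (f q)..max (f p) (f q)} \<le> emeasure lborel B"
      using neg B(1) by (intro emeasure_le_if_subset_Un_negligible[of _ _ "f ` K \<union> {f p, f q}"])
        (auto intro!: negligible_Un)
    also have "\<dots> \<le> emeasure \<nu> {p..q}"
      using B(3) by (rule order_trans) (intro emeasure_mono, auto simp: V_def)
    also have "emeasure lborel {min (f p) (f q)..max (f p) (f q)} = ennreal \<bar>f q - f p\<bar>"
      by (simp add: min_def max_def)
    finally show ?thesis .
  qed
  define u where "u x = f x - integral {a..x} G" for x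
  have uu: "u q - u p = f q - f p - (LINT x:{p..q}|lborel. G x)" if "a \<le> p" "p \<le> q" for p q
    using Henstock_Kurzweil_Integration.integral_combine[OF that Gint] unfolding u_def GI by simp
  \<comment> \<open>The factor 2 accounts for the two parts of \<open>u\<close>: the increments of
    \<open>f\<close> and those of the integral of \<open>G\<close> are each bounded by
    \<open>\<nu>\<close>.\<close>
  define \<mu> where "\<mu> = density lborel (\<lambda>x. 2 * ennreal \<bar>G x\<bar>)"
  have s\<mu>[simp]: "sets \<mu> = sets borel" by (simp add: \<mu>_def)
  have em\<mu>: "emeasure \<mu> A = 2 * emeasure \<nu> A" if "A \<in> sets borel" for A
    unfolding \<mu>_def using that by (subst emeasure_density) (auto simp: em\<nu> nn_integral_cmult[symmetric] mult.assoc)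
  have u\<mu>: "ennreal \<bar>u q - u p\<bar> \<le> emeasure \<mu> {p..q}" if "a \<le> p" "p \<le> q" for p q
  proof -
    have "ennreal \<bar>u q - u p\<bar> \<le> ennreal (\<bar>f q - f p\<bar> + \<bar>LINT x:{p..q}|lborel. G x\<bar>)"
      unfolding uu[OF that] by (intro ennreal_leI) linarith
    also have "\<dots> = ennreal \<bar>f q - f p\<bar> + ennreal \<bar>LINT x:{p..q}|lborel. G x\<bar>"
      by (intro ennreal_plus) auto
    also have "\<dots> \<le> emeasure \<nu> {p..q} + emeasure \<nu> {p..q}"
      using step1[OF that(2)] int_le by (intro add_mono)
    finally show ?thesis by (simp add: em\<mu> mult_2)
  qed
  have "negligible (u ` ({a<..<b} - K))"
  proof (rule negligible_if_borel_covers)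
    fix e :: real assume "e > 0"
    \<comment> \<open>Since \<open>u\<close> is locally constant off \<open>K\<close>, its
      increments there are bounded by the zero measure.\<close>
    let ?n = "density lborel (\<lambda>_. 0) :: real measure"
    have "open ({a<..<b} - K)" using K by (intro open_Diff) auto
    moreover have "ennreal \<bar>u s - u r\<bar> \<le> emeasure ?n {r..s}" if "r \<le> s" "{r..s} \<subseteq> {a<..<b} - K" for r s
    proof -
      have "{r..s} \<inter> K = {}" "a \<le> r" using that by auto
      then show ?thesis using uu[of r s] fG[OF that(1)] that by simp
    qed
    ultimately obtain B where B: "B \<in> sets borel" "u ` ({a<..<b} - K) \<subseteq> B" "emeasure lborel B \<le> emeasure ?n ({a<..<b} - K)"
      using borel_cover_image_open[of "{a<..<b} - K" ?n u] by auto
    have "emeasure ?n ({a<..<b} - K) = 0" using K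
      by (subst emeasure_density) auto
    then show "\<exists>B\<in>sets borel. u ` ({a<..<b} - K) \<subseteq> B \<and> emeasure lborel B \<le> ennreal e"
      using B by (intro bexI[of _ B]) auto
  qed
  moreover have "negligible (u ` ({a<..<b} \<inter> K))"
  proof (rule negligible_if_borel_covers)
    fix e :: real assume e: "e > 0"
    \<comment> \<open>These neighbourhoods shrink to \<open>K\<close> inside the interval. The
      measure \<open>\<mu>\<close> is finite there and gives \<open>K\<close> no mass, because
      \<open>G\<close> vanishes on \<open>K\<close>, so the masses of the \<open>V m\<close> tend to
      zero.\<close>
    define V where "V m = {a<..<b} \<inter> (\<Union>k\<in>K. ball k (1 / Suc m))" for m :: nat
    have oV: "open (V m)" for m unfolding V_def by (intro open_Int open_UN ballI open_ball open_greaterThanLessThan)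
    have bV[measurable]: "V m \<in> sets borel" for m by (intro borel_open oV)
    have dec: "decseq V"
      unfolding decseq_def
    proof (intro allI impI)
      fix m n :: nat assume "m \<le> n"
      then have "1 / real (Suc n) \<le> 1 / real (Suc m)" by (intro divide_left_mono) auto
      then show "V n \<subseteq> V m" unfolding V_def by (intro Int_mono UN_mono subset_ball order_refl)
    qed
    have IV: "(\<Inter>m. V m) = {a<..<b} \<inter> K"
    proof (intro equalityI subsetI)
      fix x assume x: "x \<in> (\<Inter>m. V m)"
      have "x \<in> closure K" unfolding closure_approachable
      proof (intro allI impI)
        fix r :: real assume "r > 0"
        then obtain m where m: "1 / real (Suc m) < r" using nat_approx_posE by metis
        have "x \<in> V m" using x by blast
        then obtain k where "k \<in> K" "dist k x < 1 / Suc m" unfolding V_def by auto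
        then show "\<exists>k\<in>K. dist k x < r" using m by (intro bexI[of _ k]) auto
      qed
      then show "x \<in> {a<..<b} \<inter> K" using K x unfolding V_def by auto
    next
      fix x assume "x \<in> {a<..<b} \<inter> K"
      then show "x \<in> (\<Inter>m. V m)" unfolding V_def by (auto intro!: bexI[of _ x])
    qed
    have "(\<lambda>m. emeasure \<mu> (V m)) \<longlonglongrightarrow> emeasure \<mu> (\<Inter>m. V m)"
    proof (rule Lim_emeasure_decseq)
      fix m
      have "emeasure \<mu> (V m) \<le> emeasure \<mu> {a..b}" by (intro emeasure_mono) (auto simp: V_def)
      also have "\<dots> < \<infinity>" using \<nu>fin[of a b] by (simp add: em\<mu> ennreal_mult_less_top)
      finally show "emeasure \<mu> (V m) \<noteq> \<infinity>" by simp
    qed (use dec in auto)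
    also have "emeasure \<mu> (\<Inter>m. V m) = 0"
    proof -
      have "{a<..<b} \<inter> K \<in> sets borel" using K by auto
      moreover have "(\<integral>\<^sup>+x\<in>{a<..<b} \<inter> K. ennreal \<bar>G x\<bar> \<partial>lborel) = (\<integral>\<^sup>+(x::real). 0 \<partial>lborel)"
        by (intro nn_integral_cong) (auto simp: indicator_def G0)
      ultimately show ?thesis unfolding IV by (simp add: em\<mu> em\<nu>)
    qed
    finally have "\<forall>\<^sub>F m in sequentially. emeasure \<mu> (V m) < ennreal e"
      using e by (intro order_tendstoD(2)) auto
    then obtain m where m: "emeasure \<mu> (V m) < ennreal e" by (auto simp: eventually_sequentially)
    have "ennreal \<bar>u s - u r\<bar> \<le> emeasure \<mu> {r..s}" if "r \<le> s" "{r..s} \<subseteq> V m" for r s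
    proof -
      have "r \<in> V m" using that by auto
      then show ?thesis using u\<mu>[of r s] that by (auto simp: V_def)
    qed
    then obtain B where B: "B \<in> sets borel" "u ` V m \<subseteq> B" "emeasure lborel B \<le> emeasure \<mu> (V m)"
      using borel_cover_image_open[OF oV, of \<mu> m u] by auto
    have "{a<..<b} \<inter> K \<subseteq> V m" using IV by auto
    then show "\<exists>B\<in>sets borel. u ` ({a<..<b} \<inter> K) \<subseteq> B \<and> emeasure lborel B \<le> ennreal e"
      using B m by (intro bexI[of _ B]) auto
  qed
  ultimately have "negligible (u ` ({a<..<b} - K) \<union> u ` ({a<..<b} \<inter> K) \<union> {u a, u b})"
    by (intro negligible_Un) auto
  moreover have "u ` {a..b} \<subseteq> u ` ({a<..<b} - K) \<union> u ` ({a<..<b} \<inter> K) \<union> {u a, u b}"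
  proof -
    have "{a..b} \<subseteq> ({a<..<b} - K) \<union> ({a<..<b} \<inter> K) \<union> {a, b}" by auto
    then have "u ` {a..b} \<subseteq> u ` (({a<..<b} - K) \<union> ({a<..<b} \<inter> K) \<union> {a, b})" by (rule image_mono)
    then show ?thesis by (simp only: image_Un image_insert image_empty)
  qed
  ultimately have negu: "negligible (u ` {a..b})"
    by (rule negligible_subset)
  have "continuous_on {a..b} u"
    unfolding u_def using f by (intro continuous_intros indefinite_integral_continuous_1 Gint)
      (auto intro: continuous_on_subset)
  then have "connected (u ` {a..b})" by (intro connected_continuous_image) auto
  then have "{min (u a) (u b)..max (u a) (u b)} \<subseteq> u ` {a..b}"
    using ab by (intro connected_contains_Icc) (auto simp: min_def max_def)
  then have "negligible {min (u a) (u b)..max (u a) (u b)}" using negu negligible_subset by blast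
  then have "u a = u b"
    using negligible_interval(1)[of "min (u a) (u b)" "max (u a) (u b)"]
    by (auto simp: min_def max_def split: if_splits)
  then show ?thesis using uu[OF order_refl ab] by simp
qed

section \<open>Dyadic squares and crosses\<close>

definition side :: "nat \<Rightarrow> real" where "side n = 1 / 2 ^ n"

definition sq :: "nat \<times> int \<times> int \<Rightarrow> (real \<times> real) set" where
  "sq = (\<lambda>(n, i, j). {of_int i * side n..(of_int i + 1) * side n} \<times> {of_int j * side n..(of_int j + 1) * side n})"

text \<open>The index \<open>(n, i, j)\<close> stands for the square of side \<open>2 ^ (- n)\<close> with lower left corner
  \<open>(i, j) * 2 ^ (- n)\<close>. The concentric square \<open>bigsq\<close> of five times the side is so large that the crosses of two
  squares meeting in a common layer intersect, and so small that it avoids \<open>K\<close> if \<open>layer K\<close> is nonempty.\<close>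

definition bigsq :: "nat \<times> int \<times> int \<Rightarrow> (real \<times> real) set" where
  "bigsq = (\<lambda>(n, i, j). {(of_int i - 2) * side n..(of_int i + 3) * side n} \<times> {(of_int j - 2) * side n..(of_int j + 3) * side n})"

text \<open>These are pieces of Whitney squares. The bounds differ by the factor 2 between
  consecutive dyadic sides, so no distance to \<open>K\<close> falls between two levels. The lower
  constant 8 exceeds by 2 the constant 6 of \<open>dist_sq_bigsq\<close>, which keeps the whole
  enlarged square at distance at least two sides from \<open>K\<close>.\<close>

definition layer :: "(real \<times> real) set \<Rightarrow> nat \<times> int \<times> int \<Rightarrow> (real \<times> real) set" where
  "layer K \<alpha> = {z \<in> sq \<alpha>. 8 * side (fst \<alpha>) \<le> infdist z K \<and> infdist z K \<le> 16 * side (fst \<alpha>)}"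

text \<open>The arms run through all of \<open>bigsq\<close>, while the centre \<open>c\<close> will
  be chosen in the small square \<open>sq\<close>.\<close>

definition cross :: "real \<times> real \<Rightarrow> nat \<times> int \<times> int \<Rightarrow> (real \<times> real) set" where
  "cross c \<alpha> = {z \<in> bigsq \<alpha>. fst z = fst c \<or> snd z = snd c}"

lemma side_pos[simp]: "side n > 0" "side n \<ge> 0" "side n \<noteq> 0" by (simp_all add: side_def)

lemma side_le_iff: "side m \<le> side n \<longleftrightarrow> n \<le> m"
  by (simp add: side_def divide_simps)

lemma dist_prod_le: "dist (a, b) (c, d) \<le> \<bar>a - c\<bar> + \<bar>b - (d::real)\<bar>" for a c :: real
  using sqrt_sum_squares_le_sum_abs[of "a - c" "b - d"] by (simp add: dist_prod_def dist_real_def)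

lemma dist_sq_bigsq:
  assumes "z \<in> bigsq \<alpha>" "w \<in> sq \<alpha>"
  shows "dist z w \<le> 6 * side (fst \<alpha>)"
proof -
  obtain n i j where \<alpha>: "\<alpha> = (n, i, j)" by (cases \<alpha>) auto
  have "\<bar>fst z - fst w\<bar> \<le> 3 * side n" "\<bar>snd z - snd w\<bar> \<le> 3 * side n"
    using assms unfolding \<alpha> sq_def bigsq_def by (auto simp: algebra_simps abs_le_iff)
  then show ?thesis using dist_prod_le[of "fst z" "snd z" "fst w" "snd w"] by (simp add: \<alpha>)
qed

lemma dist_sq_sq:
  assumes "z \<in> sq \<alpha>" "w \<in> sq \<alpha>"
  shows "dist z w \<le> 2 * side (fst \<alpha>)"
proof -
  obtain n i j where \<alpha>: "\<alpha> = (n, i, j)" by (cases \<alpha>) auto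
  have "\<bar>fst z - fst w\<bar> \<le> side n" "\<bar>snd z - snd w\<bar> \<le> side n"
    using assms unfolding \<alpha> sq_def by (auto simp: algebra_simps abs_le_iff)
  then show ?thesis using dist_prod_le[of "fst z" "snd z" "fst w" "snd w"] by (simp add: \<alpha>)
qed

lemma infdist_bigsq:
  assumes "layer K \<alpha> \<noteq> {}" "z \<in> bigsq \<alpha>"
  shows "2 * side (fst \<alpha>) \<le> infdist z K" "infdist z K \<le> 22 * side (fst \<alpha>)"
proof -
  obtain w where w: "w \<in> sq \<alpha>" "8 * side (fst \<alpha>) \<le> infdist w K" "infdist w K \<le> 16 * side (fst \<alpha>)"
    using assms(1) unfolding layer_def by blast
  have "dist z w \<le> 6 * side (fst \<alpha>)" using assms(2) w(1) by (rule dist_sq_bigsq)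
  then show "2 * side (fst \<alpha>) \<le> infdist z K" "infdist z K \<le> 22 * side (fst \<alpha>)"
    using infdist_triangle[of z K w] infdist_triangle[of w K z] w by (simp_all add: dist_commute)
qed

lemma bigsq_disjoint:
  assumes "layer K \<alpha> \<noteq> {}"
  shows "bigsq \<alpha> \<inter> K = {}"
proof -
  have False if "z \<in> bigsq \<alpha>" "z \<in> K" for z
    using infdist_bigsq(1)[OF assms that(1)] that(2) side_pos(1)[of "fst \<alpha>"] by simp
  then show ?thesis by blast
qed

lemma sq_mem_iff:
  "z \<in> sq (n, i, j) \<longleftrightarrow> of_int i * side n \<le> fst z \<and> fst z \<le> (of_int i + 1) * side n \<and>
     of_int j * side n \<le> snd z \<and> snd z \<le> (of_int j + 1) * side n"
  by (auto simp: sq_def mem_Times_iff)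

lemma bigsq_mem_iff:
  "z \<in> bigsq (n, i, j) \<longleftrightarrow> (of_int i - 2) * side n \<le> fst z \<and> fst z \<le> (of_int i + 3) * side n \<and>
     (of_int j - 2) * side n \<le> snd z \<and> snd z \<le> (of_int j + 3) * side n"
  by (auto simp: bigsq_def mem_Times_iff)

lemma sq_subset_bigsq: "sq \<alpha> \<subseteq> bigsq \<alpha>"
proof
  fix z assume z: "z \<in> sq \<alpha>"
  obtain n i j where \<alpha>: "\<alpha> = (n, i, j)" by (cases \<alpha>) auto
  have "side n > 0" by simp
  then show "z \<in> bigsq \<alpha>" using z unfolding \<alpha> sq_mem_iff bigsq_mem_iff by (auto simp: algebra_simps)
qed

lemma in_some_sq: "\<exists>i j. z \<in> sq (n, i, j)"
proof -
  have "of_int \<lfloor>x / side n\<rfloor> * side n \<le> x \<and> x \<le> (of_int \<lfloor>x / side n\<rfloor> + 1) * side n" for x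
  proof -
    have "of_int \<lfloor>x / side n\<rfloor> \<le> x / side n" "x / side n \<le> of_int \<lfloor>x / side n\<rfloor> + 1" by linarith+
    then show ?thesis using side_pos(1)[of n] by (metis pos_le_divide_eq pos_divide_le_eq)
  qed
  then show ?thesis unfolding sq_mem_iff by blast
qed

text \<open>The level is the least \<open>n \<ge> n0\<close> with
  \<open>8 * side n \<le> infdist z K\<close>. If it exceeds \<open>n0\<close>, its predecessor
  fails this inequality, which is the upper bound; if it equals \<open>n0\<close>, the upper bound
  is the second hypothesis.\<close>

lemma in_some_layer:
  assumes "0 < infdist z K" "infdist z K \<le> 16 * side n0"
  obtains \<alpha> where "n0 \<le> fst \<alpha>" "z \<in> layer K \<alpha>"
proof -
  obtain m where m: "(1/2::real) ^ m < infdist z K / 16"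
    using real_arch_pow_inv[of "infdist z K / 16" "1/2"] assms(1) by auto
  have ex: "\<exists>n. 8 * side n \<le> infdist z K"
    by (rule exI[of _ m]) (use m assms(1) in \<open>simp add: side_def power_one_over\<close>)
  define n where "n = (LEAST n. n0 \<le> n \<and> 8 * side n \<le> infdist z K)"
  have "\<exists>n. n0 \<le> n \<and> 8 * side n \<le> infdist z K"
  proof -
    obtain k where k: "8 * side k \<le> infdist z K" using ex by blast
    have "side (max k n0) \<le> side k" by (simp add: side_le_iff)
    then show ?thesis using k by (intro exI[of _ "max k n0"]) auto
  qed
  then have n: "n0 \<le> n \<and> 8 * side n \<le> infdist z K" unfolding n_def by (rule LeastI_ex)
  have "infdist z K \<le> 16 * side n"
  proof (cases "n = n0")
    case False
    then obtain k where k: "n = Suc k" "n0 \<le> k" using n by (cases n) auto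
    have "\<not> (n0 \<le> k \<and> 8 * side k \<le> infdist z K)"
      using k(1) unfolding n_def by (intro not_less_Least) auto
    then show ?thesis using k by (simp add: side_def)
  qed (use assms in auto)
  moreover obtain i j where "z \<in> sq (n, i, j)" using in_some_sq by blast
  ultimately have "z \<in> layer K (n, i, j)" unfolding layer_def using n by simp
  then show ?thesis using that[of "(n, i, j)"] n by simp
qed

lemma int_interval_card:
  fixes x :: real
  assumes "s > 0"
  shows "{i::int. (of_int i - 2) * s \<le> x \<and> x \<le> (of_int i + 3) * s} \<subseteq> {\<lfloor>x / s\<rfloor> - 3..\<lfloor>x / s\<rfloor> + 2}"
proof
  fix i :: int assume "i \<in> {i. (of_int i - 2) * s \<le> x \<and> x \<le> (of_int i + 3) * s}"
  then have "of_int i - 2 \<le> x / s" "x / s \<le> of_int i + 3"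
    using assms by (simp_all add: pos_le_divide_eq pos_divide_le_eq)
  then show "i \<in> {\<lfloor>x / s\<rfloor> - 3..\<lfloor>x / s\<rfloor> + 2}" by simp linarith
qed

text \<open>The distance from \<open>z\<close> to \<open>K\<close> lies between 2 and 22 sides, so
  the sides of the squares in question differ by a factor of at most 11 < 16. That leaves four
  levels, and at each level at most six values for either coordinate of the index: 4 * 36 =
  144.\<close>

lemma bigsq_overlap:
  "finite {\<alpha>. layer K \<alpha> \<noteq> {} \<and> z \<in> bigsq \<alpha>} \<and> card {\<alpha>. layer K \<alpha> \<noteq> {} \<and> z \<in> bigsq \<alpha>} \<le> 144"
proof (cases "{\<alpha>. layer K \<alpha> \<noteq> {} \<and> z \<in> bigsq \<alpha>} = {}")
  case False
  define A where "A = {\<alpha>. layer K \<alpha> \<noteq> {} \<and> z \<in> bigsq \<alpha>}"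
  have b: "2 * side (fst \<alpha>) \<le> infdist z K \<and> infdist z K \<le> 22 * side (fst \<alpha>)" if "\<alpha> \<in> A" for \<alpha>
    using infdist_bigsq[of K \<alpha> z] that unfolding A_def by auto
  define n0 where "n0 = (LEAST n. n \<in> fst ` A)"
  obtain a where "a \<in> A" using False unfolding A_def by (metis ex_in_conv)
  then have "n0 \<in> fst ` A" unfolding n0_def by (intro LeastI[of "\<lambda>n. n \<in> fst ` A" "fst a"] imageI)
  then obtain \<alpha>0 where \<alpha>0: "\<alpha>0 \<in> A" "fst \<alpha>0 = n0" by blast
  have range: "fst \<alpha> \<in> {n0..n0 + 3}" if "\<alpha> \<in> A" for \<alpha>
  proof -
    have "n0 \<le> fst \<alpha>" unfolding n0_def using that by (intro Least_le) auto
    moreover have "fst \<alpha> \<le> n0 + 3"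
    proof (rule ccontr)
      assume "\<not> fst \<alpha> \<le> n0 + 3"
      then have "side (fst \<alpha>) \<le> side (n0 + 4)" by (simp add: side_le_iff)
      then have "22 * side (fst \<alpha>) \<le> 22 / 16 * side n0" by (simp add: side_def power_add)
      moreover have "2 * side n0 \<le> 22 * side (fst \<alpha>)" using b[OF \<alpha>0(1)] b[OF that] \<alpha>0(2) by auto
      ultimately show False using side_pos(1)[of n0] by linarith
    qed
    ultimately show ?thesis by simp
  qed
  define I where "I n = {\<lfloor>fst z / side n\<rfloor> - 3..\<lfloor>fst z / side n\<rfloor> + 2} \<times> {\<lfloor>snd z / side n\<rfloor> - 3..\<lfloor>snd z / side n\<rfloor> + 2}" for n
  have sub: "A \<subseteq> Sigma {n0..n0 + 3} I"
  proof
    fix \<alpha> assume \<alpha>: "\<alpha> \<in> A"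
    obtain n i j where nij: "\<alpha> = (n, i, j)" by (cases \<alpha>) auto
    have "z \<in> bigsq (n, i, j)" using \<alpha> nij unfolding A_def by simp
    then have "i \<in> {\<lfloor>fst z / side n\<rfloor> - 3..\<lfloor>fst z / side n\<rfloor> + 2}" "j \<in> {\<lfloor>snd z / side n\<rfloor> - 3..\<lfloor>snd z / side n\<rfloor> + 2}"
      using int_interval_card[of "side n" "fst z"] int_interval_card[of "side n" "snd z"] unfolding bigsq_mem_iff by auto
    then show "\<alpha> \<in> Sigma {n0..n0 + 3} I" using range[OF \<alpha>] by (simp add: nij I_def)
  qed
  have fin: "finite (Sigma {n0..n0 + 3} I)" by (auto simp: I_def)
  have "card (Sigma {n0..n0 + 3} I) = (\<Sum>n\<in>{n0..n0 + 3}. card (I n))"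
    by (rule card_SigmaI) (auto simp: I_def)
  also have "\<dots> = (\<Sum>n\<in>{n0..n0 + 3}. 36)" by (rule sum.cong) (auto simp: I_def card_cartesian_product)
  finally have "card (Sigma {n0..n0 + 3} I) = 144" by simp
  then show ?thesis using card_mono[OF fin sub] finite_subset[OF sub fin] unfolding A_def by simp
qed (simp only: finite.emptyI card.empty, simp)

lemma finite_sq_meeting_bounded:
  assumes "bounded D"
  shows "finite {\<alpha>. fst \<alpha> \<le> N \<and> sq \<alpha> \<inter> D \<noteq> {}}"
proof -
  obtain R where R: "\<And>z. z \<in> D \<Longrightarrow> norm z \<le> R" using assms unfolding bounded_iff by blast
  define k where "k = \<lceil>R * 2 ^ N\<rceil> + 1"
  have bd: "i \<in> {-k..k}" if i: "of_int i * side n \<le> x" "x \<le> (of_int i + 1) * side n" "\<bar>x\<bar> \<le> R" "n \<le> N" for i :: int and n x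
  proof -
    have R0: "0 \<le> R" using that by linarith
    have "x / side n \<le> R * 2 ^ N" "- (R * 2 ^ N) \<le> x / side n"
    proof -
      have "\<bar>x / side n\<bar> = \<bar>x\<bar> * 2 ^ n" by (simp add: side_def abs_mult)
      also have "\<dots> \<le> R * 2 ^ N" using that R0 by (intro mult_mono) auto
      finally show "x / side n \<le> R * 2 ^ N" "- (R * 2 ^ N) \<le> x / side n" by linarith+
    qed
    moreover have "of_int i \<le> x / side n" "x / side n \<le> of_int i + 1"
      using i side_pos(1)[of n] by (simp_all add: pos_le_divide_eq pos_divide_le_eq)
    ultimately have "of_int i \<le> R * 2 ^ N" "- (R * 2 ^ N) \<le> of_int i + 1" by linarith+
    then show ?thesis unfolding k_def by simp linarith
  qed
  have "{\<alpha>. fst \<alpha> \<le> N \<and> sq \<alpha> \<inter> D \<noteq> {}} \<subseteq> {..N} \<times> {-k..k} \<times> {-k..k}"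
  proof
    fix \<alpha> assume "\<alpha> \<in> {\<alpha>. fst \<alpha> \<le> N \<and> sq \<alpha> \<inter> D \<noteq> {}}"
    then obtain z where z: "fst \<alpha> \<le> N" "z \<in> sq \<alpha>" "z \<in> D" by blast
    obtain n i j where nij: "\<alpha> = (n, i, j)" by (cases \<alpha>) auto
    have "\<bar>fst z\<bar> \<le> R" "\<bar>snd z\<bar> \<le> R"
      using R[OF z(3)] norm_fst_le[of "fst z" "snd z"] norm_snd_le[of "snd z" "fst z"] by auto
    then show "\<alpha> \<in> {..N} \<times> {-k..k} \<times> {-k..k}"
      using z bd[of i n "fst z"] bd[of j n "snd z"] unfolding nij sq_mem_iff by simp
  qed
  then show ?thesis by (rule finite_subset) auto
qed

lemma closed_layer: "closed (layer K \<alpha>)"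
proof -
  have "closed (sq \<alpha>)" unfolding sq_def by (cases \<alpha>) (auto intro!: closed_Times)
  moreover have "closed {z. 8 * side (fst \<alpha>) \<le> infdist z K}" "closed {z. infdist z K \<le> 16 * side (fst \<alpha>)}"
    by (intro closed_Collect_le continuous_intros)+
  moreover have "layer K \<alpha> = sq \<alpha> \<inter> {z. 8 * side (fst \<alpha>) \<le> infdist z K} \<inter> {z. infdist z K \<le> 16 * side (fst \<alpha>)}"
    unfolding layer_def by auto
  ultimately show ?thesis by (simp add: closed_Int)
qed

lemma connected_cross:
  assumes "c \<in> bigsq \<alpha>"
  shows "connected (cross c \<alpha>)" "c \<in> cross c \<alpha>"
proof -
  obtain n i j where \<alpha>: "\<alpha> = (n, i, j)" by (cases \<alpha>) auto
  let ?H = "{(of_int i - 2) * side n..(of_int i + 3) * side n} \<times> {snd c}"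
  let ?V = "{fst c} \<times> {(of_int j - 2) * side n..(of_int j + 3) * side n}"
  show c: "c \<in> cross c \<alpha>" using assms by (simp add: cross_def)
  have "cross c \<alpha> = ?H \<union> ?V"
    using assms unfolding cross_def \<alpha> by (auto simp: bigsq_def mem_Times_iff)
  moreover have "connected ?H" "connected ?V" by (intro connected_Times; simp)+
  moreover have "c \<in> ?H \<inter> ?V"
    using assms unfolding \<alpha> bigsq_def by (auto simp: mem_Times_iff)
  ultimately show "connected (cross c \<alpha>)" using connected_Un[of ?H ?V] by auto
qed

text \<open>A common layer point forces the sides to agree up to a factor 2, so either square lies
  within two sides of the common point, measured in the other one. The enlargement by two sides in
  every direction therefore contains the intersection of the horizontal line through
  \<open>c\<close> with the vertical line through \<open>d\<close>.\<close>

lemma cross_meet: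
  assumes "layer K \<alpha> \<inter> layer K \<beta> \<noteq> {}" "c \<in> sq \<alpha>" "d \<in> sq \<beta>"
  shows "cross c \<alpha> \<inter> cross d \<beta> \<noteq> {}"
proof -
  obtain n i j where \<alpha>: "\<alpha> = (n, i, j)" by (cases \<alpha>) auto
  obtain m k l where \<beta>: "\<beta> = (m, k, l)" by (cases \<beta>) auto
  obtain z where z: "z \<in> layer K \<alpha>" "z \<in> layer K \<beta>" using assms(1) by blast
  have s: "side m \<le> 2 * side n" "side n \<le> 2 * side m"
    using z unfolding layer_def \<alpha> \<beta> by auto
  have zs: "z \<in> sq (n, i, j)" "z \<in> sq (m, k, l)" using z unfolding layer_def \<alpha> \<beta> by auto
  have p: "side n > 0" "side m > 0" by auto
  have "(fst d, snd c) \<in> bigsq (n, i, j)" "(fst d, snd c) \<in> bigsq (m, k, l)"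
    using zs s p assms(2,3) unfolding bigsq_mem_iff sq_mem_iff \<alpha> \<beta> by (auto simp: algebra_simps)
  then have "(fst d, snd c) \<in> cross c \<alpha> \<inter> cross d \<beta>" unfolding cross_def \<alpha> \<beta> by simp
  then show ?thesis by blast
qed

section \<open>Null images of the slices of a set accessible through cones\<close>

text \<open>The John condition as it is used: every boundary point \<open>x\<close> can be reached inside the
  twisted cone \<open>{z. dist z x \<le> M * infdist z K}\<close>.\<close>

abbreviation cone_joins :: "real \<Rightarrow> ('a::metric_space) set \<Rightarrow> 'a \<Rightarrow> real \<Rightarrow> real \<Rightarrow> bool" where
  "cone_joins M K x \<rho> \<eta> \<equiv> \<exists>C. compact C \<and> connected C \<and>
        (\<forall>z\<in>C. 0 < infdist z K \<and> infdist z K \<le> \<rho> \<and> dist z x \<le> M * infdist z K) \<and>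
        (\<exists>w\<in>C. infdist w K = \<rho>) \<and> (\<exists>z\<in>C. dist z x \<le> \<eta>)"

text \<open>The set \<open>C\<close> stands for a piece of curve running from distance \<rho> from
  \<open>K\<close> to within \<eta> of \<open>x\<close> without touching \<open>K\<close>. The radii
  needed later are \<open>16 * side n\<close>, the upper ends of the layers; as sides are at most 1,
  they do not exceed 16.\<close>

definition cone_accessible :: "real \<Rightarrow> ('a::metric_space) set \<Rightarrow> bool" where
  "cone_accessible M K \<longleftrightarrow> (\<forall>x\<in>K. \<forall>\<eta>>0. \<forall>\<rho>. 0 < \<rho> \<and> \<rho> \<le> 16 \<longrightarrow>
     cone_joins M K x \<rho> \<eta>)"

text \<open>The terms \<open>c i\<close> define a finite measure on \<open>I\<close>, for which the
  sets of indices of level at least \<open>n\<close> decrease to the empty set.\<close>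

lemma countable_nn_integral_tail:
  fixes c :: "'i \<Rightarrow> ennreal" and lev :: "'i \<Rightarrow> nat"
  assumes "(\<integral>\<^sup>+i. c i \<partial>count_space I) < \<infinity>" "e > 0"
  obtains n0 where "(\<integral>\<^sup>+i. c i \<partial>count_space {i \<in> I. n0 \<le> lev i}) \<le> ennreal e"
proof -
  define \<mu> where "\<mu> = density (count_space I) c"
  have em: "emeasure \<mu> A = (\<integral>\<^sup>+i. c i \<partial>count_space A)" if "A \<subseteq> I" for A
  proof -
    have "emeasure \<mu> A = (\<integral>\<^sup>+i. c i * indicator A i \<partial>count_space I)"
      unfolding \<mu>_def using that by (intro emeasure_density) auto
    also have "\<dots> = (\<integral>\<^sup>+i. c i \<partial>count_space A)"
      by (subst nn_integral_count_space_indicator[of A], simp)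
         (subst nn_integral_count_space_indicator[of I], simp,
          intro nn_integral_cong, use that in \<open>auto simp: indicator_def\<close>)
    finally show ?thesis .
  qed
  define A where "A n = {i \<in> I. n \<le> lev i}" for n
  have "(\<lambda>n. emeasure \<mu> (A n)) \<longlonglongrightarrow> emeasure \<mu> (\<Inter>n. A n)"
  proof (rule Lim_emeasure_decseq)
    fix n
    have "emeasure \<mu> (A n) \<le> emeasure \<mu> I" by (intro emeasure_mono) (auto simp: A_def \<mu>_def)
    then show "emeasure \<mu> (A n) \<noteq> \<infinity>" using em[of I] assms(1) by (auto simp: top_unique)
  qed (auto simp: A_def \<mu>_def decseq_def)
  moreover have "(\<Inter>n. A n) = {}"
  proof -
    have "i \<notin> A (Suc (lev i))" for i by (simp add: A_def)
    then show ?thesis by blast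
  qed
  ultimately have "(\<lambda>n. emeasure \<mu> (A n)) \<longlonglongrightarrow> 0" by simp
  then have "\<forall>\<^sub>F n in sequentially. emeasure \<mu> (A n) < ennreal e"
    using assms(2) by (intro order_tendstoD(2)) auto
  then obtain n where "emeasure \<mu> (A n) < ennreal e" by (auto simp: eventually_sequentially)
  then show ?thesis using that[of n] em[of "A n"] by (auto simp: A_def)
qed

text \<open>A component of the union \<open>W\<close> of the crosses has an interval as image under \<open>f\<close>, so passing to
  the closure of this image only adds the null set \<open>N\<close>.\<close>

lemma negligible_image_on_line:
  fixes f :: "real \<times> real \<Rightarrow> real" and K :: "(real \<times> real) set"
    and ctr :: "nat \<times> int \<times> int \<Rightarrow> real \<times> real" and c :: "nat \<times> int \<times> int \<Rightarrow> ennreal"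
  assumes K: "compact K" and f: "continuous_on UNIV f"
    and M: "M > 0" and acc: "cone_accessible M K"
    and ctr: "\<And>\<alpha>. layer K \<alpha> \<noteq> {} \<Longrightarrow> ctr \<alpha> \<in> sq \<alpha>"
    and osc: "\<And>\<alpha> z w. layer K \<alpha> \<noteq> {} \<Longrightarrow> z \<in> cross (ctr \<alpha>) \<alpha> \<Longrightarrow> w \<in> cross (ctr \<alpha>) \<alpha> \<Longrightarrow> ennreal \<bar>f z - f w\<bar> \<le> c \<alpha>"
    and fin: "(\<integral>\<^sup>+\<alpha>. c \<alpha> \<partial>count_space {(n, i, j). layer K (n, i, j) \<noteq> {} \<and> \<bar>t - of_int j * side n\<bar> \<le> (16 * M + 1) * side n}) < \<infinity>"
  shows "negligible (f ` (K \<inter> UNIV \<times> {t}))"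
proof -
  define \<Lambda> where "\<Lambda> = {(n, i, j). layer K (n, i, j) \<noteq> {} \<and> \<bar>t - of_int j * side n\<bar> \<le> (16 * M + 1) * side n}"
  define S where "S = f ` (K \<inter> UNIV \<times> {t})"
  have "compact S" unfolding S_def using K f
    by (intro compact_continuous_image compact_Int_closed closed_Times closed_UNIV closed_singleton)
      (auto intro: continuous_on_subset)
  then have Sb: "S \<in> sets borel" by (auto intro: borel_compact)
  have "emeasure lborel S \<le> ennreal e" if e: "e > 0" for e
  proof -
    obtain n0 where n0: "(\<integral>\<^sup>+\<alpha>. c \<alpha> \<partial>count_space {\<alpha> \<in> \<Lambda>. n0 \<le> fst \<alpha>}) \<le> ennreal e"
      using countable_nn_integral_tail[OF fin[folded \<Lambda>_def] e] by metis
    define L where "L = {\<alpha> \<in> \<Lambda>. n0 \<le> fst \<alpha>}"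
    have Lne: "layer K \<alpha> \<noteq> {}" if "\<alpha> \<in> L" for \<alpha> using that unfolding L_def \<Lambda>_def by auto
    define X where "X \<alpha> = cross (ctr \<alpha>) \<alpha>" for \<alpha>
    have X: "connected (X \<alpha>)" "ctr \<alpha> \<in> X \<alpha>" if "\<alpha> \<in> L" for \<alpha>
      using connected_cross[of "ctr \<alpha>" \<alpha>] ctr[OF Lne[OF that]] sq_subset_bigsq[of \<alpha>] unfolding X_def by auto
    define W where "W = (\<Union>\<alpha>\<in>L. X \<alpha>)"
    define Co where "Co \<alpha> = connected_component_set W (ctr \<alpha>)" for \<alpha>
    have XW: "X \<alpha> \<subseteq> W" if "\<alpha> \<in> L" for \<alpha> using that unfolding W_def by blast
    have XCo: "X \<alpha> \<subseteq> Co \<alpha>" if "\<alpha> \<in> L" for \<alpha>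
      unfolding Co_def using X[OF that] XW[OF that] by (intro connected_component_maximal)
    have Co_eq: "Co \<alpha> = Co \<beta>" if ab: "\<alpha> \<in> L" "\<beta> \<in> L" "layer K \<alpha> \<inter> layer K \<beta> \<noteq> {}" for \<alpha> \<beta>
    proof -
      obtain z where "z \<in> X \<alpha>" "z \<in> X \<beta>"
        using cross_meet[OF ab(3) ctr ctr] Lne ab(1,2) unfolding X_def by blast
      then have "z \<in> Co \<alpha>" "z \<in> Co \<beta>" using XCo ab(1,2) by blast+
      then show ?thesis unfolding Co_def by (metis connected_component_eq)
    qed
    define N where "N = (\<Union>\<alpha>\<in>L. frontier (f ` Co \<alpha>))"
    have "negligible N" unfolding N_def
    proof (rule negligible_countable_Union)
      show "countable ((\<lambda>\<alpha>. frontier (f ` Co \<alpha>)) ` L)" by (intro countable_image) simp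
      fix s assume "s \<in> (\<lambda>\<alpha>. frontier (f ` Co \<alpha>)) ` L"
      then obtain \<alpha> where s: "s = frontier (f ` Co \<alpha>)" by blast
      have "connected (f ` Co \<alpha>)" unfolding Co_def using f
        by (intro connected_continuous_image) (auto intro: continuous_on_subset)
      then have "convex (f ` Co \<alpha>)" by (simp add: is_interval_connected_1 is_interval_convex_1[symmetric])
      then show "negligible s" unfolding s by (rule negligible_convex_frontier)
    qed
    obtain B where B: "B \<in> sets borel" "(\<Union>\<alpha>\<in>L. f ` X \<alpha>) \<subseteq> B"
        "emeasure lborel B \<le> (\<integral>\<^sup>+\<alpha>. c \<alpha> \<partial>count_space L)"
    proof (rule borel_cover_UN[of L "\<lambda>\<alpha>. f ` X \<alpha>" c])
      fix \<alpha> x y assume "\<alpha> \<in> L" "x \<in> f ` X \<alpha>" "y \<in> f ` X \<alpha>" "x \<le> y"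
      then obtain z w where "z \<in> X \<alpha>" "w \<in> X \<alpha>" "x = f w" "y = f z" by blast
      then show "ennreal (y - x) \<le> c \<alpha>" using osc[OF Lne[OF \<open>\<alpha> \<in> L\<close>], of z w] \<open>x \<le> y\<close> unfolding X_def by simp
    qed auto
    have fCoB: "f ` Co \<alpha> \<subseteq> B" if "\<alpha> \<in> L" for \<alpha>
    proof -
      have "Co \<alpha> \<subseteq> W" unfolding Co_def by (rule connected_component_subset)
      then show ?thesis using B(2) unfolding W_def by blast
    qed
    have "S \<subseteq> B \<union> N"
    proof
      fix v assume "v \<in> S"
      then obtain x where x: "x \<in> K" "snd x = t" "v = f x" unfolding S_def by auto
      define \<rho> where "\<rho> = 16 * side n0"
      have \<rho>: "0 < \<rho>" "\<rho> \<le> 16" unfolding \<rho>_def using side_le_iff[of n0 0] by (auto simp: side_def[of 0])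
      \<comment> \<open>These are the squares of level exactly \<open>n0\<close> in which a curve
        ending near \<open>x\<close> can start. They form a finite set that does not depend on how
        close to \<open>x\<close> the curve ends, and closure commutes with finite unions; so
        \<open>f x\<close> lies in the closure of the image of a single component.\<close>
      define F where "F = {\<alpha> \<in> L. fst \<alpha> \<le> n0 \<and> sq \<alpha> \<inter> cball x (M * \<rho>) \<noteq> {}}"
      have finF: "finite F"
        using finite_sq_meeting_bounded[OF bounded_cball, of n0 x "M * \<rho>"] unfolding F_def
        by (rule rev_finite_subset) auto
      have "f x \<in> closure (\<Union>\<alpha>\<in>F. f ` Co \<alpha>)"
        unfolding closure_approachable
      proof (intro allI impI)
        fix e' :: real assume "e' > 0"
        then obtain \<delta> where \<delta>: "\<delta> > 0" "\<And>z. dist z x < \<delta> \<Longrightarrow> dist (f z) (f x) < e'"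
          using f unfolding continuous_on_iff by (metis UNIV_I)
        obtain C where C: "compact C" "connected C"
          "\<And>z. z \<in> C \<Longrightarrow> 0 < infdist z K \<and> infdist z K \<le> \<rho> \<and> dist z x \<le> M * infdist z K"
          "\<exists>w\<in>C. infdist w K = \<rho>" "\<exists>z\<in>C. dist z x \<le> \<delta> / 4"
          using acc[unfolded cone_accessible_def, rule_format, OF x(1), of "\<delta> / 4" \<rho>] \<delta>(1) \<rho> by auto
        \<comment> \<open>In the constant \<open>16 * M + 1\<close>, the part \<open>16 * M\<close>
          comes from the cone condition in a layer, and 1 from the height of \<open>z\<close> above
          the lower edge of its square.\<close>
        have inL: "\<alpha> \<in> L" if that: "n0 \<le> fst \<alpha>" "z \<in> layer K \<alpha>" "z \<in> C" for \<alpha> z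
        proof -
          obtain n i j where nij: "\<alpha> = (n, i, j)" by (cases \<alpha>) auto
          have z: "z \<in> sq (n, i, j)" "infdist z K \<le> 16 * side n" using that(2) unfolding layer_def nij by auto
          have "\<bar>snd z - t\<bar> \<le> dist z x"
            using dist_snd_le[of z x] x(2) by (simp add: dist_real_def)
          also have "\<dots> \<le> M * infdist z K" using C(3)[OF that(3)] by simp
          also have "\<dots> \<le> M * (16 * side n)" using z(2) M by (intro mult_left_mono) auto
          finally have "\<bar>snd z - t\<bar> \<le> 16 * M * side n" by (simp add: algebra_simps)
          moreover have "\<bar>snd z - of_int j * side n\<bar> \<le> side n"
            using z(1) unfolding sq_mem_iff by (auto simp: algebra_simps abs_le_iff)
          ultimately have "\<bar>t - of_int j * side n\<bar> \<le> (16 * M + 1) * side n"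
            unfolding distrib_right by linarith
          then show ?thesis using that unfolding L_def \<Lambda>_def nij by auto
        qed
        obtain w where w: "w \<in> C" "infdist w K = \<rho>" using C(4) by blast
        obtain i0 j0 where ij0: "w \<in> sq (n0, i0, j0)" using in_some_sq by blast
        define \<alpha>0 where "\<alpha>0 = (n0, i0, j0)"
        have w0: "w \<in> layer K \<alpha>0" unfolding layer_def \<alpha>0_def using ij0 w(2) side_pos(1)[of n0] by (simp add: \<rho>_def)
        have \<alpha>0L: "\<alpha>0 \<in> L" using inL[of \<alpha>0 w] w w0 by (simp add: \<alpha>0_def)
        have "w \<in> cball x (M * \<rho>)" using C(3)[OF w(1)] w(2) by (simp add: dist_commute)
        then have \<alpha>0F: "\<alpha>0 \<in> F" using \<alpha>0L ij0 unfolding F_def by (auto simp: \<alpha>0_def)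
        obtain z1 where z1: "z1 \<in> C" "dist z1 x \<le> \<delta> / 4" using C(5) by blast
        obtain \<alpha>1 where \<alpha>1: "n0 \<le> fst \<alpha>1" "z1 \<in> layer K \<alpha>1"
          using in_some_layer[of z1 K n0] C(3)[OF z1(1)] unfolding \<rho>_def by blast
        have \<alpha>1L: "\<alpha>1 \<in> L" using inL \<alpha>1 z1(1) by blast
        define A where "A = {\<alpha> \<in> L. layer K \<alpha> \<inter> C \<noteq> {}}"
        \<comment> \<open>The distance to \<open>K\<close> has a positive minimum on the compact set
          \<open>C\<close>, which bounds the levels of the squares from above; the boundedness of
          \<open>C\<close> then leaves finitely many.\<close>
        have finA: "finite A"
        proof -
          have "C \<noteq> {}" using w by blast
          moreover have "continuous_on C (\<lambda>z. infdist z K)" by (intro continuous_intros)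
          ultimately obtain zm where zm: "zm \<in> C" "\<And>z. z \<in> C \<Longrightarrow> infdist zm K \<le> infdist z K"
            using continuous_attains_inf[OF C(1)] by blast
          have "0 < infdist zm K / 16" using C(3)[OF zm(1)] by simp
          then obtain m where m: "(1/2::real) ^ m < infdist zm K / 16"
            using real_arch_pow_inv[of "infdist zm K / 16" "1/2"] by auto
          have "fst \<alpha> \<le> m" if \<alpha>A: "\<alpha> \<in> A" for \<alpha>
          proof -
            obtain z where z: "z \<in> layer K \<alpha>" "z \<in> C" using \<alpha>A unfolding A_def by blast
            have "side m < side (fst \<alpha>)" using m zm(2)[OF z(2)] z(1) unfolding layer_def
              by (simp add: side_def power_one_over)
            then have "\<not> m \<le> fst \<alpha>" using side_le_iff[of "fst \<alpha>" m] by linarith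
            then show ?thesis by simp
          qed
          then have "A \<subseteq> {\<alpha>. fst \<alpha> \<le> m \<and> sq \<alpha> \<inter> C \<noteq> {}}" unfolding A_def layer_def by blast
          then show ?thesis
            using finite_sq_meeting_bounded[OF compact_imp_bounded[OF C(1)]] finite_subset by blast
        qed
        \<comment> \<open>The curve is split according to the component reached. Both parts are
          closed by finiteness of \<open>A\<close>; they are disjoint on \<open>C\<close> because
          squares with a common layer point have meeting crosses. Connectedness of \<open>C\<close>
          makes the second part empty, so the square near \<open>x\<close> belongs to the same
          component as the starting square.\<close>
        define T1 where "T1 = (\<Union>\<alpha>\<in>{\<alpha>\<in>A. Co \<alpha> = Co \<alpha>0}. layer K \<alpha>)"
        define T2 where "T2 = (\<Union>\<alpha>\<in>{\<alpha>\<in>A. Co \<alpha> \<noteq> Co \<alpha>0}. layer K \<alpha>)"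
        have "closed T1" "closed T2" unfolding T1_def T2_def
          using finA by (auto intro!: closed_UN closed_layer)
        moreover have "C \<subseteq> T1 \<union> T2"
        proof
          fix z assume z: "z \<in> C"
          obtain \<alpha> where \<alpha>: "n0 \<le> fst \<alpha>" "z \<in> layer K \<alpha>"
            using in_some_layer[of z K n0] C(3)[OF z] unfolding \<rho>_def by blast
          then have "\<alpha> \<in> A" using inL[OF \<alpha> z] z unfolding A_def by blast
          then show "z \<in> T1 \<union> T2" using \<alpha> unfolding T1_def T2_def by blast
        qed
        moreover have "T1 \<inter> T2 \<inter> C = {}"
        proof (rule ccontr)
          assume "T1 \<inter> T2 \<inter> C \<noteq> {}"
          then obtain z \<alpha> \<beta> where "z \<in> layer K \<alpha>" "z \<in> layer K \<beta>" "\<alpha> \<in> A" "\<beta> \<in> A" "Co \<alpha> = Co \<alpha>0" "Co \<beta> \<noteq> Co \<alpha>0"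
            unfolding T1_def T2_def by blast
          then show False using Co_eq[of \<alpha> \<beta>] unfolding A_def by blast
        qed
        moreover have "T1 \<inter> C \<noteq> {}"
          using w w0 \<alpha>0L unfolding T1_def A_def by blast
        ultimately have "T2 \<inter> C = {}" using connected_closedD[OF C(2)] by blast
        moreover have "\<alpha>1 \<in> A" using \<alpha>1L \<alpha>1 z1 unfolding A_def by blast
        ultimately have Co1: "Co \<alpha>1 = Co \<alpha>0" using \<alpha>1 z1 unfolding T2_def by blast
        have cc: "ctr \<alpha>1 \<in> sq \<alpha>1" using ctr Lne \<alpha>1L by blast
        \<comment> \<open>Being within \<open>\<delta> / 4\<close> of a point of \<open>K\<close>
          bounds \<open>8 * side\<close> by \<open>\<delta> / 4\<close>, so the centre of the cross
          is within \<open>\<delta> / 16\<close> of \<open>z1\<close> and hence within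
          \<open>\<delta>\<close> of \<open>x\<close>.\<close>
        have "infdist z1 K \<le> dist z1 x" using x(1) by (rule infdist_le)
        then have "side (fst \<alpha>1) \<le> \<delta> / 32" using \<alpha>1(2) z1(2) unfolding layer_def by simp
        moreover have "dist (ctr \<alpha>1) z1 \<le> 2 * side (fst \<alpha>1)"
          using \<alpha>1(2) cc by (intro dist_sq_sq) (auto simp: layer_def)
        ultimately have "dist (ctr \<alpha>1) x < \<delta>"
          using dist_triangle[of "ctr \<alpha>1" x z1] z1(2) \<delta>(1) by linarith
        then have "dist (f (ctr \<alpha>1)) (f x) < e'" by (rule \<delta>(2))
        moreover have "ctr \<alpha>1 \<in> Co \<alpha>0" using XCo[OF \<alpha>1L] X(2)[OF \<alpha>1L] Co1 by blast
        ultimately show "\<exists>y\<in>\<Union>\<alpha>\<in>F. f ` Co \<alpha>. dist y (f x) < e'" using \<alpha>0F by blast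
      qed
      also have "closure (\<Union>\<alpha>\<in>F. f ` Co \<alpha>) = (\<Union>\<alpha>\<in>F. closure (f ` Co \<alpha>))"
        using finF by (induction F rule: finite_induct) (auto simp: closure_Un)
      finally obtain \<alpha> where \<alpha>: "\<alpha> \<in> F" "f x \<in> closure (f ` Co \<alpha>)" by blast
      then have "\<alpha> \<in> L" unfolding F_def by blast
      have "f x \<in> f ` Co \<alpha> \<or> f x \<in> frontier (f ` Co \<alpha>)"
        using \<alpha>(2) interior_subset[of "f ` Co \<alpha>"] unfolding frontier_def by blast
      then show "v \<in> B \<union> N" using fCoB[OF \<open>\<alpha> \<in> L\<close>] \<open>\<alpha> \<in> L\<close> x(3) unfolding N_def by blast
    qed
    then have "emeasure lborel S \<le> emeasure lborel B"
      using Sb B(1) \<open>negligible N\<close> by (intro emeasure_le_if_subset_Un_negligible)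
    also have "\<dots> \<le> ennreal e" using B(3) n0 unfolding L_def by (rule order_trans)
    finally show ?thesis .
  qed
  then show ?thesis unfolding S_def[symmetric]
    using Sb by (intro negligible_if_borel_covers) auto
qed

section \<open>Choice of the crosses and summability of their oscillations\<close>

lemma exists_below_average:
  fixes \<phi> :: "real \<Rightarrow> ennreal"
  assumes [measurable]: "\<phi> \<in> borel_measurable borel" and ab: "a < b"
    and P: "AE y in lborel. P y"
    and H: "(\<integral>\<^sup>+y\<in>{a..b}. \<phi> y \<partial>lborel) \<le> H" "H < \<infinity>"
  obtains y where "y \<in> {a..b}" "P y" "\<phi> y \<le> ennreal (1 / (b - a)) * H"
proof (rule ccontr)
  assume "\<not> thesis"
  with that have no: "\<not> \<phi> y \<le> ennreal (1 / (b - a)) * H" if "y \<in> {a..b}" "P y" for y using that by blast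
  \<comment> \<open>This is the mean value of \<open>H\<close> over the interval. If no admissible
    \<open>y\<close> stayed below it, then \<open>\<phi>\<close> would exceed it almost everywhere
    and the integral would be strictly larger than \<open>H\<close>.\<close>
  define c where "c = ennreal (1 / (b - a)) * H"
  have less: "AE y in lborel. y \<in> {a..b} \<longrightarrow> c < \<phi> y"
    using P by eventually_elim (use no in \<open>auto simp: c_def not_le\<close>)
  have Ic: "(\<integral>\<^sup>+y. c * indicator {a..b} y \<partial>lborel) = H"
  proof -
    have "(\<integral>\<^sup>+y. c * indicator {a..b} y \<partial>lborel) = c * ennreal (b - a)"
      using ab by (subst nn_integral_cmult_indicator) auto
    also have "\<dots> = (ennreal (1 / (b - a)) * ennreal (b - a)) * H"
      unfolding c_def by (simp add: ac_simps)
    also have "ennreal (1 / (b - a)) * ennreal (b - a) = 1"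
      using ab by (subst ennreal_mult[symmetric]) auto
    finally show ?thesis by simp
  qed
  have "(\<integral>\<^sup>+y. c * indicator {a..b} y \<partial>lborel) < (\<integral>\<^sup>+y. \<phi> y * indicator {a..b} y \<partial>lborel)"
  proof (rule nn_integral_less)
    show "(\<integral>\<^sup>+y. c * indicator {a..b} y \<partial>lborel) \<noteq> \<infinity>" unfolding Ic using H(2) by simp
    show "AE y in lborel. c * indicator {a..b} y \<le> \<phi> y * indicator {a..b} y"
      using less by eventually_elim (auto simp: indicator_def)
    show "\<not> (AE y in lborel. \<phi> y * indicator {a..b} y \<le> c * indicator {a..b} y)"
    proof
      assume "AE y in lborel. \<phi> y * indicator {a..b} y \<le> c * indicator {a..b} y"
      with less have "AE y in lborel. y \<notin> {a..b}"
        by eventually_elim (auto simp: indicator_def)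
      then have "emeasure lborel {a..b} = 0"
        by (subst (asm) AE_iff_measurable[of "{a..b}"]) auto
      then show False using ab by simp
    qed
  qed auto
  then show False using H(1) unfolding Ic by simp
qed

definition osc_bound_x :: "(real \<times> real) set \<Rightarrow> (real \<times> real \<Rightarrow> ennreal) \<Rightarrow> (real \<times> real \<Rightarrow> real) \<Rightarrow> real \<Rightarrow> bool" where
  "osc_bound_x K h f t \<longleftrightarrow> (\<forall>p q. p \<le> q \<longrightarrow> {p..q} \<times> {t} \<inter> K = {} \<longrightarrow>
     ennreal \<bar>f (q, t) - f (p, t)\<bar> \<le> (\<integral>\<^sup>+s\<in>{p..q}. h (s, t) \<partial>lborel))"

definition osc_bound_y :: "(real \<times> real) set \<Rightarrow> (real \<times> real \<Rightarrow> ennreal) \<Rightarrow> (real \<times> real \<Rightarrow> real) \<Rightarrow> real \<Rightarrow> bool" where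
  "osc_bound_y K h f s \<longleftrightarrow> (\<forall>p q. p \<le> q \<longrightarrow> {s} \<times> {p..q} \<inter> K = {} \<longrightarrow>
     ennreal \<bar>f (s, q) - f (s, p)\<bar> \<le> (\<integral>\<^sup>+t\<in>{p..q}. h (s, t) \<partial>lborel))"

text \<open>The integral over \<open>bigsq\<close> is sliced by lines, and the height of the
  horizontal arm is chosen below average among heights meeting the small square, an interval of
  length \<open>side\<close>; likewise for the vertical arm. The slices have the full width of
  \<open>bigsq\<close>, so the bound holds along entire arms. Two points of the cross are compared
  through its centre, hence the factor 2.\<close>

lemma exists_good_cross:
  fixes h :: "real \<times> real \<Rightarrow> ennreal" and f :: "real \<times> real \<Rightarrow> real"
  assumes [measurable]: "h \<in> borel_measurable borel"
    and x: "AE t in lborel. osc_bound_x K h f t" and y: "AE s in lborel. osc_bound_y K h f s"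
    and ne: "layer K \<alpha> \<noteq> {}" and fin: "(\<integral>\<^sup>+z\<in>bigsq \<alpha>. h z \<partial>lborel) < \<infinity>"
  shows "\<exists>c \<in> sq \<alpha>. \<forall>z \<in> cross c \<alpha>. \<forall>w \<in> cross c \<alpha>.
    ennreal \<bar>f z - f w\<bar> \<le> 2 * (ennreal (1 / side (fst \<alpha>)) * (\<integral>\<^sup>+z\<in>bigsq \<alpha>. h z \<partial>lborel))"
proof -
  obtain n i j where \<alpha>: "\<alpha> = (n, i, j)" by (cases \<alpha>) auto
  define H where "H = (\<integral>\<^sup>+z\<in>bigsq \<alpha>. h z \<partial>lborel)"
  define Ix where "Ix = {(of_int i - 2) * side n..(of_int i + 3) * side n}"
  define Iy where "Iy = {(of_int j - 2) * side n..(of_int j + 3) * side n}"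
  have big: "bigsq \<alpha> = Ix \<times> Iy" unfolding \<alpha> bigsq_def Ix_def Iy_def by simp
  have sp: "side n > 0" by simp
  have mI[measurable]: "Ix \<in> sets borel" "Iy \<in> sets borel" unfolding Ix_def Iy_def by auto
  have hm[measurable]: "h \<in> borel_measurable (lborel \<Otimes>\<^sub>M lborel)" unfolding lborel_prod by simp
  have Hx: "(\<integral>\<^sup>+t. (\<integral>\<^sup>+s. h (s, t) * indicator Ix s \<partial>lborel) * indicator Iy t \<partial>lborel) = H"
  proof -
    have "H = (\<integral>\<^sup>+z. h z * indicator Ix (fst z) * indicator Iy (snd z) \<partial>(lborel \<Otimes>\<^sub>M lborel))"
      unfolding H_def big lborel_prod by (intro nn_integral_cong) (auto simp: indicator_def)
    also have "\<dots> = (\<integral>\<^sup>+t. (\<integral>\<^sup>+s. h (s, t) * indicator Ix s * indicator Iy t \<partial>lborel) \<partial>lborel)"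
      by (subst lborel_pair.nn_integral_snd[symmetric]) auto
    also have "\<dots> = (\<integral>\<^sup>+t. (\<integral>\<^sup>+s. h (s, t) * indicator Ix s \<partial>lborel) * indicator Iy t \<partial>lborel)"
      by (intro nn_integral_cong nn_integral_multc) auto
    finally show ?thesis by simp
  qed
  have Hy: "(\<integral>\<^sup>+s. (\<integral>\<^sup>+t. h (s, t) * indicator Iy t \<partial>lborel) * indicator Ix s \<partial>lborel) = H"
  proof -
    have "H = (\<integral>\<^sup>+z. h z * indicator Iy (snd z) * indicator Ix (fst z) \<partial>(lborel \<Otimes>\<^sub>M lborel))"
      unfolding H_def big lborel_prod by (intro nn_integral_cong) (auto simp: indicator_def)
    also have "\<dots> = (\<integral>\<^sup>+s. (\<integral>\<^sup>+t. h (s, t) * indicator Iy t * indicator Ix s \<partial>lborel) \<partial>lborel)"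
      by (subst lborel.nn_integral_fst[symmetric]) auto
    also have "\<dots> = (\<integral>\<^sup>+s. (\<integral>\<^sup>+t. h (s, t) * indicator Iy t \<partial>lborel) * indicator Ix s \<partial>lborel)"
      by (intro nn_integral_cong nn_integral_multc) auto
    finally show ?thesis by simp
  qed
  have Hfin: "H < \<infinity>" using fin unfolding H_def .
  have len: "(of_int k + 1) * side n - of_int k * side n = side n" for k :: int
    by (simp add: algebra_simps)
  have lt: "of_int k * side n < (of_int k + 1) * side n" for k :: int
    using sp by (simp add: algebra_simps)
  obtain y0 where y0: "y0 \<in> {of_int j * side n..(of_int j + 1) * side n}" "osc_bound_x K h f y0"
    "(\<integral>\<^sup>+s. h (s, y0) * indicator Ix s \<partial>lborel) \<le> ennreal (1 / side n) * H"
  proof (rule exists_below_average[OF _ lt[of j] x _ Hfin, of "\<lambda>t. \<integral>\<^sup>+s. h (s, t) * indicator Ix s \<partial>lborel"])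
    have "{of_int j * side n..(of_int j + 1) * side n} \<subseteq> Iy"
      unfolding Iy_def using sp by (auto simp: algebra_simps)
    then show "(\<integral>\<^sup>+t\<in>{of_int j * side n..(of_int j + 1) * side n}. (\<integral>\<^sup>+s. h (s, t) * indicator Ix s \<partial>lborel) \<partial>lborel) \<le> H"
      unfolding Hx[symmetric] by (intro nn_integral_mono) (auto simp: indicator_def)
  qed (auto simp: len)
  obtain x0 where x0: "x0 \<in> {of_int i * side n..(of_int i + 1) * side n}" "osc_bound_y K h f x0"
    "(\<integral>\<^sup>+t. h (x0, t) * indicator Iy t \<partial>lborel) \<le> ennreal (1 / side n) * H"
  proof (rule exists_below_average[OF _ lt[of i] y _ Hfin, of "\<lambda>s. \<integral>\<^sup>+t. h (s, t) * indicator Iy t \<partial>lborel"])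
    have "{of_int i * side n..(of_int i + 1) * side n} \<subseteq> Ix"
      unfolding Ix_def using sp by (auto simp: algebra_simps)
    then show "(\<integral>\<^sup>+s\<in>{of_int i * side n..(of_int i + 1) * side n}. (\<integral>\<^sup>+t. h (s, t) * indicator Iy t \<partial>lborel) \<partial>lborel) \<le> H"
      unfolding Hy[symmetric] by (intro nn_integral_mono) (auto simp: indicator_def)
  qed (auto simp: len)
  define c where "c = (x0, y0)"
  have c: "c \<in> sq \<alpha>" unfolding c_def \<alpha> sq_mem_iff using x0(1) y0(1) by simp
  then have c': "x0 \<in> Ix" "y0 \<in> Iy" using sq_subset_bigsq[of \<alpha>] unfolding big c_def by auto
  have disj: "bigsq \<alpha> \<inter> K = {}" using ne by (rule bigsq_disjoint)
  have bx: "ennreal \<bar>f (q, y0) - f (p, y0)\<bar> \<le> ennreal (1 / side n) * H" if "p \<in> Ix" "q \<in> Ix" "p \<le> q" for p q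
  proof -
    have sub: "{p..q} \<subseteq> Ix" using that unfolding Ix_def by auto
    then have "{p..q} \<times> {y0} \<inter> K = {}" using disj c' unfolding big by blast
    then have "ennreal \<bar>f (q, y0) - f (p, y0)\<bar> \<le> (\<integral>\<^sup>+s\<in>{p..q}. h (s, y0) \<partial>lborel)"
      using y0(2) that(3) unfolding osc_bound_x_def by blast
    also have "\<dots> \<le> (\<integral>\<^sup>+s. h (s, y0) * indicator Ix s \<partial>lborel)"
      using sub by (intro nn_integral_mono) (auto simp: indicator_def)
    finally show ?thesis using y0(3) by (rule order_trans)
  qed
  have bY: "ennreal \<bar>f (x0, q) - f (x0, p)\<bar> \<le> ennreal (1 / side n) * H" if "p \<in> Iy" "q \<in> Iy" "p \<le> q" for p q
  proof -
    have sub: "{p..q} \<subseteq> Iy" using that unfolding Iy_def by auto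
    then have "{x0} \<times> {p..q} \<inter> K = {}" using disj c' unfolding big by blast
    then have "ennreal \<bar>f (x0, q) - f (x0, p)\<bar> \<le> (\<integral>\<^sup>+t\<in>{p..q}. h (x0, t) \<partial>lborel)"
      using x0(2) that(3) unfolding osc_bound_y_def by blast
    also have "\<dots> \<le> (\<integral>\<^sup>+t. h (x0, t) * indicator Iy t \<partial>lborel)"
      using sub by (intro nn_integral_mono) (auto simp: indicator_def)
    finally show ?thesis using x0(3) by (rule order_trans)
  qed
  have one: "ennreal \<bar>f z - f c\<bar> \<le> ennreal (1 / side n) * H" if z: "z \<in> cross c \<alpha>" for z
  proof -
    have zb: "fst z \<in> Ix" "snd z \<in> Iy" "fst z = x0 \<or> snd z = y0"
      using z unfolding cross_def big c_def by (auto simp: mem_Times_iff)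
    show ?thesis
    proof (cases "fst z = x0")
      case True
      then have z: "z = (x0, snd z)" by (metis prod.collapse)
      show ?thesis
        using bY[of y0 "snd z"] bY[of "snd z" y0] zb c' unfolding c_def
        by (subst z, cases "y0 \<le> snd z") (auto simp: abs_minus_commute)
    next
      case False
      then have z: "z = (fst z, y0)" using zb by (metis prod.collapse)
      show ?thesis
        using bx[of x0 "fst z"] bx[of "fst z" x0] zb c' unfolding c_def
        by (subst z, cases "x0 \<le> fst z") (auto simp: abs_minus_commute)
    qed
  qed
  have "ennreal \<bar>f z - f w\<bar> \<le> 2 * (ennreal (1 / side n) * H)" if zw: "z \<in> cross c \<alpha>" "w \<in> cross c \<alpha>" for z w
  proof -
    have "ennreal \<bar>f z - f w\<bar> \<le> ennreal (\<bar>f z - f c\<bar> + \<bar>f w - f c\<bar>)" by (intro ennreal_leI) linarith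
    also have "\<dots> = ennreal \<bar>f z - f c\<bar> + ennreal \<bar>f w - f c\<bar>" by (intro ennreal_plus) auto
    also have "\<dots> \<le> 2 * (ennreal (1 / side n) * H)" unfolding mult_2 using zw by (intro add_mono one)
    finally show ?thesis .
  qed
  then show ?thesis using c unfolding H_def \<alpha> fst_conv by blast
qed

text \<open>By Tonelli it suffices to integrate the sum over \<open>t\<close>. The heights counting
  the square form an interval of length \<open>2 * C * side\<close>, which cancels the factor
  \<open>1 / side\<close> and leaves \<open>4 * C\<close> times the sum of the integrals over the
  enlarged squares. Their overlap is at most 144 and they lie in a fixed ball.\<close>

lemma AE_finite_cross_sum:
  fixes h :: "real \<times> real \<Rightarrow> ennreal"
  assumes [measurable]: "h \<in> borel_measurable borel" and K: "compact K" "K \<noteq> {}"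
    and fin: "\<And>R. (\<integral>\<^sup>+z\<in>cball 0 R. h z \<partial>lborel) < \<infinity>" and C: "C \<ge> 0"
  shows "AE t in lborel. (\<integral>\<^sup>+\<alpha>. 2 * (ennreal (1 / side (fst \<alpha>)) * (\<integral>\<^sup>+z\<in>bigsq \<alpha>. h z \<partial>lborel))
    \<partial>count_space {(n, i, j). layer K (n, i, j) \<noteq> {} \<and> \<bar>t - of_int j * side n\<bar> \<le> C * side n}) < \<infinity>"
proof -
  define \<Lambda> where "\<Lambda> = {\<alpha>. layer K \<alpha> \<noteq> {}}"
  define H where "H \<alpha> = (\<integral>\<^sup>+z\<in>bigsq \<alpha>. h z \<partial>lborel)" for \<alpha>
  define c where "c \<alpha> = 2 * (ennreal (1 / side (fst \<alpha>)) * H \<alpha>)" for \<alpha>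
  define J where "J = (\<lambda>(n, i::int, j::int). {of_int j * side n - C * side n..of_int j * side n + C * side n})"
  have [measurable]: "cball (0 :: real \<times> real) r \<in> sets borel" for r by (intro borel_closed closed_cball)
  have Jb[measurable]: "J \<alpha> \<in> sets borel" for \<alpha> by (cases \<alpha>) (auto simp: J_def)
  have bb[measurable]: "bigsq \<alpha> \<in> sets borel" for \<alpha>
    unfolding bigsq_def by (cases \<alpha>) (auto intro!: borel_closed closed_Times)
  define T where "T t = (\<integral>\<^sup>+\<alpha>. c \<alpha> * indicator (J \<alpha>) t \<partial>count_space \<Lambda>)" for t
  have Teq: "(\<integral>\<^sup>+\<alpha>. c \<alpha> \<partial>count_space {(n, i, j). layer K (n, i, j) \<noteq> {} \<and> \<bar>t - of_int j * side n\<bar> \<le> C * side n}) = T t" for t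
    unfolding T_def
    by (subst (1 2) nn_integral_count_space_indicator)
       (auto intro!: nn_integral_cong simp: \<Lambda>_def J_def indicator_def abs_le_iff algebra_simps)
  have Tm: "T \<in> borel_measurable borel"
  proof -
    interpret sigma_finite_measure "count_space \<Lambda>"
      by (rule sigma_finite_measure_count_space_countable) simp
    have "(\<lambda>p. c (snd p) * indicator (J (snd p)) (fst p)) \<in> borel_measurable (borel \<Otimes>\<^sub>M count_space \<Lambda>)"
      by (rule measurable_compose_countable'[where f = "\<lambda>\<alpha> p. c \<alpha> * indicator (J \<alpha>) (fst p)" and g = snd and I = \<Lambda>]) auto
    then show ?thesis unfolding T_def[abs_def]
      by (intro borel_measurable_nn_integral) (simp add: case_prod_beta')
  qed
  obtain R0 where R0: "\<And>z. z \<in> K \<Longrightarrow> norm z \<le> R0" using compact_imp_bounded[OF K(1)] unfolding bounded_iff by blast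
  \<comment> \<open>A point of such an enlarged square has distance at most 22 sides from
    \<open>K\<close>, and sides are at most 1.\<close>
  have inD: "bigsq \<alpha> \<subseteq> cball 0 (R0 + 22)" if "\<alpha> \<in> \<Lambda>" for \<alpha>
  proof
    fix z assume z: "z \<in> bigsq \<alpha>"
    have "infdist z K \<le> 22 * side (fst \<alpha>)" using infdist_bigsq(2)[OF _ z] that unfolding \<Lambda>_def by blast
    also have "\<dots> \<le> 22" using side_le_iff[of "fst \<alpha>" 0] by (simp add: side_def[of 0])
    finally have le: "infdist z K \<le> 22" .
    obtain k where k: "k \<in> K" "infdist z K = dist z k"
      using infdist_attains_inf[OF compact_imp_closed[OF K(1)] K(2)] by metis
    have "norm z \<le> norm k + dist z k" using norm_triangle_ineq[of k "z - k"] by (simp add: dist_norm)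
    then show "z \<in> cball 0 (R0 + 22)" using le k R0[OF k(1)] by simp
  qed
  have sumH: "(\<integral>\<^sup>+\<alpha>. H \<alpha> \<partial>count_space \<Lambda>) < \<infinity>"
  proof -
    have "(\<integral>\<^sup>+\<alpha>. H \<alpha> \<partial>count_space \<Lambda>) = (\<integral>\<^sup>+z. (\<integral>\<^sup>+\<alpha>. h z * indicator (bigsq \<alpha>) z \<partial>count_space \<Lambda>) \<partial>lborel)"
      unfolding H_def by (intro nn_integral_count_space_nn_integral[symmetric]) auto
    also have "\<dots> \<le> (\<integral>\<^sup>+z. 144 * (h z * indicator (cball 0 (R0 + 22)) z) \<partial>lborel)"
    proof (rule nn_integral_mono)
      fix z
      let ?A = "{\<alpha>. layer K \<alpha> \<noteq> {} \<and> z \<in> bigsq \<alpha>}"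
      have "(\<integral>\<^sup>+\<alpha>. h z * indicator (bigsq \<alpha>) z \<partial>count_space \<Lambda>) \<le> (\<integral>\<^sup>+\<alpha>. (h z * indicator (cball 0 (R0 + 22)) z) * indicator ?A \<alpha> \<partial>count_space \<Lambda>)"
      proof (rule nn_integral_mono)
        fix \<alpha> assume "\<alpha> \<in> space (count_space \<Lambda>)"
        then have "\<alpha> \<in> \<Lambda>" by simp
        then show "h z * indicator (bigsq \<alpha>) z \<le> (h z * indicator (cball 0 (R0 + 22)) z) * indicator ?A \<alpha>"
          using inD[OF \<open>\<alpha> \<in> \<Lambda>\<close>] by (auto simp: indicator_def \<Lambda>_def)
      qed
      also have "\<dots> = (h z * indicator (cball 0 (R0 + 22)) z) * emeasure (count_space \<Lambda>) ?A"
        by (intro nn_integral_cmult_indicator) (auto simp: \<Lambda>_def)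
      also have "\<dots> \<le> (h z * indicator (cball 0 (R0 + 22)) z) * 144"
      proof (rule mult_left_mono)
        have "emeasure (count_space \<Lambda>) ?A = of_nat (card ?A)"
          using bigsq_overlap[of K z] by (intro emeasure_count_space_finite) (auto simp: \<Lambda>_def)
        also have "\<dots> \<le> of_nat 144" using bigsq_overlap[of K z] by (intro of_nat_mono) auto
        finally show "emeasure (count_space \<Lambda>) ?A \<le> 144" by simp
      qed simp
      finally show "(\<integral>\<^sup>+\<alpha>. h z * indicator (bigsq \<alpha>) z \<partial>count_space \<Lambda>) \<le> 144 * (h z * indicator (cball 0 (R0 + 22)) z)"
        by (simp add: mult.commute)
    qed
    also have "\<dots> = 144 * (\<integral>\<^sup>+z\<in>cball 0 (R0 + 22). h z \<partial>lborel)" by (intro nn_integral_cmult) auto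
    also have "\<dots> < \<infinity>" using fin by (simp add: ennreal_mult_less_top)
    finally show ?thesis .
  qed
  have "(\<integral>\<^sup>+t. T t \<partial>lborel) = (\<integral>\<^sup>+\<alpha>. (\<integral>\<^sup>+t. c \<alpha> * indicator (J \<alpha>) t \<partial>lborel) \<partial>count_space \<Lambda>)"
    unfolding T_def by (intro nn_integral_count_space_nn_integral) auto
  also have "\<dots> = (\<integral>\<^sup>+\<alpha>. ennreal (4 * C) * H \<alpha> \<partial>count_space \<Lambda>)"
  proof (rule nn_integral_cong)
    fix \<alpha> :: "nat \<times> int \<times> int"
    obtain n i j where \<alpha>: "\<alpha> = (n, i, j)" by (cases \<alpha>) auto
    have sp: "side n > 0" by simp
    have "(\<integral>\<^sup>+t. c \<alpha> * indicator (J \<alpha>) t \<partial>lborel) = c \<alpha> * emeasure lborel (J \<alpha>)"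
      by (intro nn_integral_cmult_indicator) auto
    also have "emeasure lborel (J \<alpha>) = ennreal (2 * C * side n)"
    proof -
      have "0 \<le> C * side n" by (intro mult_nonneg_nonneg C less_imp_le[OF sp])
      then have "of_int j * side n - C * side n \<le> of_int j * side n + C * side n" by linarith
      then show ?thesis unfolding J_def \<alpha> by (simp add: emeasure_lborel_Icc)
    qed
    also have "c \<alpha> * ennreal (2 * C * side n) = (ennreal 2 * ennreal (1 / side n) * ennreal (2 * C * side n)) * H \<alpha>"
      unfolding c_def \<alpha> by (simp add: ac_simps)
    also have "ennreal 2 * ennreal (1 / side n) * ennreal (2 * C * side n) = ennreal (4 * C)"
    proof -
      have "ennreal (4 * C) = ennreal (2 * (1 / side n) * (2 * C * side n))" using sp by simp
      also have "\<dots> = ennreal (2 * (1 / side n)) * ennreal (2 * C * side n)"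
        using C sp by (intro ennreal_mult) (auto intro: less_imp_le)
      also have "ennreal (2 * (1 / side n)) = ennreal 2 * ennreal (1 / side n)"
        using sp by (intro ennreal_mult) (auto intro: less_imp_le)
      finally show ?thesis by simp
    qed
    finally show "(\<integral>\<^sup>+t. c \<alpha> * indicator (J \<alpha>) t \<partial>lborel) = ennreal (4 * C) * H \<alpha>" .
  qed
  also have "\<dots> = ennreal (4 * C) * (\<integral>\<^sup>+\<alpha>. H \<alpha> \<partial>count_space \<Lambda>)" by (intro nn_integral_cmult) auto
  also have "\<dots> < \<infinity>" using sumH by (simp add: ennreal_mult_less_top)
  finally have "AE t in lborel. T t \<noteq> \<infinity>" using Tm by (intro nn_integral_noteq_infinite) auto
  then show ?thesis
    unfolding H_def[symmetric] c_def[symmetric] Teq by eventually_elim (simp add: less_top)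
qed

lemma AE_negligible_image_on_line:
  fixes f :: "real \<times> real \<Rightarrow> real" and h :: "real \<times> real \<Rightarrow> ennreal"
  assumes K: "compact K" "K \<noteq> {}" and f: "continuous_on UNIV f"
    and M: "M > 0" and acc: "cone_accessible M K"
    and h: "h \<in> borel_measurable borel" "\<And>R. (\<integral>\<^sup>+z\<in>cball 0 R. h z \<partial>lborel) < \<infinity>"
    and x: "AE t in lborel. osc_bound_x K h f t" and y: "AE s in lborel. osc_bound_y K h f s"
  shows "AE t in lborel. negligible (f ` (K \<inter> UNIV \<times> {t}))"
proof -
  define c where "c \<alpha> = 2 * (ennreal (1 / side (fst \<alpha>)) * (\<integral>\<^sup>+z\<in>bigsq \<alpha>. h z \<partial>lborel))" for \<alpha>
  have "\<exists>v \<in> sq \<alpha>. \<forall>z \<in> cross v \<alpha>. \<forall>w \<in> cross v \<alpha>. ennreal \<bar>f z - f w\<bar> \<le> c \<alpha>" if "layer K \<alpha> \<noteq> {}" for \<alpha>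
    unfolding c_def
  proof (rule exists_good_cross[OF h(1) x y that])
    have "bounded (bigsq \<alpha>)" by (cases \<alpha>) (auto simp: bigsq_def intro!: bounded_Times)
    then obtain R where "\<forall>z\<in>bigsq \<alpha>. norm z \<le> R" unfolding bounded_iff by blast
    then have "(\<integral>\<^sup>+z\<in>bigsq \<alpha>. h z \<partial>lborel) \<le> (\<integral>\<^sup>+z\<in>cball 0 R. h z \<partial>lborel)"
      by (intro nn_integral_mono) (auto simp: indicator_def)
    then show "(\<integral>\<^sup>+z\<in>bigsq \<alpha>. h z \<partial>lborel) < \<infinity>" using h(2) by (rule le_less_trans)
  qed
  then obtain ctr where ctr: "\<And>\<alpha>. layer K \<alpha> \<noteq> {} \<Longrightarrow> ctr \<alpha> \<in> sq \<alpha>"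
    "\<And>\<alpha> z w. layer K \<alpha> \<noteq> {} \<Longrightarrow> z \<in> cross (ctr \<alpha>) \<alpha> \<Longrightarrow> w \<in> cross (ctr \<alpha>) \<alpha> \<Longrightarrow> ennreal \<bar>f z - f w\<bar> \<le> c \<alpha>"
    by metis
  have "16 * M + 1 \<ge> 0" using M by simp
  from AE_finite_cross_sum[OF h(1) K h(2) this] show ?thesis
    unfolding c_def[symmetric]
    by eventually_elim (rule negligible_image_on_line[OF K(1) f M acc ctr])
qed

section \<open>Accessibility of the boundary of a John domain\<close>

text \<open>The path ends near \<open>x\<close>, not at \<open>x\<close>, and its cone has the
  vertex \<open>q b\<close>. Outside the ball about \<open>q b\<close> of radius
  \<open>u = dist (q b) x\<close> the distances to \<open>x\<close> and to \<open>q b\<close> are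
  comparable, with factor 2, so the path is cut when it first enters this ball and the vertex is
  moved to \<open>x\<close>. The hypothesis \<open>2 * u < \<rho>\<close> ensures that at this
  moment it is already closer to \<open>K\<close> than \<rho>.\<close>

lemma cone_from_path:
  fixes q :: "real \<Rightarrow> 'a::metric_space"
  assumes q: "continuous_on {a..b} q" and ab: "a \<le> b" and K: "closed K" "x \<in> K"
    and qK: "\<And>s. s \<in> {a..b} \<Longrightarrow> q s \<notin> K"
    and start: "\<rho> \<le> infdist (q a) K" and near: "2 * dist (q b) x < \<rho>"
    and cone: "\<And>s. s \<in> {a..b} \<Longrightarrow> infdist (q s) K \<le> \<rho> \<Longrightarrow> dist (q s) (q b) \<le> M * infdist (q s) K"
  shows "cone_joins (2 * M) K x \<rho> (2 * dist (q b) x)"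
proof -
  define u where "u = dist (q b) x"
  have u: "u > 0" using qK[of b] K ab unfolding u_def by auto
  define T where "T = {s \<in> {a..b}. dist (q s) (q b) \<le> u}"
  have cd: "continuous_on {a..b} (\<lambda>s. dist (q s) (q b))" and ci: "continuous_on {a..b} (\<lambda>s. infdist (q s) K)"
    by (intro continuous_intros q)+
  have "closed T" unfolding T_def by (intro continuous_on_closed_Collect_le cd continuous_on_const closed_atLeastAtMost)
  then have "compact T" unfolding compact_eq_bounded_closed T_def
    by (auto intro: bounded_subset[OF bounded_closed_interval[of a b]])
  moreover have "T \<noteq> {}" using ab u unfolding T_def by (auto intro!: exI[of _ b])
  \<comment> \<open>First time at which the path is within \<open>u\<close> of its end; up to then
    its distance from the end is at least \<open>u\<close>.\<close>
  ultimately obtain b' where b': "b' \<in> T" "\<And>s. s \<in> T \<Longrightarrow> b' \<le> s" using compact_attains_inf[of T] by blast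
  have b'2: "b' \<in> {a..b}" "dist (q b') (q b) \<le> u" using b'(1) unfolding T_def by auto
  have "infdist (q b') K \<le> dist (q b') x" using K(2) by (rule infdist_le)
  also have qb'x: "dist (q b') x \<le> 2 * u" using dist_triangle[of "q b'" x "q b"] b'2 by (simp add: u_def)
  also have "2 * u < \<rho>" using near by (simp add: u_def)
  finally have ib': "infdist (q b') K < \<rho>" .
  have ab': "a \<noteq> b'" using ib' start by auto
  have far: "u \<le> dist (q s) (q b)" if s: "s \<in> {a..b'}" for s
  proof (rule ccontr)
    assume *: "\<not> u \<le> dist (q s) (q b)"
    then have "s \<in> T" using s b'2 unfolding T_def by auto
    then have "s = b'" using b'(2)[of s] s by auto
    have "a \<notin> T" using b'(2)[of a] ab' b'2 by auto
    then have "u \<le> dist (q a) (q b)" using ab unfolding T_def by auto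
    moreover have "continuous_on {a..b'} (\<lambda>s. dist (q s) (q b))"
      using cd by (rule continuous_on_subset) (use b'2 in auto)
    ultimately obtain r where r: "a \<le> r" "r \<le> b'" "dist (q r) (q b) = u"
      using IVT2'[of "\<lambda>s. dist (q s) (q b)" b' u a] * \<open>s = b'\<close> b'2 by auto
    then have "r \<in> T" using b'2 unfolding T_def by auto
    then show False using b'(2)[of r] r * \<open>s = b'\<close> by auto
  qed
  define S where "S = {s \<in> {a..b'}. \<rho> \<le> infdist (q s) K}"
  have ci': "continuous_on {a..b'} (\<lambda>s. infdist (q s) K)"
    using ci by (rule continuous_on_subset) (use b'2 in auto)
  have "closed S" unfolding S_def by (intro continuous_on_closed_Collect_le ci' continuous_on_const closed_atLeastAtMost)
  then have "compact S" unfolding compact_eq_bounded_closed S_def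
    by (auto intro: bounded_subset[OF bounded_closed_interval[of a b']])
  moreover have "S \<noteq> {}" using b'2 start unfolding S_def by (auto intro!: exI[of _ a])
  \<comment> \<open>Last time before \<open>b'\<close> at distance at least \<rho> from
    \<open>K\<close>; by continuity the distance equals \<rho> there and is at most \<rho>
    afterwards.\<close>
  ultimately obtain a' where a': "a' \<in> S" "\<And>s. s \<in> S \<Longrightarrow> s \<le> a'" using compact_attains_sup[of S] by blast
  have a'2: "a \<le> a'" "a' \<le> b'" "\<rho> \<le> infdist (q a') K" using a'(1) unfolding S_def by auto
  have ia': "infdist (q a') K = \<rho>"
  proof (rule ccontr)
    assume ne: "infdist (q a') K \<noteq> \<rho>"
    have "continuous_on {a'..b'} (\<lambda>s. infdist (q s) K)"
      using ci' by (rule continuous_on_subset) (use a'2 in auto)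
    then obtain r where r: "a' \<le> r" "r \<le> b'" "infdist (q r) K = \<rho>"
      using IVT2'[of "\<lambda>s. infdist (q s) K" b' \<rho> a'] a'2 ib' by auto
    then have "r \<in> S" using a'2 unfolding S_def by auto
    then have "r = a'" using a'(2)[of r] r by auto
    then show False using r ne by simp
  qed
  define C where "C = q ` {a'..b'}"
  have sub: "{a'..b'} \<subseteq> {a..b}" using a'2 b'2 by auto
  have "compact C" "connected C" unfolding C_def
    using continuous_on_subset[OF q sub] by (auto intro: compact_continuous_image connected_continuous_image)
  moreover have "0 < infdist (q s) K \<and> infdist (q s) K \<le> \<rho> \<and> dist (q s) x \<le> 2 * M * infdist (q s) K"
    if s: "s \<in> {a'..b'}" for s
  proof (intro conjI)
    have "s \<in> {a..b}" using s sub by auto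
    show "0 < infdist (q s) K"
      using qK[OF \<open>s \<in> {a..b}\<close>] K infdist_pos_not_in_closed[of K "q s"] by auto
    show le: "infdist (q s) K \<le> \<rho>"
    proof (rule ccontr)
      assume *: "\<not> infdist (q s) K \<le> \<rho>"
      then have "s \<in> S" using s a'2 unfolding S_def by auto
      then have "s = a'" using a'(2)[of s] s by auto
      then show False using * ia' by simp
    qed
    have "dist (q s) x \<le> dist (q s) (q b) + u" unfolding u_def by (rule dist_triangle)
    also have "\<dots> \<le> 2 * dist (q s) (q b)" using far[of s] s a'2 by auto
    also have "\<dots> \<le> 2 * (M * infdist (q s) K)" using cone[OF \<open>s \<in> {a..b}\<close> le] by simp
    finally show "dist (q s) x \<le> 2 * M * infdist (q s) K" by simp
  qed
  moreover have "q a' \<in> C" "q b' \<in> C" using a'2 unfolding C_def by auto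
  ultimately show ?thesis using ia' qb'x unfolding C_def u_def
    by (intro exI[of _ "q ` {a'..b'}"]) blast
qed

section \<open>From the chordal to the Euclidean metric\<close>

definition finite_part :: "riemann_sphere \<Rightarrow> complex" where
  "finite_part y = (case y of Finite z \<Rightarrow> z | Infinity \<Rightarrow> 0)"

lemma finite_part_Finite[simp]: "finite_part (Finite z) = z" by (simp add: finite_part_def)

lemma Finite_finite_part: "y \<noteq> Infinity \<Longrightarrow> Finite (finite_part y) = y" by (cases y) auto

text \<open>Stereographic projection from the north pole recovers the plane coordinate as the first
  component of \<open>stereo y\<close> divided by \<open>1 - snd (stereo y)\<close>, and
  \<open>stereo\<close> is an isometry by definition of the metric.\<close>

lemma continuous_on_finite_part: "continuous_on (- {Infinity}) finite_part"
proof -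
  have st: "continuous_on A stereo" for A
    unfolding continuous_on_iff dist_riemann_sphere_def by auto
  have eq: "finite_part y = fst (stereo y) /\<^sub>R (1 - snd (stereo y)) \<and> 1 - snd (stereo y) \<noteq> 0" if "y \<noteq> Infinity" for y
  proof (cases y)
    case (Finite z)
    define s where "s = (cmod z)\<^sup>2 + 1"
    have s: "s > 0" unfolding s_def by (simp add: add_nonneg_pos)
    have "stereo y = ((2 / s) *\<^sub>R z, (s - 2) / s)" by (simp add: Finite s_def)
    moreover have "1 - (s - 2) / s = 2 / s" using s by (simp add: field_simps)
    ultimately show ?thesis using s by (simp add: Finite del: stereo.simps)
  qed (use that in simp)
  have "continuous_on (- {Infinity}) (\<lambda>y. fst (stereo y) /\<^sub>R (1 - snd (stereo y)))"
    using eq by (intro continuous_intros st continuous_on_fst continuous_on_snd) auto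
  then show ?thesis by (rule continuous_on_eq) (use eq in auto)
qed

lemma chordal_dist_le: "dist (Finite z) (Finite w) \<le> 2 * dist z w"
proof -
  have "1 \<le> sqrt ((cmod z)\<^sup>2 + 1)" "1 \<le> sqrt ((cmod w)\<^sup>2 + 1)" by simp_all
  then have "1 * 1 \<le> sqrt ((cmod z)\<^sup>2 + 1) * sqrt ((cmod w)\<^sup>2 + 1)" by (intro mult_mono) auto
  then show ?thesis unfolding chordal_dist_Finite dist_norm
    by (simp add: divide_le_eq mult_left_le mult_le_cancel_left1 mult_ac) 
qed

lemma chordal_dist_ge:
  assumes "cmod z \<le> R" "cmod w \<le> R"
  shows "2 * dist z w \<le> (1 + R\<^sup>2) * dist (Finite z) (Finite w)"
proof -
  let ?a = "sqrt ((cmod z)\<^sup>2 + 1)" and ?b = "sqrt ((cmod w)\<^sup>2 + 1)"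
  have pos: "0 < ?a" "0 < ?b" by (simp_all add: add_nonneg_pos)
  have "?a \<le> sqrt (1 + R\<^sup>2)" "?b \<le> sqrt (1 + R\<^sup>2)"
    using assms by (auto intro!: power_mono)
  then have "?a * ?b \<le> sqrt (1 + R\<^sup>2) * sqrt (1 + R\<^sup>2)" using pos by (intro mult_mono) auto
  also have "\<dots> = 1 + R\<^sup>2" by simp
  finally have "?a * ?b \<le> 1 + R\<^sup>2" .
  then have "?a * ?b * dist (Finite z) (Finite w) \<le> (1 + R\<^sup>2) * dist (Finite z) (Finite w)"
    by (intro mult_right_mono) auto
  also have "?a * ?b * dist (Finite z) (Finite w) = 2 * dist z w"
    using pos unfolding chordal_dist_Finite dist_norm by (simp add: field_simps)
  finally show ?thesis .
qed

text \<open>A boundary point \<open>x\<close> is not the end of a John arc, so arcs to domain points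
  \<open>w\<close> arbitrarily close to \<open>x\<close> are used. Near \<open>Infinity\<close> the
  two metrics are not comparable; the arcs are therefore started only after leaving
  \<open>Infinity\<close>, and the cone condition is needed only within distance 16 of
  \<open>K\<close>, inside a fixed disc.\<close>

lemma john_domain_cone_accessible:
  assumes john: "john_domain \<Omega> Infinity" and K: "K = Finite -` frontier \<Omega>"
  obtains M where "M > 0" "cone_accessible M K"
proof -
  obtain \<epsilon> where \<epsilon>: "\<epsilon> > 0" and arcs: "\<And>z1. z1 \<in> \<Omega> - {Infinity} \<Longrightarrow> \<exists>\<gamma>. arc \<gamma> \<and> path_image \<gamma> \<subseteq> \<Omega> \<and>
        pathstart \<gamma> = Infinity \<and> pathfinish \<gamma> = z1 \<and>
        (\<forall>z\<in>path_image \<gamma>. infdist z (frontier \<Omega>) \<ge> \<epsilon> * dist z z1)"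
    and op: "open \<Omega>" and Inf: "Infinity \<in> \<Omega>"
    using john unfolding john_domain_def by blast
  have cK: "compact K" unfolding K using op Inf by (rule compact_vimage_frontier)
  have Feq: "frontier \<Omega> = Finite ` K" unfolding K using op Inf by (rule frontier_eq_Finite_image)
  have disj: "Finite z \<notin> \<Omega>" if "z \<in> K" for z
    using that op unfolding K by (simp add: frontier_def interior_open)
  obtain R where R: "\<And>z. z \<in> K \<Longrightarrow> cmod z \<le> R" using compact_imp_bounded[OF cK] unfolding bounded_iff by blast
  \<comment> \<open>The disc of radius \<open>R'\<close> leaves room for the largest admissible
    \<rho>, which is 16, and a unit to spare.\<close>
  define R' where "R' = \<bar>R\<bar> + 17"
  \<comment> \<open>In that disc \<open>2 * dist z w\<close> is at most
    \<open>1 + R'\<^sup>2\<close> times the chordal distance, while the chordal distance to the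
    frontier is at most twice the Euclidean one; the two factors 2 cancel. The doubling in the final
    constant comes from \<open>cone_from_path\<close>.\<close>
  define M where "M = (1 + R'\<^sup>2) / \<epsilon>"
  have M: "M > 0" unfolding M_def using \<epsilon> by (intro divide_pos_pos) (auto intro: add_pos_nonneg)
  have "cone_accessible (2 * M) K"
    unfolding cone_accessible_def
  proof (intro ballI allI impI)
    fix x \<eta> \<rho> assume x: "x \<in> K" and \<eta>: "(0::real) < \<eta>" and \<rho>: "0 < \<rho> \<and> \<rho> \<le> (16::real)"
    \<comment> \<open>The three bounds serve, in order, to end within \<eta> of \<open>x\<close>, to
      have twice the distance below \<rho>, and to keep \<open>w\<close> in the disc of radius
      \<open>R'\<close>.\<close>
    define \<eta>' where "\<eta>' = min (\<eta> / 2) (min (\<rho> / 3) 1)"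
    have \<eta>': "\<eta>' > 0" "\<eta>' \<le> \<eta> / 2" "\<eta>' \<le> \<rho> / 3" "\<eta>' \<le> 1" unfolding \<eta>'_def using \<eta> \<rho> by auto
    have Rx: "cmod x \<le> \<bar>R\<bar>" using R[OF x] by linarith
    obtain w where w: "Finite w \<in> \<Omega>" "dist w x < \<eta>'"
    proof -
      have "Finite x \<in> - {Infinity}" by simp
      then obtain d where d: "d > 0" "\<And>y. y \<in> - {Infinity} \<Longrightarrow> dist y (Finite x) < d \<Longrightarrow> dist (finite_part y) (finite_part (Finite x)) < \<eta>'"
        using continuous_on_finite_part \<eta>'(1) unfolding continuous_on_iff by meson
      have "Finite x \<in> closure \<Omega>" using x unfolding K by (simp add: frontier_def)
      moreover have "0 < min d (dist Infinity (Finite x))" using d by simp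
      ultimately obtain y where y: "y \<in> \<Omega>" "dist y (Finite x) < min d (dist Infinity (Finite x))"
        unfolding closure_approachable by blast
      then have "y \<noteq> Infinity" by auto
      then show ?thesis using that[of "finite_part y"] d(2)[of y] y by (simp add: Finite_finite_part)
    qed
    obtain \<gamma> where \<gamma>: "arc \<gamma>" "path_image \<gamma> \<subseteq> \<Omega>" "pathstart \<gamma> = Infinity" "pathfinish \<gamma> = Finite w"
      "\<And>z. z \<in> path_image \<gamma> \<Longrightarrow> infdist z (frontier \<Omega>) \<ge> \<epsilon> * dist z (Finite w)"
      using arcs[of "Finite w"] w(1) by auto
    have \<gamma>c: "continuous_on {0..1} \<gamma>" and \<gamma>i: "inj_on \<gamma> {0..1}"
      using \<gamma>(1) unfolding arc_def path_def by auto
    have \<gamma>0: "\<gamma> 0 = Infinity" "\<gamma> 1 = Finite w" using \<gamma>(3,4) by (auto simp: pathstart_def pathfinish_def)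
    \<comment> \<open>Injectivity of the arc keeps it from returning to \<open>Infinity\<close>, so
      the dummy value 0 of \<open>finite_part\<close> at that point is never met for positive
      parameters.\<close>
    have nI: "\<gamma> s \<noteq> Infinity" if "0 < s" "s \<le> 1" for s
      using inj_onD[OF \<gamma>i, of s 0] \<gamma>0 that by auto
    define q where "q s = finite_part (\<gamma> s)" for s
    have Fq: "Finite (q s) = \<gamma> s" if "0 < s" "s \<le> 1" for s
      unfolding q_def using nI[OF that] by (rule Finite_finite_part)
    \<comment> \<open>Chordal distance less than \<open>e\<close> from \<open>Infinity\<close> means
      modulus larger than \<open>R'\<close>, so a small positive parameter \<open>a\<close> gives a
      starting point farther than 16 from \<open>K\<close>.\<close>
    define e where "e = 2 / sqrt (R'\<^sup>2 + 1)"
    have e: "e > 0" unfolding e_def by (simp add: add_nonneg_pos)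
    obtain d where d: "d > 0" "\<And>s. s \<in> {0..1} \<Longrightarrow> dist s 0 < d \<Longrightarrow> dist (\<gamma> s) (\<gamma> 0) < e"
      using \<gamma>c e unfolding continuous_on_iff by (metis atLeastAtMost_iff order_refl zero_le_one)
    define a where "a = min (d / 2) 1"
    have a: "0 < a" "a \<le> 1" unfolding a_def using d(1) by auto
    have "dist (\<gamma> a) Infinity < e" using d(2)[of a] a d(1) \<gamma>0 unfolding a_def by (auto simp: dist_real_def)
    then have "2 / sqrt ((cmod (q a))\<^sup>2 + 1) < 2 / sqrt (R'\<^sup>2 + 1)"
      unfolding Fq[OF a, symmetric] chordal_dist_Infinity e_def .
    moreover have "0 < sqrt ((cmod (q a))\<^sup>2 + 1)" "0 < sqrt (R'\<^sup>2 + 1)" by (simp_all add: add_nonneg_pos)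
    ultimately have "sqrt (R'\<^sup>2 + 1) < sqrt ((cmod (q a))\<^sup>2 + 1)" by (simp add: field_simps)
    then have "R'\<^sup>2 < (cmod (q a))\<^sup>2" by simp
    then have qa: "R' < cmod (q a)" by (rule power_less_imp_less_base) simp
    have "cone_joins (2 * M) K x \<rho> (2 * dist (q 1) x)"
    proof (rule cone_from_path)
      show "continuous_on {a..1} q" unfolding q_def
      proof (rule continuous_on_compose2[OF continuous_on_finite_part])
        show "continuous_on {a..1} \<gamma>" using a by (intro continuous_on_subset[OF \<gamma>c]) auto
        show "\<gamma> ` {a..1} \<subseteq> - {Infinity}"
        proof (rule image_subsetI)
          fix s assume "s \<in> {a..1}"
          then have "\<gamma> s \<noteq> Infinity" using nI[of s] a by auto
          then show "\<gamma> s \<in> - {Infinity}" by simp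
        qed
      qed
      show "closed K" using cK by (rule compact_imp_closed)
      show "q s \<notin> K" if "s \<in> {a..1}" for s
      proof -
        have "\<gamma> s \<in> \<Omega>" using \<gamma>(2) that a unfolding path_image_def by auto
        then show ?thesis using disj[of "q s"] Fq[of s] that a by auto
      qed
      show "\<rho> \<le> infdist (q a) K"
      proof -
        obtain k where k: "k \<in> K" "infdist (q a) K = dist (q a) k"
          using infdist_attains_inf[OF compact_imp_closed[OF cK]] x by blast
        have "cmod (q a) \<le> cmod (q a - k) + cmod k" using norm_triangle_sub[of "q a" k] by simp
        then show ?thesis using k(2) R[OF k(1)] qa \<rho> unfolding R'_def dist_norm by linarith
      qed
      have q1: "q 1 = w" using \<gamma>0 by (simp add: q_def)
      show "2 * dist (q 1) x < \<rho>" using w(2) \<eta>' \<rho> unfolding q1 by linarith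
      show "dist (q s) (q 1) \<le> M * infdist (q s) K" if s: "s \<in> {a..1}" "infdist (q s) K \<le> \<rho>" for s
      proof -
        obtain k where k: "k \<in> K" "infdist (q s) K = dist (q s) k"
          using infdist_attains_inf[OF compact_imp_closed[OF cK]] x by blast
        have "cmod (q s) \<le> cmod (q s - k) + cmod k" using norm_triangle_sub[of "q s" k] by simp
        then have qs: "cmod (q s) \<le> R'" using k(2) R[OF k(1)] s(2) \<rho> unfolding R'_def dist_norm by linarith
        have "cmod w \<le> cmod (w - x) + cmod x" using norm_triangle_sub[of w x] by simp
        then have wR: "cmod w \<le> R'" using w(2) \<eta>' Rx unfolding R'_def by (simp add: dist_norm)
        have \<gamma>s: "\<gamma> s = Finite (q s)" using Fq[of s] s a by auto
        have "\<epsilon> * (2 * dist (q s) w) \<le> \<epsilon> * ((1 + R'\<^sup>2) * dist (Finite (q s)) (Finite w))"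
          using \<epsilon> chordal_dist_ge[OF qs wR] by (intro mult_left_mono) auto
        also have "\<dots> = (1 + R'\<^sup>2) * (\<epsilon> * dist (\<gamma> s) (Finite w))" unfolding \<gamma>s by simp
        also have "\<dots> \<le> (1 + R'\<^sup>2) * infdist (\<gamma> s) (frontier \<Omega>)"
          using \<gamma>(5)[of "\<gamma> s"] s a unfolding path_image_def by (intro mult_left_mono) auto
        also have "infdist (\<gamma> s) (frontier \<Omega>) \<le> 2 * infdist (q s) K"
        proof -
          have "infdist (\<gamma> s) (frontier \<Omega>) \<le> dist (\<gamma> s) (Finite k)"
            using k(1) unfolding Feq by (intro infdist_le) auto
          also have "\<dots> \<le> 2 * dist (q s) k" unfolding \<gamma>s by (rule chordal_dist_le)
          finally show ?thesis using k(2) by simp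
        qed
        finally have "\<epsilon> * (2 * dist (q s) w) \<le> (1 + R'\<^sup>2) * (2 * infdist (q s) K)"
          by (simp add: mult_left_mono)
        then show ?thesis unfolding q1 M_def using \<epsilon> by (simp add: field_simps)
      qed
    qed (use a x in auto)
    moreover have "2 * dist (q 1) x \<le> \<eta>" using w(2) \<eta>'(2) \<gamma>0 by (simp add: q_def)
    ultimately show "cone_joins (2 * M) K x \<rho> \<eta>" by (meson order_trans)
  qed
  then show ?thesis using that[of "2 * M"] M by simp
qed

text \<open>Carries the cone condition from \<open>complex\<close> to
  \<open>real \<times> real\<close>, where the squares live, and through the exchange of the two
  axes.\<close>

lemma cone_accessible_vimage_isometry:
  fixes \<Phi> :: "'a::metric_space \<Rightarrow> 'b::metric_space"
  assumes iso: "\<And>x y. dist (\<Phi> x) (\<Phi> y) = dist x y" and surj: "surj \<Phi>" and acc: "cone_accessible M K"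
  shows "cone_accessible M (\<Phi> -` K)"
proof -
  have inj: "inj \<Phi>" using iso by (intro injI) (metis dist_eq_0_iff)
  have inf: "infdist x (\<Phi> -` K) = infdist (\<Phi> x) K" for x
  proof -
    have "dist (\<Phi> x) ` K = dist (\<Phi> x) ` \<Phi> ` (\<Phi> -` K)" by (simp only: surj_image_vimage_eq[OF surj])
    also have "\<dots> = dist x ` (\<Phi> -` K)" by (simp only: image_image iso)
    finally show ?thesis using surj by (simp add: infdist_def surj_vimage_empty)
  qed
  define \<Psi> where "\<Psi> = inv \<Phi>"
  have \<Psi>: "\<Phi> (\<Psi> y) = y" "\<Psi> (\<Phi> x) = x" for x y
    unfolding \<Psi>_def using surj inj by (auto simp: surj_f_inv_f)
  have \<Psi>iso: "dist (\<Psi> x) (\<Psi> y) = dist x y" for x y using iso[of "\<Psi> x" "\<Psi> y"] by (simp add: \<Psi>)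
  have \<Psi>c: "continuous_on A \<Psi>" for A unfolding continuous_on_iff \<Psi>iso by auto
  show ?thesis unfolding cone_accessible_def
  proof (intro ballI allI impI)
    fix x \<eta> \<rho> assume x: "x \<in> \<Phi> -` K" and \<eta>: "(0::real) < \<eta>" and \<rho>: "0 < \<rho> \<and> \<rho> \<le> (16::real)"
    then obtain C where C: "compact C" "connected C"
        "\<And>z. z \<in> C \<Longrightarrow> 0 < infdist z K \<and> infdist z K \<le> \<rho> \<and> dist z (\<Phi> x) \<le> M * infdist z K"
        "\<exists>w\<in>C. infdist w K = \<rho>" "\<exists>z\<in>C. dist z (\<Phi> x) \<le> \<eta>"
      using acc[unfolded cone_accessible_def, rule_format, of "\<Phi> x" \<eta> \<rho>] x \<eta> \<rho> by auto
    have dx: "dist (\<Psi> z) x = dist z (\<Phi> x)" for z using iso[of "\<Psi> z" x] by (simp add: \<Psi>)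
    have "compact (\<Psi> ` C)" "connected (\<Psi> ` C)"
      using C(1,2) \<Psi>c by (auto intro: compact_continuous_image connected_continuous_image)
    then show "cone_joins M (\<Phi> -` K) x \<rho> \<eta>"
      using C(3-5) by (intro exI[of _ "\<Psi> ` C"]) (simp add: inf \<Psi> dx)
  qed
qed

section \<open>Smooth step functions\<close>

text \<open>One-variable counterpart of \<open>C_k\<close>. The derivative is existentially
  quantified so that the calculus rules can supply it directly.\<close>

primrec diff_k :: "nat \<Rightarrow> (real \<Rightarrow> real) \<Rightarrow> bool" where
  "diff_k 0 f \<longleftrightarrow> continuous_on UNIV f"
| "diff_k (Suc k) f \<longleftrightarrow> (\<exists>f'. (\<forall>x. (f has_real_derivative f' x) (at x)) \<and> diff_k k f')"

lemma diff_k_Suc_imp: "diff_k (Suc k) f \<Longrightarrow> diff_k k f"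
proof (induction k arbitrary: f)
  case 0
  then obtain f' where "\<forall>x. (f has_real_derivative f' x) (at x)" by auto
  then have "continuous_on UNIV f" by (intro DERIV_continuous_on[of _ _ f']) auto
  then show ?case by simp
next
  case (Suc k)
  then obtain f' where "\<forall>x. (f has_real_derivative f' x) (at x)" "diff_k (Suc k) f'" by auto
  then show ?case using Suc.IH by auto
qed

lemma diff_k_continuous: "diff_k k f \<Longrightarrow> continuous_on UNIV f"
  by (induction k) (auto dest: diff_k_Suc_imp simp del: diff_k.simps(2))

lemma diff_k_const: "diff_k k (\<lambda>x. c)"
proof (induction k arbitrary: c)
  case (Suc k)
  then show ?case by (auto intro!: exI[of _ "\<lambda>x. 0"])
qed simp

lemma diff_k_add: "diff_k k f \<Longrightarrow> diff_k k g \<Longrightarrow> diff_k k (\<lambda>x. f x + g x)"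
proof (induction k arbitrary: f g)
  case (Suc k)
  then obtain f' g' where "\<forall>x. (f has_real_derivative f' x) (at x)" "diff_k k f'"
    "\<forall>x. (g has_real_derivative g' x) (at x)" "diff_k k g'" by auto
  then show ?case using Suc.IH[of f' g'] by (auto intro!: exI[of _ "\<lambda>x. f' x + g' x"] derivative_intros)
qed (auto intro: continuous_on_add)

lemma diff_k_mult: "diff_k k f \<Longrightarrow> diff_k k g \<Longrightarrow> diff_k k (\<lambda>x. f x * g x)"
proof (induction k arbitrary: f g)
  case (Suc k)
  then obtain f' g' where *: "\<forall>x. (f has_real_derivative f' x) (at x)" "diff_k k f'"
    "\<forall>x. (g has_real_derivative g' x) (at x)" "diff_k k g'" by auto
  have "diff_k k f" "diff_k k g" using Suc.prems by (auto intro: diff_k_Suc_imp simp del: diff_k.simps)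
  then have "diff_k k (\<lambda>x. f' x * g x + g' x * f x)"
    using * by (intro diff_k_add Suc.IH)
  then show ?case using * by (auto intro!: exI[of _ "\<lambda>x. f' x * g x + g' x * f x"] DERIV_mult)
qed (auto intro: continuous_on_mult)

lemma diff_k_diff: "diff_k k f \<Longrightarrow> diff_k k g \<Longrightarrow> diff_k k (\<lambda>x. f x - g x)"
  using diff_k_add[of k f "\<lambda>x. (-1) * g x"] diff_k_mult[of k "\<lambda>_. -1" g] diff_k_const[of k "-1"] by simp

lemma diff_k_affine: "diff_k k f \<Longrightarrow> diff_k k (\<lambda>x. f (a * x + b))"
proof (induction k arbitrary: f)
  case 0
  then show ?case by (auto intro!: continuous_on_compose2[of UNIV f] continuous_intros)
next
  case (Suc k)
  then obtain f' where *: "\<forall>x. (f has_real_derivative f' x) (at x)" "diff_k k f'" by auto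
  have "((\<lambda>x. f (a * x + b)) has_real_derivative f' (a * x + b) * a) (at x)" for x
    by (rule DERIV_chain2[of f]) (use * in \<open>auto intro!: derivative_eq_intros\<close>)
  moreover have "diff_k k (\<lambda>x. f' (a * x + b) * a)"
    using Suc.IH[OF *(2)] by (intro diff_k_mult diff_k_const)
  ultimately show ?case unfolding diff_k.simps by (intro exI[of _ "\<lambda>x. f' (a * x + b) * a"] conjI allI)
qed

lemma diff_k_inverse:
  assumes "\<And>x. g x \<noteq> 0"
  shows "diff_k k g \<Longrightarrow> diff_k k (\<lambda>x. inverse (g x))"
proof (induction k)
  case 0
  then show ?case using assms by (auto intro!: continuous_intros)
next
  case (Suc k)
  then obtain g' where *: "\<forall>x. (g has_real_derivative g' x) (at x)" "diff_k k g'" by auto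
  have "diff_k k (\<lambda>x. inverse (g x))" using Suc diff_k_Suc_imp by blast
  then have "diff_k k (\<lambda>x. (-1) * (inverse (g x) * g' x * inverse (g x)))"
    using *(2) by (intro diff_k_mult diff_k_const)
  moreover have "((\<lambda>x. inverse (g x)) has_real_derivative - (inverse (g x) * g' x * inverse (g x))) (at x)" for x
    using * assms by (intro DERIV_inverse') auto
  ultimately show ?case unfolding diff_k.simps
    by (intro exI[of _ "\<lambda>x. - (inverse (g x) * g' x * inverse (g x))"] conjI allI) simp_all
qed

text \<open>The functions \<open>p(1/x) exp(-1/x)\<close>, extended by zero. With
  \<open>y = 1/x\<close> the derivative is \<open>y^2 (p(y) - p'(y)) exp(-y)\<close>, so the
  polynomial factor makes the family closed under differentiation and smoothness follows by
  induction.\<close>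

definition flat_fun :: "real poly \<Rightarrow> real \<Rightarrow> real" where
  "flat_fun p x = (if x > 0 then poly p (inverse x) / exp (inverse x) else 0)"

text \<open>The extra power \<open>k\<close> is what the induction on \<open>p\<close> needs:
  passing from \<open>pCons a p\<close> to \<open>p\<close> raises it by one.\<close>

lemma poly_div_exp_tendsto_0: "((\<lambda>y. y ^ k * poly p y / exp y) \<longlongrightarrow> (0::real)) at_top"
proof (induction p arbitrary: k)
  case (pCons a p)
  have "((\<lambda>y. a * (y ^ k / exp y) + y ^ Suc k * poly p y / exp y) \<longlongrightarrow> a * 0 + 0) at_top"
    by (intro tendsto_add tendsto_mult tendsto_const tendsto_power_div_exp_0 pCons.IH)
  then show ?case by (simp add: field_simps)
qed simp

lemma flat_fun_tendsto_0: "((\<lambda>x. flat_fun p x / x) \<longlongrightarrow> 0) (at 0)"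
proof -
  have "((\<lambda>x. (\<lambda>y. y ^ 1 * poly p y / exp y) (inverse x)) \<longlongrightarrow> (0::real)) (at_right 0)"
    by (rule filterlim_compose[OF poly_div_exp_tendsto_0 filterlim_inverse_at_top_right])
  moreover have "\<forall>\<^sub>F x::real in at_right 0. (\<lambda>y. y ^ 1 * poly p y / exp y) (inverse x) = flat_fun p x / x"
    unfolding eventually_at_right_field by (intro exI[of _ 1]) (auto simp: flat_fun_def field_simps)
  ultimately have "((\<lambda>x. flat_fun p x / x) \<longlongrightarrow> 0) (at_right 0)"
    by (rule Lim_transform_eventually)
  moreover have "((\<lambda>x. flat_fun p x / x) \<longlongrightarrow> 0) (at_left 0)"
    by (rule tendsto_eventually) (auto simp: flat_fun_def eventually_at_left_field intro!: exI[of _ "-1"])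
  ultimately show ?thesis by (simp add: filterlim_at_split)
qed

lemma flat_fun_deriv:
  "(flat_fun p has_real_derivative flat_fun ([:0, 0, 1:] * (p - pderiv p)) x) (at x)"
proof -
  consider "x > 0" | "x < 0" | "x = 0" by linarith
  then show ?thesis
  proof cases
    case 1
    have "((\<lambda>x. poly p (inverse x) / exp (inverse x)) has_real_derivative
        flat_fun ([:0, 0, 1:] * (p - pderiv p)) x) (at x)"
      using 1 by (auto intro!: derivative_eq_intros poly_DERIV[THEN DERIV_chain2]
        simp: flat_fun_def field_simps power2_eq_square)
    then show ?thesis
      by (rule has_field_derivative_transform_within_open[of _ _ _ "{0<..}"]) (use 1 in \<open>auto simp: flat_fun_def\<close>)
  next
    case 2
    have "((\<lambda>x. 0) has_real_derivative flat_fun ([:0, 0, 1:] * (p - pderiv p)) x) (at x)"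
      using 2 by (simp add: flat_fun_def)
    then show ?thesis
      by (rule has_field_derivative_transform_within_open[of _ _ _ "{..<0}"]) (use 2 in \<open>auto simp: flat_fun_def\<close>)
  next
    case 3
    have "flat_fun q 0 = 0" for q by (simp add: flat_fun_def)
    then show ?thesis using flat_fun_tendsto_0[of p] unfolding 3 by (simp add: DERIV_def)
  qed
qed

lemma diff_k_flat_fun: "diff_k k (flat_fun p)"
proof (induction k arbitrary: p)
  case 0
  have "continuous_on UNIV (flat_fun p)" using flat_fun_deriv by (rule DERIV_continuous_on[OF has_field_derivative_at_within])
  then show ?case by simp
next
  case (Suc k)
  then show ?case using flat_fun_deriv[of p] by auto
qed

definition smooth_step :: "real \<Rightarrow> real" where
  "smooth_step x = flat_fun 1 x * inverse (flat_fun 1 x + flat_fun 1 (1 - x))"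

lemma flat_fun_1: "0 \<le> flat_fun 1 x" "x > 0 \<Longrightarrow> 0 < flat_fun 1 x" "x \<le> 0 \<Longrightarrow> flat_fun 1 x = 0"
  by (auto simp: flat_fun_def)

lemma flat_fun_sum_pos: "0 < flat_fun 1 x + flat_fun 1 (1 - x)"
  using flat_fun_1(1)[of x] flat_fun_1(1)[of "1 - x"] flat_fun_1(2)[of x] flat_fun_1(2)[of "1 - x"]
  by (cases "x > 0") auto

lemma smooth_step:
  "x \<le> 0 \<Longrightarrow> smooth_step x = 0" "x \<ge> 1 \<Longrightarrow> smooth_step x = 1"
  "0 \<le> smooth_step x" "smooth_step x \<le> 1" "diff_k k smooth_step"
proof -
  show "x \<le> 0 \<Longrightarrow> smooth_step x = 0" by (simp add: smooth_step_def flat_fun_1)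
  show "x \<ge> 1 \<Longrightarrow> smooth_step x = 1"
    using flat_fun_1(2)[of x] by (simp add: smooth_step_def flat_fun_1(3))
  show "0 \<le> smooth_step x" "smooth_step x \<le> 1"
    using flat_fun_1(1)[of x] flat_fun_1(1)[of "1 - x"] flat_fun_sum_pos[of x]
    by (simp_all add: smooth_step_def field_simps)
  have "diff_k k (\<lambda>x. flat_fun 1 (1 - x))"
    using diff_k_affine[OF diff_k_flat_fun, of k 1 "-1" 1] by simp
  then show "diff_k k smooth_step"
    unfolding smooth_step_def[abs_def]
    using flat_fun_sum_pos by (intro diff_k_mult diff_k_inverse diff_k_add diff_k_flat_fun) (auto simp: less_imp_neq[symmetric])
qed

section \<open>Products of one-variable functions as smooth functions in the plane\<close>

lemma has_derivative_product_Re_Im: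
  assumes "\<And>x. (\<xi> has_real_derivative \<xi>' x) (at x)" "\<And>x. (\<psi> has_real_derivative \<psi>' x) (at x)"
  shows "((\<lambda>z::complex. \<xi> (Re z) * \<psi> (Im z)) has_derivative
      (\<lambda>v. \<xi> (Re z) * (\<psi>' (Im z) * Im v) + (\<xi>' (Re z) * Re v) * \<psi> (Im z))) (at z)"
proof -
  have "((\<lambda>z. \<xi> (Re z)) has_derivative (\<lambda>v. \<xi>' (Re z) * Re v)) (at z)"
    using assms(1) by (intro has_derivative_compose[of Re Re z UNIV \<xi> "\<lambda>v. \<xi>' (Re z) * v"])
      (auto simp: has_field_derivative_def intro!: derivative_eq_intros)
  moreover have "((\<lambda>z. \<psi> (Im z)) has_derivative (\<lambda>v. \<psi>' (Im z) * Im v)) (at z)"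
    using assms(2) by (intro has_derivative_compose[of Im Im z UNIV \<psi> "\<lambda>v. \<psi>' (Im z) * v"])
      (auto simp: has_field_derivative_def intro!: derivative_eq_intros)
  ultimately show ?thesis by (rule has_derivative_mult)
qed

lemma partial_deriv_product_Re_Im:
  assumes "\<And>x. (\<xi> has_real_derivative \<xi>' x) (at x)" "\<And>x. (\<psi> has_real_derivative \<psi>' x) (at x)"
  shows "partial_deriv b (\<lambda>z::complex. \<xi> (Re z) * \<psi> (Im z)) z =
      \<xi> (Re z) * (\<psi>' (Im z) * Im b) + (\<xi>' (Re z) * Re b) * \<psi> (Im z)"
  by (simp add: frechet_derivative_at[OF has_derivative_product_Re_Im[OF assms], symmetric])

text \<open>Along a basis direction one of the two terms of the product rule vanishes. The partial
  derivatives are thus again products, and the induction does without closure of \<open>C_k\<close>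
  under sums.\<close>

lemma C_k_product:
  "diff_k k \<xi> \<Longrightarrow> diff_k k \<psi> \<Longrightarrow> C_k k (\<lambda>z::complex. \<xi> (Re z) * \<psi> (Im z))"
proof (induction k arbitrary: \<xi> \<psi>)
  case 0
  then show ?case by (auto intro!: continuous_intros continuous_on_compose2[of UNIV \<xi>] continuous_on_compose2[of UNIV \<psi>])
next
  case (Suc k)
  then obtain \<xi>' \<psi>' where *: "\<forall>x. (\<xi> has_real_derivative \<xi>' x) (at x)" "diff_k k \<xi>'"
    "\<forall>x. (\<psi> has_real_derivative \<psi>' x) (at x)" "diff_k k \<psi>'" by auto
  have low: "diff_k k \<xi>" "diff_k k \<psi>" using Suc.prems by (auto intro: diff_k_Suc_imp simp del: diff_k.simps)
  have "\<forall>z. (\<lambda>z::complex. \<xi> (Re z) * \<psi> (Im z)) differentiable (at z)"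
    using has_derivative_product_Re_Im[of \<xi> \<xi>' \<psi> \<psi>'] * unfolding differentiable_def by blast
  moreover have "partial_deriv b (\<lambda>z::complex. \<xi> (Re z) * \<psi> (Im z)) =
      (\<lambda>z. \<xi> (Re z) * (\<psi>' (Im z) * Im b) + (\<xi>' (Re z) * Re b) * \<psi> (Im z))" for b
    using * by (intro ext partial_deriv_product_Re_Im) auto
  moreover have "C_k k (\<lambda>z. \<xi>' (Re z) * \<psi> (Im z))" "C_k k (\<lambda>z. \<xi> (Re z) * \<psi>' (Im z))"
    using low * by (auto intro: Suc.IH)
  ultimately show ?case by (auto simp: Basis_complex_def)
qed

section \<open>Plateau functions approximating indicators of intervals\<close>

definition step_deriv :: "real \<Rightarrow> real" where
  "step_deriv = (SOME D. (\<forall>x. (smooth_step has_real_derivative D x) (at x)) \<and> continuous_on UNIV D)"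

lemma step_deriv:
  "(smooth_step has_real_derivative step_deriv x) (at x)" "continuous_on UNIV step_deriv"
proof -
  obtain D where "\<forall>x. (smooth_step has_real_derivative D x) (at x)" "diff_k 0 D"
    using smooth_step(5)[of "Suc 0"] by auto
  then have "\<exists>D. (\<forall>x. (smooth_step has_real_derivative D x) (at x)) \<and> continuous_on UNIV D" by auto
  from someI_ex[OF this] show "(smooth_step has_real_derivative step_deriv x) (at x)" "continuous_on UNIV step_deriv"
    unfolding step_deriv_def by blast+
qed

lemma step_deriv_eq_0:
  assumes "x < 0 \<or> x > 1"
  shows "step_deriv x = 0"
proof -
  have "(smooth_step has_real_derivative 0) (at x)"
  proof (cases "x < 0")
    case True
    show ?thesis
      by (rule has_field_derivative_transform_within_open[of "\<lambda>_. 0" _ _ "{..<0}"])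
         (use True in \<open>auto simp: smooth_step(1)\<close>)
  next
    case False
    show ?thesis
      by (rule has_field_derivative_transform_within_open[of "\<lambda>_. 1" _ _ "{1<..}"])
         (use False assms in \<open>auto simp: smooth_step(2)\<close>)
  qed
  then show ?thesis using step_deriv(1) DERIV_unique by blast
qed

lemma step_deriv_measurable[measurable]: "step_deriv \<in> borel_measurable borel"
  using step_deriv(2) by (rule borel_measurable_continuous_onI)

lemma step_deriv_indicator: "step_deriv x = indicator {0..1} x *\<^sub>R step_deriv x"
  using step_deriv_eq_0[of x] by (cases "x < 0 \<or> x > 1") (auto simp: indicator_def)

lemma step_deriv_integrable: "integrable lborel step_deriv"
proof -
  have "integrable lborel (\<lambda>x. indicator {0..1::real} x *\<^sub>R step_deriv x)"
    using step_deriv(2) by (intro borel_integrable_compact) (auto intro: continuous_on_subset)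
  then show ?thesis unfolding step_deriv_indicator[symmetric] .
qed

lemma step_deriv_integral: "(LINT x|lborel. step_deriv x) = 1"
proof -
  have "(LINT x|lborel. step_deriv x) = (LINT x:{0..1}|lborel. step_deriv x)"
    unfolding set_lebesgue_integral_def step_deriv_indicator[symmetric] ..
  also have "\<dots> = integral {0..1} step_deriv"
    using step_deriv_integrable
    by (intro set_borel_integral_eq_integral) (simp only: set_integrable_def step_deriv_indicator[symmetric])
  also have "\<dots> = smooth_step 1 - smooth_step 0"
    using step_deriv(1)
    by (intro integral_unique fundamental_theorem_of_calculus)
       (auto simp: has_real_derivative_iff_has_vector_derivative intro: has_vector_derivative_at_within)
  finally show ?thesis by (simp add: smooth_step)
qed

text \<open>It rises on \<open>[p, p + 1/m]\<close> and falls on \<open>[q - 1/m, q]\<close>; the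
  summand 1 shifts the second ramp so that it ends at \<open>q\<close>. Both ramps lie in
  \<open>[p, q]\<close> as soon as \<open>m \<ge> 1 / (q - p)\<close>.\<close>

definition plateau :: "real \<Rightarrow> real \<Rightarrow> real \<Rightarrow> real \<Rightarrow> real" where
  "plateau p q m s = smooth_step (m * (s - p)) - smooth_step (m * (s - q) + 1)"

definition plateau_deriv :: "real \<Rightarrow> real \<Rightarrow> real \<Rightarrow> real \<Rightarrow> real" where
  "plateau_deriv p q m s = m * step_deriv (m * (s - p)) - m * step_deriv (m * (s - q) + 1)"

lemma plateau_diff_k: "diff_k k (plateau p q m)"
proof -
  have "diff_k k (\<lambda>s. smooth_step (m * s + (- m * p)))" "diff_k k (\<lambda>s. smooth_step (m * s + (1 - m * q)))"
    by (intro diff_k_affine smooth_step)+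
  from diff_k_diff[OF this] show ?thesis
    by (simp add: plateau_def[abs_def] algebra_simps)
qed

lemma plateau_has_derivative: "(plateau p q m has_real_derivative plateau_deriv p q m s) (at s)"
  unfolding plateau_def[abs_def] plateau_deriv_def
  by (auto intro!: derivative_eq_intros step_deriv(1)[THEN DERIV_chain2])

lemma continuous_plateau: "continuous_on UNIV (plateau p q m)" "continuous_on UNIV (plateau_deriv p q m)"
proof -
  show "continuous_on UNIV (plateau p q m)" using plateau_diff_k diff_k_continuous by blast
  show "continuous_on UNIV (plateau_deriv p q m)" unfolding plateau_deriv_def[abs_def]
    by (intro continuous_intros continuous_on_compose2[OF step_deriv(2)]) auto
qed

lemma plateau_measurable[measurable]:
  "plateau p q m \<in> borel_measurable borel" "plateau_deriv p q m \<in> borel_measurable borel"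
  using continuous_plateau by (auto intro: borel_measurable_continuous_onI)

lemma abs_plateau_le_1: "\<bar>plateau p q m s\<bar> \<le> 1"
  using smooth_step(3,4)[of "m * (s - p)"] smooth_step(3,4)[of "m * (s - q) + 1"]
  unfolding plateau_def by linarith

lemma plateau_outside:
  assumes "p < q" "m \<ge> 1 / (q - p)"
  shows "s \<notin> {p<..<q} \<Longrightarrow> plateau p q m s = 0" "s \<notin> {p..q} \<Longrightarrow> plateau_deriv p q m s = 0"
proof -
  have m: "m > 0" using assms by (meson diff_gt_0_iff_gt less_le_trans zero_less_divide_1_iff)
  have mm: "m * (q - p) \<ge> 1" using assms by (simp add: pos_divide_le_eq)
  have left: "m * (s - p) \<le> 0 \<and> m * (s - q) + 1 \<le> 0" if "s \<le> p"
  proof -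
    have "m * (s - p) \<le> 0" using m that by (simp add: mult_nonneg_nonpos)
    moreover have "m * (s - q) = m * (s - p) - m * (q - p)" by (simp add: algebra_simps)
    ultimately show ?thesis using mm by linarith
  qed
  have right: "m * (s - p) \<ge> 1 \<and> m * (s - q) + 1 \<ge> 1" if "q \<le> s"
  proof -
    have "m * (s - q) \<ge> 0" using m that by simp
    moreover have "m * (s - p) = m * (s - q) + m * (q - p)" by (simp add: algebra_simps)
    ultimately show ?thesis using mm by linarith
  qed
  show "s \<notin> {p<..<q} \<Longrightarrow> plateau p q m s = 0"
    using left right unfolding plateau_def by (cases "s \<le> p") (auto simp: smooth_step)
  have left': "m * (s - p) < 0 \<and> m * (s - q) + 1 < 0" if "s < p"
  proof -
    have "m * (s - p) < 0" using m that by (simp add: mult_pos_neg)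
    moreover have "m * (s - q) = m * (s - p) - m * (q - p)" by (simp add: algebra_simps)
    ultimately show ?thesis using mm by linarith
  qed
  have right': "m * (s - p) > 1 \<and> m * (s - q) + 1 > 1" if "q < s"
  proof -
    have "m * (s - q) > 0" using m that by simp
    moreover have "m * (s - p) = m * (s - q) + m * (q - p)" by (simp add: algebra_simps)
    ultimately show ?thesis using mm by linarith
  qed
  show "s \<notin> {p..q} \<Longrightarrow> plateau_deriv p q m s = 0"
    using left' right' unfolding plateau_deriv_def by (cases "s < p") (auto simp: step_deriv_eq_0)
qed

lemma plateau_tendsto:
  assumes "p < q"
  shows "(\<lambda>m. plateau p q (real m) s) \<longlonglongrightarrow> indicator {p<..<q} s"
proof (cases "s \<in> {p<..<q}")
  case True
  define N where "N = nat \<lceil>max (1 / (s - p)) (1 / (q - s))\<rceil>"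
  have "plateau p q (real m) s = 1" if "m \<ge> N" for m
  proof -
    have "real m \<ge> 1 / (s - p)" "real m \<ge> 1 / (q - s)" using that unfolding N_def by linarith+
    then have "real m * (s - p) \<ge> 1" "real m * (q - s) \<ge> 1" using True by (simp_all add: pos_divide_le_eq)
    moreover have "real m * (s - q) = - (real m * (q - s))" by (simp add: algebra_simps)
    ultimately show ?thesis unfolding plateau_def by (simp add: smooth_step)
  qed
  then show ?thesis using True
    by (intro tendsto_eventually) (auto simp: eventually_sequentially)
next
  case False
  have "plateau p q (real m) s = 0" if "m \<ge> nat \<lceil>1 / (q - p)\<rceil>" for m
    using that assms False by (intro plateau_outside) linarith+
  then have "\<forall>\<^sub>F m in sequentially. plateau p q (real m) s = 0"
    by (rule eventually_sequentiallyI)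
  then show ?thesis using False by (intro tendsto_eventually) simp
qed

text \<open>The rescaled derivative of the step is an approximate identity: its total mass is one
  and its support shrinks to a point. The base point \<open>a m\<close> may move, since the falling
  ramp starts at \<open>q - 1/m\<close>.\<close>

lemma step_deriv_average_tendsto:
  fixes u :: "real \<Rightarrow> 'b::euclidean_space"
  assumes u: "continuous_on UNIV u" and a: "a \<longlonglongrightarrow> a0"
  shows "(\<lambda>m. LINT x|lborel. step_deriv x *\<^sub>R u (a m + x / real m)) \<longlonglongrightarrow> u a0"
proof -
  obtain A where A: "\<And>m. \<bar>a m\<bar> \<le> A"
    using convergent_imp_Bseq[OF convergentI[OF a]] unfolding Bseq_def by auto
  have "compact (u ` {-A - 1..A + 1})" using u
    by (intro compact_continuous_image) (auto intro: continuous_on_subset)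
  then obtain B where B: "\<And>y. y \<in> {-A - 1..A + 1} \<Longrightarrow> norm (u y) \<le> B"
    using compact_imp_bounded[of "u ` {-A - 1..A + 1}"] unfolding bounded_iff by (metis imageI)
  have um[measurable]: "u \<in> borel_measurable borel" using u by (rule borel_measurable_continuous_onI)
  have "(\<lambda>m. LINT x|lborel. step_deriv x *\<^sub>R u (a m + x / real m)) \<longlonglongrightarrow> (LINT x|lborel. step_deriv x *\<^sub>R u a0)"
  proof (rule integral_dominated_convergence[where w = "\<lambda>x. \<bar>step_deriv x\<bar> * B"])
    show "integrable lborel (\<lambda>x. \<bar>step_deriv x\<bar> * B)"
      using step_deriv_integrable by auto
    show "AE x in lborel. (\<lambda>m. step_deriv x *\<^sub>R u (a m + x / real m)) \<longlonglongrightarrow> step_deriv x *\<^sub>R u a0"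
    proof (rule AE_I2)
      fix x :: real
      have t: "(\<lambda>m. a m + x / real m) \<longlonglongrightarrow> a0"
        using tendsto_add[OF a lim_const_over_n[of x]] by simp
      have "isCont u a0" using u by (simp add: continuous_on_eq_continuous_at)
      from isCont_tendsto_compose[OF this t] have "(\<lambda>m. u (a m + x / real m)) \<longlonglongrightarrow> u a0" .
      then show "(\<lambda>m. step_deriv x *\<^sub>R u (a m + x / real m)) \<longlonglongrightarrow> step_deriv x *\<^sub>R u a0"
        by (intro tendsto_intros)
    qed
    show "AE x in lborel. norm (step_deriv x *\<^sub>R u (a m + x / real m)) \<le> \<bar>step_deriv x\<bar> * B" for m
    proof (rule AE_I2)
      fix x :: real
      show "norm (step_deriv x *\<^sub>R u (a m + x / real m)) \<le> \<bar>step_deriv x\<bar> * B"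
      proof (cases "x \<in> {0..1}")
        case True
        \<comment> \<open>For \<open>m = 0\<close> the quotient is 0, so the bound holds there as
          well.\<close>
        have "0 \<le> x / real m \<and> x / real m \<le> 1"
        proof (cases "m = 0")
          case False
          then have "x / real m \<le> x / 1" using True by (intro divide_left_mono) auto
          then show ?thesis using True by auto
        qed simp
        then have "a m + x / real m \<in> {-A - 1..A + 1}" using A[of m] by (auto simp: abs_le_iff) 
        then have "norm (u (a m + x / real m)) \<le> B" by (rule B)
        then show ?thesis by (auto intro: mult_left_mono)
      next
        case False
        then show ?thesis using step_deriv_eq_0[of x] by auto
      qed
    qed
  qed measurable
  also have "(LINT x|lborel. step_deriv x *\<^sub>R u a0) = u a0"
    using step_deriv_integral step_deriv_integrable by simp
  finally show ?thesis .
qed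

lemma step_deriv_substitution:
  fixes u :: "real \<Rightarrow> 'b::euclidean_space"
  assumes "m > 0"
  shows "(LINT s|lborel. (m * step_deriv (m * (s - a))) *\<^sub>R u s) = (LINT x|lborel. step_deriv x *\<^sub>R u (a + x / m))"
proof -
  have "(LINT s|lborel. (m * step_deriv (m * (s - a))) *\<^sub>R u s) =
      \<bar>1 / m\<bar> *\<^sub>R (LINT x|lborel. (m * step_deriv (m * (a + 1 / m * x - a))) *\<^sub>R u (a + 1 / m * x))"
    using assms by (intro lborel_integral_real_affine) auto
  also have "\<dots> = \<bar>1 / m\<bar> *\<^sub>R (LINT x|lborel. m *\<^sub>R (step_deriv x *\<^sub>R u (a + x / m)))"
    using assms by simp
  also have "\<dots> = (LINT x|lborel. step_deriv x *\<^sub>R u (a + x / m))"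
  proof -
    have "\<bar>1 / m\<bar> * m = 1" using assms by simp
    have "\<bar>1 / m\<bar> *\<^sub>R (LINT x|lborel. m *\<^sub>R (step_deriv x *\<^sub>R u (a + x / m))) =
        \<bar>1 / m\<bar> *\<^sub>R (m *\<^sub>R (LINT x|lborel. step_deriv x *\<^sub>R u (a + x / m)))"
      by (simp only: integral_scaleR_right)
    also have "\<dots> = (\<bar>1 / m\<bar> * m) *\<^sub>R (LINT x|lborel. step_deriv x *\<^sub>R u (a + x / m))"
      by (rule scaleR_scaleR)
    finally show ?thesis unfolding \<open>\<bar>1 / m\<bar> * m = 1\<close> by simp
  qed
  finally show ?thesis .
qed

lemma plateau_deriv_integral_tendsto:
  fixes u :: "real \<Rightarrow> 'b::euclidean_space"
  assumes u: "continuous_on UNIV u"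
  shows "(\<lambda>m. LINT s|lborel. plateau_deriv p q (real m) s *\<^sub>R u s) \<longlonglongrightarrow> u p - u q"
proof -
  have int: "integrable lborel (\<lambda>s. (m * step_deriv (m * (s - a))) *\<^sub>R u s)" if m: "m > 0" for m a
  proof -
    have "integrable lborel (\<lambda>s. indicator {a..a + 1 / m} s *\<^sub>R ((m * step_deriv (m * (s - a))) *\<^sub>R u s))"
      by (intro borel_integrable_compact continuous_intros continuous_on_compose2[OF step_deriv(2)] continuous_on_subset[OF u]) auto
    moreover have "(\<lambda>s. indicator {a..a + 1 / m} s *\<^sub>R ((m * step_deriv (m * (s - a))) *\<^sub>R u s)) = (\<lambda>s. (m * step_deriv (m * (s - a))) *\<^sub>R u s)"
    proof (rule ext)
      fix s
      show "indicator {a..a + 1 / m} s *\<^sub>R ((m * step_deriv (m * (s - a))) *\<^sub>R u s) = (m * step_deriv (m * (s - a))) *\<^sub>R u s"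
      proof (cases "s \<in> {a..a + 1 / m}")
      case False
      then have "m * (s - a) < 0 \<or> m * (s - a) > 1"
        using m by (auto simp: mult_pos_neg field_simps)
      then show ?thesis using False by (simp add: step_deriv_eq_0)
      qed simp
    qed
    ultimately show ?thesis by (simp only:)
  qed
  have eq: "(LINT s|lborel. plateau_deriv p q m s *\<^sub>R u s) =
      (LINT x|lborel. step_deriv x *\<^sub>R u (p + x / m)) - (LINT x|lborel. step_deriv x *\<^sub>R u ((q - 1 / m) + x / m))"
    if m: "m > 0" for m
  proof -
    have *: "m * (s - q) + 1 = m * (s - (q - 1 / m))" for s using m by (simp add: field_simps)
    show ?thesis unfolding plateau_deriv_def * scaleR_diff_left
      by (subst Bochner_Integration.integral_diff) (use m in \<open>auto intro!: int simp: step_deriv_substitution[of m, simplified]\<close>)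
  qed
  have "(\<lambda>m. (LINT x|lborel. step_deriv x *\<^sub>R u (p + x / real m)) - (LINT x|lborel. step_deriv x *\<^sub>R u ((q - 1 / real m) + x / real m))) \<longlonglongrightarrow> u p - u q"
  proof (intro tendsto_diff step_deriv_average_tendsto u)
    show "(\<lambda>m. q - 1 / real m) \<longlonglongrightarrow> q" using tendsto_diff[OF tendsto_const[of q] lim_1_over_n] by simp
  qed auto
  then show ?thesis
    by (rule Lim_transform_eventually) (use eq in \<open>auto simp: eventually_sequentially intro!: exI[of _ 1]\<close>)
qed

text \<open>The bound does not depend on \<open>m\<close>, because rescaling preserves the mass of
  \<open>step_deriv\<close>. It provides the dominating function for the limit in
  \<open>rectangle_identity\<close>.\<close>

lemma plateau_deriv_integral_bound:
  fixes u :: "real \<Rightarrow> 'b::euclidean_space"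
  assumes pq: "p < q" and m: "m \<ge> 1 / (q - p)" and u[measurable]: "u \<in> borel_measurable borel"
    and B: "\<And>s. s \<in> {p..q} \<Longrightarrow> norm (u s) \<le> B"
  shows "norm (LINT s|lborel. plateau_deriv p q m s *\<^sub>R u s) \<le> 2 * B * (LINT x|lborel. \<bar>step_deriv x\<bar>)"
proof -
  have m0: "m > 0" using assms by (meson diff_gt_0_iff_gt less_le_trans zero_less_divide_1_iff)
  have "norm (u p) \<le> B" using B[of p] pq by simp
  then have B0: "0 \<le> B" using norm_ge_zero[of "u p"] by linarith
  have i: "integrable lborel (\<lambda>s. \<bar>m * step_deriv (m * s + c)\<bar>)" and
    v: "(LINT s|lborel. \<bar>m * step_deriv (m * s + c)\<bar>) = (LINT x|lborel. \<bar>step_deriv x\<bar>)" for c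
  proof -
    have "integrable lborel (\<lambda>s. step_deriv (c + m * s))"
      using step_deriv_integrable m0 by (intro lborel_integrable_real_affine) auto
    then show "integrable lborel (\<lambda>s. \<bar>m * step_deriv (m * s + c)\<bar>)"
      by (simp add: abs_mult add.commute)
    have "(LINT x|lborel. \<bar>step_deriv x\<bar>) = \<bar>m\<bar> *\<^sub>R (LINT s|lborel. \<bar>step_deriv (c + m * s)\<bar>)"
      using m0 by (intro lborel_integral_real_affine) auto
    then show "(LINT s|lborel. \<bar>m * step_deriv (m * s + c)\<bar>) = (LINT x|lborel. \<bar>step_deriv x\<bar>)"
      by (simp add: abs_mult add.commute)
  qed
  let ?w = "\<lambda>s. B * (\<bar>m * step_deriv (m * s + (- m * p))\<bar> + \<bar>m * step_deriv (m * s + (1 - m * q))\<bar>)"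
  have wi: "integrable lborel ?w"
    by (intro integrable_mult_right Bochner_Integration.integrable_add i)
  have bd: "norm (plateau_deriv p q m s *\<^sub>R u s) \<le> ?w s" for s
  proof (cases "s \<in> {p..q}")
    case True
    have "m * (s - p) = m * s + (- m * p)" "m * (s - q) + 1 = m * s + (1 - m * q)" by (simp_all add: algebra_simps)
    then have "\<bar>plateau_deriv p q m s\<bar> \<le> \<bar>m * step_deriv (m * s + (- m * p))\<bar> + \<bar>m * step_deriv (m * s + (1 - m * q))\<bar>"
      unfolding plateau_deriv_def by (metis abs_triangle_ineq4)
    then have "\<bar>plateau_deriv p q m s\<bar> * norm (u s) \<le> (\<bar>m * step_deriv (m * s + (- m * p))\<bar> + \<bar>m * step_deriv (m * s + (1 - m * q))\<bar>) * B"
      using B[OF True] by (intro mult_mono) auto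
    then show ?thesis by (simp add: mult.commute)
  next
    case False
    then show ?thesis using plateau_outside(2)[OF pq m] B0 by simp
  qed
  have "norm (plateau_deriv p q m s *\<^sub>R u s) \<le> norm (?w s)" for s
    using bd[of s] abs_ge_self[of "?w s"] unfolding real_norm_def by (rule order_trans)
  then have "integrable lborel (\<lambda>s. plateau_deriv p q m s *\<^sub>R u s)"
    by (intro Bochner_Integration.integrable_bound[OF wi]) auto
  then have "norm (LINT s|lborel. plateau_deriv p q m s *\<^sub>R u s) \<le> (LINT s|lborel. ?w s)"
    using wi bd by (intro Bochner_Integration.integral_norm_bound_integral) auto
  also have "(LINT s|lborel. ?w s) = 2 * B * (LINT x|lborel. \<bar>step_deriv x\<bar>)"
    by (subst integral_mult_right_zero, subst Bochner_Integration.integral_add[OF i i]) (simp only: v, simp)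
  finally show ?thesis .
qed

section \<open>Absolute continuity on lines\<close>

text \<open>After extension by zero the integrals over all half-lines vanish. Half-lines form an
  intersection-stable generator of the Borel sets, and the case \<open>a = d\<close> handles
  complements, so the integral over every Borel set vanishes.\<close>

lemma AE_eq_0_if_interval_integrals_eq_0:
  fixes D :: "real \<Rightarrow> 'b::euclidean_space"
  assumes int: "set_integrable lborel {c<..<d} D"
    and zero: "\<And>a. c < a \<Longrightarrow> a \<le> d \<Longrightarrow> (LINT t:{c<..<a}|lborel. D t) = 0"
  shows "AE t in lborel. t \<in> {c<..<d} \<longrightarrow> D t = 0"
proof (cases "c < d")
  case True
  define f where "f t = indicator {c<..<d} t *\<^sub>R D t" for t
  have fi: "integrable lborel f" using int unfolding f_def set_integrable_def .
  have fm[measurable]: "f \<in> borel_measurable borel" using fi by auto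
  have fA: "integrable lborel (\<lambda>t. indicator A t *\<^sub>R f t)" if "A \<in> sets borel" for A
    using fi that by (intro integrable_mult_indicator) auto
  have total: "(LINT t|lborel. f t) = 0"
    using zero[OF True order_refl] unfolding f_def set_lebesgue_integral_def .
  have all: "(LINT t:A|lborel. f t) = 0" if A: "A \<in> sets lborel" for A
  proof -
    have st: "Int_stable (range (lessThan :: real \<Rightarrow> real set))"
      unfolding Int_stable_def
    proof safe
      fix a b :: real
      have "{..<a} \<inter> {..<b} = {..<min a b}" by auto
      then show "{..<a} \<inter> {..<b} \<in> range lessThan" by simp
    qed
    have se: "sigma_sets UNIV (range (lessThan :: real \<Rightarrow> real set)) = sets borel"
      unfolding borel_Iio by (subst sets_measure_of) auto
    have sub: "range (lessThan :: real \<Rightarrow> real set) \<subseteq> Pow UNIV" by simp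
    have "A \<in> sigma_sets UNIV (range lessThan)" using A se by simp
    from st sub this show ?thesis
    proof (induction rule: sigma_sets_induct_disjoint)
      case (basic A)
      then obtain a where a: "A = {..<a}" by auto
      have "(LINT t:A|lborel. f t) = (LINT t:{c<..<min a d}|lborel. D t)"
        unfolding set_lebesgue_integral_def f_def a
        by (intro Bochner_Integration.integral_cong) (auto simp: indicator_def)
      also have "\<dots> = 0"
        using zero[of "min a d"] True by (cases "c < min a d") (auto simp: set_lebesgue_integral_def)
      finally show ?case .
    next
      case empty
      then show ?case by (simp add: set_lebesgue_integral_def)
    next
      case (compl A)
      have Ab: "A \<in> sets borel" using compl(1) se by simp
      have "(LINT t:UNIV - A|lborel. f t) = (LINT t|lborel. f t - indicator A t *\<^sub>R f t)"
        unfolding set_lebesgue_integral_def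
        by (intro Bochner_Integration.integral_cong) (auto simp: indicator_def)
      also have "\<dots> = (LINT t|lborel. f t) - (LINT t|lborel. indicator A t *\<^sub>R f t)"
        by (intro Bochner_Integration.integral_diff fi fA Ab)
      finally show ?case using compl(2) total by (simp add: set_lebesgue_integral_def)
    next
      case (union A)
      have Ab: "A i \<in> sets borel" for i using union(2) se by auto
      have "(LINT t:(\<Union>i. A i)|lborel. f t) = (\<Sum>i. (LINT t:A i|lborel. f t))"
      proof (rule lebesgue_integral_countable_add)
        show "A i \<inter> A j = {}" if "i \<noteq> j" for i j using union(1) that by (auto simp: disjoint_family_on_def)
        show "set_integrable lborel (\<Union>i. A i) f" unfolding set_integrable_def using Ab by (intro fA) auto
      qed (use Ab in auto)
      then show ?case using union(3) by simp
    qed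
  qed
  have "AE t in lborel. f t = 0" using fi all by (rule sigma_finite_measure.density_zero[OF sigma_finite_lborel])
  then show ?thesis by eventually_elim (auto simp: f_def indicator_def)
qed auto

text \<open>The weak identity is needed only for products of plateaus. As \<open>m\<close> grows,
  the differentiated factor turns into the difference of point evaluations at \<open>p\<close> and
  \<open>q\<close>, while the other factors turn into indicators. Dominated convergence passes to
  the limit on both sides; the minus sign of the weak identity swaps \<open>p\<close> and
  \<open>q\<close>.\<close>

lemma rectangle_identity:
  fixes F G :: "real \<times> real \<Rightarrow> 'b::euclidean_space"
  assumes F: "continuous_on UNIV F" and Gm[measurable]: "G \<in> borel_measurable borel"
    and G: "set_integrable lborel ({p<..<q} \<times> {c<..<d}) G" and pq: "p < q" and cd: "c < d"
    and weak: "\<And>m. m \<ge> 1 / (q - p) \<Longrightarrow> m \<ge> 1 / (d - c) \<Longrightarrow>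
      (LINT z|lborel. (plateau_deriv p q m (fst z) * plateau c d m (snd z)) *\<^sub>R F z) =
      - (LINT z|lborel. (plateau p q m (fst z) * plateau c d m (snd z)) *\<^sub>R G z)"
  shows "(LINT t:{c<..<d}|lborel. F (q, t) - F (p, t)) = (LINT z:{p<..<q} \<times> {c<..<d}|lborel. G z)"
proof -
  let ?R = "{p<..<q} \<times> {c<..<d}" and ?Q = "{p..q} \<times> {c..d}"
  have Fm[measurable]: "F \<in> borel_measurable borel" using F by (rule borel_measurable_continuous_onI)
  have Fm'[measurable]: "F \<in> borel_measurable (borel \<Otimes>\<^sub>M borel)" unfolding borel_prod by simp
  have Gp: "(\<lambda>z. (plateau p q m (fst z) * plateau c d m (snd z)) *\<^sub>R G z) \<in> borel_measurable borel" for m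
    by (intro borel_measurable_scaleR Gm borel_measurable_continuous_onI continuous_intros
        continuous_on_compose2[OF continuous_plateau(1)]) auto
  \<comment> \<open>The scales start at \<open>N\<close>, so that all ramps fit into the
    rectangle.\<close>
  obtain N :: nat where N: "real N \<ge> 1 / (q - p)" "real N \<ge> 1 / (d - c)"
    using real_arch_simple[of "max (1 / (q - p)) (1 / (d - c))"] by auto
  define \<mu> where "\<mu> n = real (n + N)" for n
  let ?P = "\<lambda>n z. plateau p q (\<mu> n) (fst z) * plateau c d (\<mu> n) (snd z)"
  have \<mu>: "\<mu> n \<ge> 1 / (q - p)" "\<mu> n \<ge> 1 / (d - c)" for n using N unfolding \<mu>_def by linarith+
  have "compact (F ` ?Q)" using F
    by (intro compact_continuous_image compact_Times) (auto intro: continuous_on_subset)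
  then obtain B where B: "\<And>z. z \<in> ?Q \<Longrightarrow> norm (F z) \<le> B"
    using compact_imp_bounded[of "F ` ?Q"] unfolding bounded_iff by (metis imageI)
  have Fc1: "continuous_on UNIV (\<lambda>s. F (s, t))" for t
    by (intro continuous_on_compose2[OF F] continuous_intros) auto
  have Fc2: "continuous_on UNIV (\<lambda>t. F (s, t))" for s
    by (intro continuous_on_compose2[OF F] continuous_intros) auto
  have Fs[measurable]: "(\<lambda>s. F (s, t)) \<in> borel_measurable borel" "(\<lambda>t. F (s, t)) \<in> borel_measurable borel" for s t
    using Fc1 Fc2 by (auto intro: borel_measurable_continuous_onI)
  define I where "I n t = (LINT s|lborel. plateau_deriv p q (\<mu> n) s *\<^sub>R F (s, t))" for n t
  have Im[measurable]: "I n \<in> borel_measurable borel" for n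
    unfolding I_def[abs_def] by measurable
  have lhs: "(LINT z|lborel. (plateau_deriv p q (\<mu> n) (fst z) * plateau c d (\<mu> n) (snd z)) *\<^sub>R F z) =
      (LINT t|lborel. plateau c d (\<mu> n) t *\<^sub>R I n t)" for n
  proof -
    let ?f = "\<lambda>z. (plateau_deriv p q (\<mu> n) (fst z) * plateau c d (\<mu> n) (snd z)) *\<^sub>R F z"
    have "integrable lborel (\<lambda>z. indicator ?Q z *\<^sub>R ?f z)"
      by (intro borel_integrable_compact compact_Times continuous_intros continuous_on_subset[OF F]
        continuous_on_compose2[OF continuous_plateau(1)] continuous_on_compose2[OF continuous_plateau(2)]) auto
    moreover have "(\<lambda>z. indicator ?Q z *\<^sub>R ?f z) = ?f"
    proof (rule ext)
      fix z
      show "indicator ?Q z *\<^sub>R ?f z = ?f z"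
      using plateau_outside(1)[OF cd \<mu>(2), of "snd z" n] plateau_outside(2)[OF pq \<mu>(1), of "fst z" n]
      by (cases "fst z \<in> {p..q}"; cases "snd z \<in> {c..d}") (auto simp: indicator_def mem_Times_iff)
    qed
    ultimately have fi: "integrable (lborel \<Otimes>\<^sub>M lborel) ?f" unfolding lborel_prod by (simp only:)
    have "(LINT z|lborel. ?f z) = (LINT t|lborel. (LINT s|lborel. ?f (s, t)))"
      using lborel_pair.integral_snd[of "\<lambda>s t. ?f (s, t)"] fi by (simp add: lborel_prod case_prod_beta')
    also have "\<dots> = (LINT t|lborel. plateau c d (\<mu> n) t *\<^sub>R I n t)"
    proof (rule Bochner_Integration.integral_cong[OF refl])
      fix t
      have "(LINT s|lborel. ?f (s, t)) = (LINT s|lborel. plateau c d (\<mu> n) t *\<^sub>R (plateau_deriv p q (\<mu> n) s *\<^sub>R F (s, t)))"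
        by (simp add: mult.commute)
      then show "(LINT s|lborel. ?f (s, t)) = plateau c d (\<mu> n) t *\<^sub>R I n t"
        unfolding I_def by (simp only: integral_scaleR_right)
    qed
    finally show ?thesis .
  qed
  let ?W = "2 * B * (LINT x|lborel. \<bar>step_deriv x\<bar>)"
  have off: "(\<lambda>n. plateau a b (\<mu> n) s) \<longlonglongrightarrow> indicator {a<..<b} s" if "a < b" for a b s
    unfolding \<mu>_def using LIMSEQ_ignore_initial_segment[OF plateau_tendsto[OF that]] by simp
  have "(\<lambda>n. LINT t|lborel. plateau c d (\<mu> n) t *\<^sub>R I n t) \<longlonglongrightarrow> (LINT t|lborel. indicator {c<..<d} t *\<^sub>R (F (p, t) - F (q, t)))"
  proof (rule integral_dominated_convergence[where w = "\<lambda>t. indicator {c..d} t * ?W"])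
    show "integrable lborel (\<lambda>t. indicator {c..d} t * ?W)" by (intro integrable_mult_left integrable_real_indicator) (auto simp: emeasure_lborel_Icc_eq)
    show "AE t in lborel. (\<lambda>n. plateau c d (\<mu> n) t *\<^sub>R I n t) \<longlonglongrightarrow> indicator {c<..<d} t *\<^sub>R (F (p, t) - F (q, t))"
    proof (rule AE_I2)
      fix t :: real
      have "(\<lambda>n. I n t) \<longlonglongrightarrow> F (p, t) - F (q, t)"
        unfolding I_def \<mu>_def
        using LIMSEQ_ignore_initial_segment[OF plateau_deriv_integral_tendsto[OF Fc1[of t], of p q], of N] by simp
      then show "(\<lambda>n. plateau c d (\<mu> n) t *\<^sub>R I n t) \<longlonglongrightarrow> indicator {c<..<d} t *\<^sub>R (F (p, t) - F (q, t))"
        by (intro tendsto_scaleR off cd)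
    qed
    show "AE t in lborel. norm (plateau c d (\<mu> n) t *\<^sub>R I n t) \<le> indicator {c..d} t * ?W" for n
    proof (rule AE_I2)
      fix t :: real
      show "norm (plateau c d (\<mu> n) t *\<^sub>R I n t) \<le> indicator {c..d} t * ?W"
      proof (cases "t \<in> {c..d}")
        case True
        have "norm (I n t) \<le> ?W" unfolding I_def
          by (rule plateau_deriv_integral_bound[OF pq \<mu>(1)]) (use B True in auto)
        then have "\<bar>plateau c d (\<mu> n) t\<bar> * norm (I n t) \<le> 1 * ?W"
          by (intro mult_mono abs_plateau_le_1) auto
        then show ?thesis using True by simp
      next
        case False
        then show ?thesis using plateau_outside(1)[OF cd \<mu>(2), of t n] by auto
      qed
    qed
  qed measurable
  moreover have "(\<lambda>n. LINT z|lborel. ?P n z *\<^sub>R G z) \<longlonglongrightarrow>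
      (LINT z|lborel. indicator ?R z *\<^sub>R G z)"
  proof (rule integral_dominated_convergence[where w = "\<lambda>z. norm (indicator ?R z *\<^sub>R G z)"])
    show "integrable lborel (\<lambda>z. norm (indicator ?R z *\<^sub>R G z))"
      using G unfolding set_integrable_def by (rule integrable_norm)
    show "AE z in lborel. (\<lambda>n. ?P n z *\<^sub>R G z) \<longlonglongrightarrow> indicator ?R z *\<^sub>R G z"
    proof (rule AE_I2)
      fix z :: "real \<times> real"
      have "(\<lambda>n. ?P n z *\<^sub>R G z) \<longlonglongrightarrow>
         (indicator {p<..<q} (fst z) * indicator {c<..<d} (snd z)) *\<^sub>R G z"
        by (intro tendsto_scaleR tendsto_mult off pq cd tendsto_const)
      then show "(\<lambda>n. ?P n z *\<^sub>R G z) \<longlonglongrightarrow> indicator ?R z *\<^sub>R G z"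
        by (simp add: indicator_times)
    qed
    show "AE z in lborel. norm (?P n z *\<^sub>R G z)
        \<le> norm (indicator ?R z *\<^sub>R G z)" for n
    proof (rule AE_I2)
      fix z :: "real \<times> real"
      show "norm (?P n z *\<^sub>R G z)
        \<le> norm (indicator ?R z *\<^sub>R G z)"
      proof (cases "z \<in> ?R")
        case True
        have "\<bar>plateau p q (\<mu> n) (fst z)\<bar> * \<bar>plateau c d (\<mu> n) (snd z)\<bar> \<le> 1 * 1"
          by (intro mult_mono abs_plateau_le_1) auto
        then have "\<bar>plateau p q (\<mu> n) (fst z) * plateau c d (\<mu> n) (snd z)\<bar> * norm (G z) \<le> 1 * norm (G z)"
          unfolding abs_mult by (intro mult_right_mono) auto
        then show ?thesis using True by simp
      next
        case False
        then show ?thesis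
          using plateau_outside(1)[OF cd \<mu>(2), of "snd z" n] plateau_outside(1)[OF pq \<mu>(1), of "fst z" n]
          by (auto simp: mem_Times_iff)
      qed
    qed
  qed (use Gp Gm G in \<open>auto simp: set_integrable_def\<close>)
  ultimately have "(LINT t|lborel. indicator {c<..<d} t *\<^sub>R (F (p, t) - F (q, t))) =
      - (LINT z|lborel. indicator ?R z *\<^sub>R G z)"
    using weak[OF \<mu>] unfolding lhs by (intro LIMSEQ_unique) (auto intro: tendsto_minus)
  moreover have "(LINT t|lborel. indicator {c<..<d} t *\<^sub>R (F (p, t) - F (q, t))) =
      - (LINT t|lborel. indicator {c<..<d} t *\<^sub>R (F (q, t) - F (p, t)))"
    by (subst integral_minus[symmetric], intro Bochner_Integration.integral_cong) (auto simp: algebra_simps)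
  ultimately show ?thesis unfolding set_lebesgue_integral_def by simp
qed

lemma set_integral_open_interval:
  fixes g :: "real \<Rightarrow> 'b::euclidean_space"
  assumes [measurable]: "g \<in> borel_measurable borel"
  shows "(LINT s:{p<..<q}|lborel. g s) = (LINT s:{p..q}|lborel. g s)"
proof -
  have "AE s in lborel. s \<noteq> p \<and> s \<noteq> q"
    using AE_lborel_singleton[of p] AE_lborel_singleton[of q] by eventually_elim auto
  then have "AE s in lborel. indicator {p<..<q} s *\<^sub>R g s = indicator {p..q} s *\<^sub>R g s"
    by eventually_elim (auto simp: indicator_def)
  then show ?thesis
    unfolding set_lebesgue_integral_def by (intro integral_cong_AE) auto
qed

lemma lborel_prod_integral_snd:
  fixes f :: "real \<times> real \<Rightarrow> 'b::euclidean_space"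
  assumes "integrable lborel f"
  shows "(LINT z|lborel. f z) = (LINT t|lborel. (LINT s|lborel. f (s, t)))"
    and "integrable lborel (\<lambda>t. LINT s|lborel. f (s, t))"
    and "AE t in lborel. integrable lborel (\<lambda>s. f (s, t))"
proof -
  have i: "integrable (lborel \<Otimes>\<^sub>M lborel) (case_prod (\<lambda>s t. f (s, t)))"
    using assms by (simp add: lborel_prod case_prod_beta')
  show "(LINT z|lborel. f z) = (LINT t|lborel. (LINT s|lborel. f (s, t)))"
    using lborel_pair.integral_snd[OF i] by (simp add: lborel_prod case_prod_beta')
  show "integrable lborel (\<lambda>t. LINT s|lborel. f (s, t))"
    using lborel_pair.integrable_snd[OF i] .
  show "AE t in lborel. integrable lborel (\<lambda>s. f (s, t))"
    using lborel_pair.AE_integrable_snd[OF i] .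
qed

text \<open>For a fixed rectangle the identity on rectangles gives an identity for almost every
  \<open>t\<close>, with a null set depending on the rectangle. Only countably many rational
  rectangles are used, so one null set serves all; continuity of both sides in the end points then
  reaches arbitrary segments.\<close>

lemma AE_absolutely_continuous_on_lines:
  fixes F G :: "real \<times> real \<Rightarrow> 'b::euclidean_space"
  assumes F: "continuous_on UNIV F" and K: "closed K" and Gm[measurable]: "G \<in> borel_measurable borel"
    and G: "\<And>A. compact A \<Longrightarrow> set_integrable lborel A G"
    and rect: "\<And>p q c d. p < q \<Longrightarrow> c < d \<Longrightarrow> {p..q} \<times> {c..d} \<inter> K = {} \<Longrightarrow>
      (LINT t:{c<..<d}|lborel. F (q, t) - F (p, t)) = (LINT z:{p<..<q} \<times> {c<..<d}|lborel. G z)"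
  shows "AE t in lborel. (\<forall>a b. set_integrable lborel {a..b} (\<lambda>s. G (s, t))) \<and>
    (\<forall>p q. p \<le> q \<longrightarrow> {p..q} \<times> {t} \<inter> K = {} \<longrightarrow> F (q, t) - F (p, t) = (LINT s:{p..q}|lborel. G (s, t)))"
proof -
  have Gm'[measurable]: "G \<in> borel_measurable (borel \<Otimes>\<^sub>M borel)" unfolding borel_prod by simp
  have Fc2: "continuous_on A (\<lambda>t. F (s, t))" for s A
    by (intro continuous_on_compose2[OF F] continuous_intros) auto
  have Fc1: "continuous_on A (\<lambda>s. F (s, t))" for t A
    by (intro continuous_on_compose2[OF F] continuous_intros) auto
  have "AE t in lborel. \<forall>n::nat. integrable lborel (\<lambda>s. indicator ({- real n..real n} \<times> {- real n..real n}) (s, t) *\<^sub>R G (s, t))"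
    unfolding AE_all_countable
  proof
    fix n :: nat
    have "integrable lborel (\<lambda>z. indicator ({- real n..real n} \<times> {- real n..real n}) z *\<^sub>R G z)"
      using G[OF compact_Times[OF compact_Icc compact_Icc], of "- real n" "real n" "- real n" "real n"]
      unfolding set_integrable_def .
    from lborel_prod_integral_snd(3)[OF this]
    show "AE t in lborel. integrable lborel (\<lambda>s. indicator ({- real n..real n} \<times> {- real n..real n}) (s, t) *\<^sub>R G (s, t))" .
  qed
  then have I: "AE t in lborel. \<forall>a b. set_integrable lborel {a..b} (\<lambda>s. G (s, t))"
  proof eventually_elim
    case (elim t)
    show ?case
    proof (intro allI)
      fix a b
      obtain n :: nat where n: "\<bar>a\<bar> + \<bar>b\<bar> + \<bar>t\<bar> \<le> real n" using real_arch_simple by blast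
      have "integrable lborel (\<lambda>s. indicator {a..b} s *\<^sub>R (indicator ({- real n..real n} \<times> {- real n..real n}) (s, t) *\<^sub>R G (s, t)))"
        using elim by (intro integrable_mult_indicator) auto
      moreover have "indicator {a..b} s *\<^sub>R (indicator ({- real n..real n} \<times> {- real n..real n}) (s, t) *\<^sub>R G (s, t)) = indicator {a..b} s *\<^sub>R G (s, t)" for s
        using n by (auto simp: indicator_def)
      ultimately show "set_integrable lborel {a..b} (\<lambda>s. G (s, t))"
        unfolding set_integrable_def by (simp only:)
    qed
  qed
  \<comment> \<open>Varying the upper side of the rectangle makes the integral of this difference
    vanish over every interval starting at \<open>c\<close>.\<close>
  have II: "AE t in lborel. t \<in> {c<..<d} \<longrightarrow> F (q, t) - F (p, t) - (LINT s:{p<..<q}|lborel. G (s, t)) = 0"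
    if pq: "p < q" and cd: "c < d" and disj: "{p..q} \<times> {c..d} \<inter> K = {}" for p q c d
  proof (rule AE_eq_0_if_interval_integrals_eq_0)
    have Gi: "integrable lborel (\<lambda>z. indicator ({p<..<q} \<times> {c<..<a}) z *\<^sub>R G z)" if "a \<le> d" for a
    proof -
      have "integrable lborel (\<lambda>z. indicator ({p<..<q} \<times> {c<..<a}) z *\<^sub>R (indicator ({p..q} \<times> {c..d}) z *\<^sub>R G z))"
        using G[OF compact_Times[OF compact_Icc compact_Icc], of p q c d] unfolding set_integrable_def
        by (rule integrable_mult_indicator[rotated]) (auto intro!: borel_open open_Times)
      moreover have "indicator ({p<..<q} \<times> {c<..<a}) z *\<^sub>R (indicator ({p..q} \<times> {c..d}) z *\<^sub>R G z) = indicator ({p<..<q} \<times> {c<..<a}) z *\<^sub>R G z" for z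
        using that by (auto simp: indicator_def)
      ultimately show ?thesis by (simp only:)
    qed
    have inner: "(LINT s|lborel. indicator ({p<..<q} \<times> {c<..<a}) (s, t) *\<^sub>R G (s, t)) = indicator {c<..<a} t *\<^sub>R (LINT s:{p<..<q}|lborel. G (s, t))" for a t
      unfolding set_lebesgue_integral_def by (auto simp: indicator_def)
    have Fi: "integrable lborel (\<lambda>t. indicator {c<..<a} t *\<^sub>R (F (q, t) - F (p, t)))" for a
    proof -
      have "integrable lborel (\<lambda>t. indicator {c<..<a} t *\<^sub>R (indicator {c..a} t *\<^sub>R (F (q, t) - F (p, t))))"
        by (intro integrable_mult_indicator borel_integrable_compact continuous_intros Fc2) auto
      moreover have "indicator {c<..<a} t *\<^sub>R (indicator {c..a} t *\<^sub>R (F (q, t) - F (p, t))) = indicator {c<..<a} t *\<^sub>R (F (q, t) - F (p, t))" for t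
        by (auto simp: indicator_def)
      ultimately show ?thesis by (simp only:)
    qed
    have GI: "integrable lborel (\<lambda>t. indicator {c<..<a} t *\<^sub>R (LINT s:{p<..<q}|lborel. G (s, t)))" if "a \<le> d" for a
      using lborel_prod_integral_snd(2)[OF Gi[OF that]] unfolding inner .
    show "set_integrable lborel {c<..<d} (\<lambda>t. F (q, t) - F (p, t) - (LINT s:{p<..<q}|lborel. G (s, t)))"
      unfolding set_integrable_def scaleR_diff_right[of _ "F (q, _) - F (p, _)"]
      by (intro Bochner_Integration.integrable_diff Fi GI order_refl)
    fix a assume a: "c < a" "a \<le> d"
    have "(LINT t:{c<..<a}|lborel. F (q, t) - F (p, t) - (LINT s:{p<..<q}|lborel. G (s, t))) =
        (LINT t:{c<..<a}|lborel. F (q, t) - F (p, t)) - (LINT t:{c<..<a}|lborel. (LINT s:{p<..<q}|lborel. G (s, t)))"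
      unfolding set_lebesgue_integral_def[of _ "{c<..<a}"] scaleR_diff_right[of _ "F (q, _) - F (p, _)"]
      by (intro Bochner_Integration.integral_diff Fi GI a)
    also have "(LINT t:{c<..<a}|lborel. (LINT s:{p<..<q}|lborel. G (s, t))) = (LINT z:{p<..<q} \<times> {c<..<a}|lborel. G z)"
      unfolding set_lebesgue_integral_def[of _ "{c<..<a}"] set_lebesgue_integral_def[of _ "{p<..<q} \<times> {c<..<a}"]
      unfolding lborel_prod_integral_snd(1)[OF Gi[OF a(2)]] inner ..
    also have "(LINT t:{c<..<a}|lborel. F (q, t) - F (p, t)) = (LINT z:{p<..<q} \<times> {c<..<a}|lborel. G z)"
    proof (rule rect[OF pq a(1)])
      have "{p..q} \<times> {c..a} \<subseteq> {p..q} \<times> {c..d}" using a by auto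
      then show "{p..q} \<times> {c..a} \<inter> K = {}" using disj by blast
    qed
    finally show "(LINT t:{c<..<a}|lborel. F (q, t) - F (p, t) - (LINT s:{p<..<q}|lborel. G (s, t))) = 0" by simp
  qed
  define Q where "Q = {(p, q, c, d). p \<in> \<rat> \<and> q \<in> \<rat> \<and> c \<in> \<rat> \<and> d \<in> \<rat> \<and> p < q \<and> c < d \<and> {p..q} \<times> {c..d} \<inter> K = {}}"
  have "Q \<subseteq> \<rat> \<times> \<rat> \<times> \<rat> \<times> \<rat>" unfolding Q_def by auto
  then have cQ: "countable Q" by (rule countable_subset) (intro countable_SIGMA countable_rat)
  have "AE t in lborel. \<forall>x\<in>Q. (case x of (p, q, c, d) \<Rightarrow> t \<in> {c<..<d} \<longrightarrow> F (q, t) - F (p, t) - (LINT s:{p<..<q}|lborel. G (s, t)) = 0)"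
    unfolding AE_ball_countable[OF cQ] using II unfolding Q_def by (auto simp del: greaterThanLessThan_iff)
  then show ?thesis using I
  proof eventually_elim
    case (elim t)
    have Gint: "(\<lambda>s. G (s, t)) integrable_on {a..b}" for a b
      using elim(2) set_borel_integral_eq_integral(1) by blast
    have GI: "(LINT s:{a..b}|lborel. G (s, t)) = integral {a..b} (\<lambda>s. G (s, t))" for a b
      using elim(2) set_borel_integral_eq_integral(2) by blast
    have "F (q, t) - F (p, t) = (LINT s:{p..q}|lborel. G (s, t))" if pq: "p \<le> q" and disj: "{p..q} \<times> {t} \<inter> K = {}" for p q
    proof (cases "p = q")
      case True
      have "(LINT s:{p..p}|lborel. G (s, t)) = 0"
        unfolding GI using integral_refl[of p "\<lambda>s. G (s, t)"] unfolding box_real .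
      then show ?thesis using True by simp
    next
      case False
      then have lt: "p < q" using pq by simp
      \<comment> \<open>A compact segment has positive distance from the closed set
        \<open>K\<close>, hence lies in a thin rectangle off \<open>K\<close> with rational lower
        and upper side.\<close>
      obtain e where e: "e > 0" "\<And>z. z \<in> K \<Longrightarrow> \<forall>w\<in>{p..q} \<times> {t}. e \<le> dist w z"
        using separate_compact_closed[OF compact_Times[OF compact_Icc compact_sing] K disj] by metis
      obtain c where c: "c \<in> \<rat>" "t - e < c" "c < t" using Rats_dense_in_real[of "t - e" t] e(1) by auto
      obtain d where d: "d \<in> \<rat>" "t < d" "d < t + e" using Rats_dense_in_real[of t "t + e"] e(1) by auto
      have tube: "{p..q} \<times> {c..d} \<inter> K = {}"
      proof (rule ccontr)
        assume "{p..q} \<times> {c..d} \<inter> K \<noteq> {}"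
        then obtain s r where sr: "s \<in> {p..q}" "r \<in> {c..d}" "(s, r) \<in> K" by blast
        have "e \<le> dist (s, t) (s, r)" using e(2)[OF sr(3)] sr(1) by auto
        moreover have "dist (s, t) (s, r) = \<bar>t - r\<bar>" by (simp add: dist_prod_def dist_real_def)
        ultimately show False using sr(2) c d by auto
      qed
      have rat: "F (b, t) - F (a, t) = integral {a..b} (\<lambda>s. G (s, t))"
        if "a \<in> \<rat>" "b \<in> \<rat>" "a < b" "a \<in> {p<..<q}" "b \<in> {p<..<q}" for a b
      proof -
        have "{a..b} \<times> {c..d} \<subseteq> {p..q} \<times> {c..d}" using that by auto
        then have "{a..b} \<times> {c..d} \<inter> K = {}" using tube by blast
        then have "(a, b, c, d) \<in> Q" unfolding Q_def using that c d by auto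
        then have "F (b, t) - F (a, t) - (LINT s:{a<..<b}|lborel. G (s, t)) = 0"
          using elim(1) c d by force
        then show ?thesis using set_integral_open_interval[of "\<lambda>s. G (s, t)" a b] GI by simp
      qed
      \<comment> \<open>The ends \<open>p\<close> and \<open>q\<close> may be irrational. The
        function \<open>u\<close> is constant on the rationals strictly between them, and by
        continuity on the closed interval.\<close>
      define u where "u s = F (s, t) - integral {p..s} (\<lambda>s. G (s, t))" for s
      have uc: "continuous_on {p..q} u" unfolding u_def
        by (intro continuous_intros Fc1 indefinite_integral_continuous_1 Gint)
      obtain r where r: "r \<in> \<rat>" "p < r" "r < q" using Rats_dense_in_real[OF lt] by auto
      have ueq: "u a = u b" if "a \<in> \<rat>" "b \<in> \<rat>" "a < b" "a \<in> {p<..<q}" "b \<in> {p<..<q}" for a b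
        using rat[OF that] Henstock_Kurzweil_Integration.integral_combine[of p a b "\<lambda>s. G (s, t)"] Gint that
        unfolding u_def by (auto simp: algebra_simps)
      have const: "u s = u r" if s: "s \<in> \<rat> \<inter> {p<..<q}" for s
      proof -
        have "s \<in> \<rat>" "s \<in> {p<..<q}" "r \<in> {p<..<q}" using s r by auto
        then show ?thesis using ueq[of s r] ueq[of r s] r(1) by (metis linorder_less_linear)
      qed
      have cl: "{p..q} \<subseteq> closure (\<rat> \<inter> {p<..<q})"
      proof
        fix s assume s: "s \<in> {p..q}"
        show "s \<in> closure (\<rat> \<inter> {p<..<q})" unfolding closure_approachable
        proof (intro allI impI)
          fix \<epsilon> :: real assume "\<epsilon> > 0"
          then have "max p (s - \<epsilon>) < min q (s + \<epsilon>)" using s lt by auto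
          from Rats_dense_in_real[OF this] obtain y where "y \<in> \<rat>" "max p (s - \<epsilon>) < y" "y < min q (s + \<epsilon>)" by blast
          then show "\<exists>y\<in>\<rat> \<inter> {p<..<q}. dist y s < \<epsilon>"
            by (intro bexI[of _ y]) (auto simp: dist_real_def abs_less_iff)
        qed
      qed
      have "closed {s \<in> {p..q}. u s = u r}"
        using uc by (intro continuous_closed_preimage_constant) auto
      moreover have "\<rat> \<inter> {p<..<q} \<subseteq> {s \<in> {p..q}. u s = u r}" using const by auto
      ultimately have "closure (\<rat> \<inter> {p<..<q}) \<subseteq> {s \<in> {p..q}. u s = u r}" by (intro closure_minimal)
      then have all: "u s = u r" if "s \<in> {p..q}" for s using cl that by blast
      have "u p = u q" using all[of p] all[of q] lt by simp
      then show ?thesis unfolding u_def GI by (simp add: algebra_simps)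
    qed
    then show ?case using elim(2) by blast
  qed
qed

section \<open>Removability\<close>

text \<open>The axes are arranged so that the first coordinate always runs in the direction
  \<open>b\<close> of differentiation; one argument on horizontal lines then covers both partial
  derivatives.\<close>

definition coords :: "complex \<Rightarrow> real \<times> real \<Rightarrow> complex" where
  "coords b = (\<lambda>(s, t). if b = 1 then Complex s t else Complex t s)"

definition other :: "complex \<Rightarrow> complex" where
  "other b = (if b = 1 then \<i> else 1)"

lemma coords_swap: "b \<in> Basis \<Longrightarrow> coords (other b) (t, s) = coords b (s, t)"
  by (auto simp: coords_def other_def Basis_complex_def)

lemma other_Basis: "b \<in> Basis \<Longrightarrow> other b \<in> Basis"
  by (auto simp: other_def Basis_complex_def)

lemma dist_coords: "dist (coords b x) (coords b y) = dist x y"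
  by (cases x; cases y)
     (auto simp: coords_def dist_prod_def dist_real_def dist_norm cmod_def complex_diff add.commute)

lemma surj_coords: "surj (coords b)"
proof (rule surjI)
  show "coords b (if b = 1 then (Re z, Im z) else (Im z, Re z)) = z" for z
    by (auto simp: coords_def)
qed

lemma continuous_on_coords: "continuous_on A (coords b)"
  unfolding continuous_on_iff dist_coords by auto

lemma coords_measurable[measurable]: "coords b \<in> borel_measurable borel"
  using continuous_on_coords by (rule borel_measurable_continuous_onI)

lemma distr_coords: "distr lborel borel (coords b) = lborel"
proof (rule lborel_eqI[symmetric])
  fix l u :: complex assume le: "\<And>b. b \<in> Basis \<Longrightarrow> l \<bullet> b \<le> u \<bullet> b"
  have le': "Re l \<le> Re u" "Im l \<le> Im u" using le[of 1] le[of \<i>] by (auto simp: Basis_complex_def)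
  have box: "box l u = {z. Re l < Re z \<and> Re z < Re u \<and> Im l < Im z \<and> Im z < Im u}"
    by (auto simp: box_def Basis_complex_def)
  have "coords b -` box l u = (if b = 1 then {Re l<..<Re u} \<times> {Im l<..<Im u} else {Im l<..<Im u} \<times> {Re l<..<Re u})"
    unfolding box by (auto simp: coords_def)
  then have "emeasure (distr lborel borel (coords b)) (box l u) =
      emeasure (lborel \<Otimes>\<^sub>M lborel) (if b = 1 then {Re l<..<Re u} \<times> {Im l<..<Im u} else {Im l<..<Im u} \<times> {Re l<..<Re u})"
    by (subst emeasure_distr) (auto simp: lborel_prod)
  also have "\<dots> = ennreal (Re u - Re l) * ennreal (Im u - Im l)"
    using le' by (auto simp: lborel.emeasure_pair_measure_Times mult.commute)
  also have "\<dots> = (\<Prod>b\<in>Basis. (u - l) \<bullet> b)"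
    using le' by (simp add: Basis_complex_def ennreal_mult)
  finally show "emeasure (distr lborel borel (coords b)) (box l u) = (\<Prod>b\<in>Basis. (u - l) \<bullet> b)" .
qed simp

lemma integral_coords:
  fixes f :: "complex \<Rightarrow> 'b::euclidean_space"
  assumes "f \<in> borel_measurable borel"
  shows "(LINT z|lborel. f z) = (LINT w|lborel. f (coords b w))"
    and "integrable lborel f \<longleftrightarrow> integrable lborel (\<lambda>w. f (coords b w))"
proof -
  show "(LINT z|lborel. f z) = (LINT w|lborel. f (coords b w))"
    using assms by (subst distr_coords[of b, symmetric]) (auto intro: integral_distr)
  show "integrable lborel f \<longleftrightarrow> integrable lborel (\<lambda>w. f (coords b w))"
    using integrable_distr_eq[of "coords b" lborel borel f] assms unfolding distr_coords by simp
qed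

lemma coords_vector_derivative:
  assumes "b \<in> Basis"
  shows "((\<lambda>s. coords b (s, t)) has_vector_derivative b) (at s)"
proof -
  have "coords b (s, t) = s *\<^sub>R b + t *\<^sub>R other b" for s
    using assms by (auto simp: coords_def other_def Basis_complex_def complex_eq_iff)
  then show ?thesis
    by (auto intro!: derivative_eq_intros simp: has_vector_derivative_def)
qed

section \<open>Integration by parts for indefinite integrals\<close>

lemma integrable_prod_scaleR:
  fixes u :: "real \<Rightarrow> real" and v :: "real \<Rightarrow> 'b::euclidean_space"
  assumes u: "integrable lborel u" and v: "integrable lborel v"
  shows "integrable lborel (\<lambda>z. u (fst z) *\<^sub>R v (snd z))"
proof -
  have [measurable]: "u \<in> borel_measurable borel" "v \<in> borel_measurable borel" using u v by auto
  have "integrable (lborel \<Otimes>\<^sub>M lborel) (\<lambda>z. u (fst z) *\<^sub>R v (snd z))"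
  proof (rule integrableI_bounded)
    have "(\<integral>\<^sup>+z. ennreal (norm (u (fst z) *\<^sub>R v (snd z))) \<partial>(lborel \<Otimes>\<^sub>M lborel)) =
        (\<integral>\<^sup>+s. (\<integral>\<^sup>+r. ennreal (norm (u s)) * ennreal (norm (v r)) \<partial>lborel) \<partial>lborel)"
      by (subst lborel.nn_integral_fst[symmetric]) (auto simp: ennreal_mult)
    also have "\<dots> = (\<integral>\<^sup>+s. ennreal (norm (u s)) \<partial>lborel) * (\<integral>\<^sup>+r. ennreal (norm (v r)) \<partial>lborel)"
      by (simp add: nn_integral_cmult nn_integral_multc)
    also have "\<dots> < \<infinity>" using u v unfolding integrable_iff_bounded by (simp add: ennreal_mult_less_top)
    finally show "(\<integral>\<^sup>+z. ennreal (norm (u (fst z) *\<^sub>R v (snd z))) \<partial>(lborel \<Otimes>\<^sub>M lborel)) < \<infinity>" .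
  qed measurable
  then show ?thesis by (simp add: lborel_prod)
qed

lemma lborel_prod_integral_fst:
  fixes f :: "real \<times> real \<Rightarrow> 'b::euclidean_space"
  assumes "integrable lborel f"
  shows "(LINT z|lborel. f z) = (LINT s|lborel. (LINT t|lborel. f (s, t)))"
  using lborel_pair.integral_fst'[of f] assms by (simp add: lborel_prod)

text \<open>As \<open>G\<close> is merely integrable, the product rule is replaced by Fubini for
  \<open>\<phi>'(s) G(r)\<close> on the triangle \<open>r \<le> s\<close>.\<close>

lemma integration_by_parts_indefinite_integral:
  fixes F G :: "real \<Rightarrow> 'b::euclidean_space" and \<phi> \<phi>' :: "real \<Rightarrow> real"
  assumes F: "continuous_on UNIV F" and G: "\<And>a b. set_integrable lborel {a..b} G"
    and FG: "\<And>a b. a \<le> b \<Longrightarrow> F b - F a = (LINT s:{a..b}|lborel. G s)"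
    and \<phi>: "\<And>s. (\<phi> has_real_derivative \<phi>' s) (at s)" "continuous_on UNIV \<phi>'"
    and supp: "\<And>s. \<bar>s\<bar> \<ge> R \<Longrightarrow> \<phi> s = 0" and R: "R > 0"
  shows "(LINT s|lborel. \<phi>' s *\<^sub>R F s) = - (LINT s|lborel. \<phi> s *\<^sub>R G s)"
proof -
  have \<phi>'0: "\<phi>' s = 0" if "s \<notin> {-R..R}" for s
  proof -
    have "(\<phi> has_real_derivative 0) (at s)"
      by (rule has_field_derivative_transform_within_open[of "\<lambda>_. 0" _ _ "- {-R..R}"])
         (use that supp in \<open>auto simp: abs_if\<close>)
    then show ?thesis using \<phi>(1) DERIV_unique by blast
  qed
  have \<phi>FTC: "(LINT s:{a..b}|lborel. \<phi>' s) = \<phi> b - \<phi> a" if "a \<le> b" for a b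
  proof -
    have "set_integrable lborel {a..b} \<phi>'" unfolding set_integrable_def
      using \<phi>(2) by (intro borel_integrable_compact) (auto intro: continuous_on_subset)
    then have "(LINT s:{a..b}|lborel. \<phi>' s) = integral {a..b} \<phi>'"
      by (rule set_borel_integral_eq_integral)
    also have "\<dots> = \<phi> b - \<phi> a"
      using \<phi>(1) that by (intro integral_unique fundamental_theorem_of_calculus)
        (auto simp: has_real_derivative_iff_has_vector_derivative intro: has_vector_derivative_at_within)
    finally show ?thesis .
  qed
  have \<phi>R: "\<phi> R = 0" "\<phi> (- R) = 0" using supp R by auto
  define u where "u s = indicator {-R..R} s *\<^sub>R \<phi>' s" for s
  define v where "v r = indicator {-R..R} r *\<^sub>R G r" for r
  have u\<phi>: "u s = \<phi>' s" for s unfolding u_def using \<phi>'0[of s] by (cases "s \<in> {-R..R}") auto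
  have ui: "integrable lborel u" unfolding u_def
    using \<phi>(2) by (intro borel_integrable_compact) (auto intro: continuous_on_subset)
  have vi: "integrable lborel v" using G[of "-R" R] unfolding v_def set_integrable_def .
  \<comment> \<open>Integrating first over \<open>r\<close> gives
    \<open>\<phi>'(s) (F(s) - F(-R))\<close>, integrating first over \<open>s\<close> gives
    \<open>(\<phi>(R) - \<phi>(r)) G(r)\<close>, where \<open>\<phi>(R) = 0\<close>. The constant
    \<open>F(-R)\<close> drops out in the end because \<open>\<phi>'\<close> has integral
    zero.\<close>
  define k where "k z = indicator {z :: real \<times> real. snd z \<le> fst z} z *\<^sub>R (u (fst z) *\<^sub>R v (snd z))" for z
  have ki: "integrable lborel k" unfolding k_def
    by (intro integrable_mult_indicator integrable_prod_scaleR ui vi)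
       (auto intro!: borel_closed closed_Collect_le continuous_intros)
  have kf: "(LINT r|lborel. k (s, r)) = u s *\<^sub>R (F s - F (- R))" for s
  proof (cases "s \<in> {-R..R}")
    case True
    have "(LINT r|lborel. k (s, r)) = (LINT r|lborel. u s *\<^sub>R (indicator {-R..s} r *\<^sub>R G r))"
      unfolding k_def v_def using True by (intro Bochner_Integration.integral_cong) (auto simp: indicator_def)
    also have "\<dots> = u s *\<^sub>R (LINT r|lborel. indicator {-R..s} r *\<^sub>R G r)"
      by (rule integral_scaleR_right)
    also have "\<dots> = u s *\<^sub>R (F s - F (- R))"
      using FG[of "-R" s] True by (simp add: set_lebesgue_integral_def)
    finally show ?thesis .
  qed (simp add: k_def u_def)
  have ks: "(LINT s|lborel. k (s, r)) = - (\<phi> r *\<^sub>R G r)" for r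
  proof (cases "r \<in> {-R..R}")
    case True
    have "(LINT s|lborel. k (s, r)) = (LINT s|lborel. (indicator {r..R} s *\<^sub>R \<phi>' s) *\<^sub>R v r)"
      unfolding k_def u_def using True by (intro Bochner_Integration.integral_cong) (auto simp: indicator_def)
    also have "\<dots> = (LINT s:{r..R}|lborel. \<phi>' s) *\<^sub>R v r"
      unfolding set_lebesgue_integral_def
      using \<phi>(2) by (intro integral_scaleR_left borel_integrable_compact) (auto intro: continuous_on_subset)
    also have "\<dots> = - (\<phi> r *\<^sub>R G r)" using \<phi>FTC[of r R] True \<phi>R by (simp add: v_def)
    finally show ?thesis .
  next
    case False
    then have "\<phi> r = 0" using supp[of r] by (auto simp: abs_if)
    then show ?thesis using False by (simp add: k_def v_def)
  qed
  have "(LINT s|lborel. \<phi>' s *\<^sub>R F s) - (LINT s|lborel. u s *\<^sub>R F (- R)) = (LINT s|lborel. \<phi>' s *\<^sub>R F s - u s *\<^sub>R F (- R))"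
  proof (rule Bochner_Integration.integral_diff[symmetric])
    have "integrable lborel (\<lambda>s. indicator {-R..R} s *\<^sub>R (\<phi>' s *\<^sub>R F s))"
      using \<phi>(2) F by (intro borel_integrable_compact continuous_on_scaleR) (auto intro: continuous_on_subset)
    moreover have "(\<lambda>s. indicator {-R..R} s *\<^sub>R (\<phi>' s *\<^sub>R F s)) = (\<lambda>s. \<phi>' s *\<^sub>R F s)"
      by (rule ext) (metis \<phi>'0 indicator_simps(1) scale_one scale_zero_left scale_zero_right)
    ultimately show "integrable lborel (\<lambda>s. \<phi>' s *\<^sub>R F s)" by (simp only:)
    show "integrable lborel (\<lambda>s. u s *\<^sub>R F (- R))" using ui by (rule integrable_scaleR_left)
  qed
  also have "\<dots> = (LINT s|lborel. u s *\<^sub>R (F s - F (- R)))"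
    by (simp add: u\<phi> scaleR_diff_right)
  also have "\<dots> = (LINT z|lborel. k z)" unfolding lborel_prod_integral_fst[OF ki] kf ..
  also have "\<dots> = (LINT r|lborel. - (\<phi> r *\<^sub>R G r))" unfolding lborel_prod_integral_snd(1)[OF ki] ks ..
  also have "\<dots> = - (LINT r|lborel. \<phi> r *\<^sub>R G r)" by (rule integral_minus)
  also have "(LINT s|lborel. u s *\<^sub>R F (- R)) = (LINT s|lborel. u s) *\<^sub>R F (- R)"
    using ui by (intro integral_scaleR_left) auto
  also have "(LINT s|lborel. u s) = 0"
    using \<phi>FTC[of "-R" R] R \<phi>R unfolding u_def set_lebesgue_integral_def by simp
  finally show ?thesis by simp
qed

section \<open>Weak derivatives and behaviour on lines\<close>

lemma partial_deriv_along_coords: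
  assumes b: "b \<in> Basis" and \<phi>: "C_k 1 \<phi>"
  shows "((\<lambda>s. \<phi> (coords b (s, t))) has_real_derivative partial_deriv b \<phi> (coords b (s, t))) (at s)"
    and "continuous_on UNIV (partial_deriv b \<phi>)"
proof -
  have d: "\<phi> differentiable (at z)" for z using \<phi> by simp
  have "(\<phi> has_derivative frechet_derivative \<phi> (at z)) (at z)" for z
    using d frechet_derivative_works by blast
  from vector_derivative_diff_chain_within[OF coords_vector_derivative[OF b, of t s], of \<phi> "frechet_derivative \<phi> (at (coords b (s, t)))"]
  show "((\<lambda>s. \<phi> (coords b (s, t))) has_real_derivative partial_deriv b \<phi> (coords b (s, t))) (at s)"
    using \<open>(\<phi> has_derivative frechet_derivative \<phi> (at (coords b (s, t)))) (at (coords b (s, t)))\<close>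
    by (simp add: has_real_derivative_iff_has_vector_derivative o_def has_derivative_at_withinI)
  show "continuous_on UNIV (partial_deriv b \<phi>)" using \<phi> b by simp
qed

definition plateau_product :: "complex \<Rightarrow> real \<Rightarrow> real \<Rightarrow> real \<Rightarrow> real \<Rightarrow> real \<Rightarrow> complex \<Rightarrow> real" where
  "plateau_product b p q c d m = (\<lambda>z. if b = 1 then plateau p q m (Re z) * plateau c d m (Im z)
     else plateau c d m (Re z) * plateau p q m (Im z))"

lemma plateau_product_coords:
  assumes "b \<in> Basis"
  shows "plateau_product b p q c d m (coords b (s, t)) = plateau p q m s * plateau c d m t"
    and "partial_deriv b (plateau_product b p q c d m) (coords b (s, t)) = plateau_deriv p q m s * plateau c d m t"
  using assms
  by (auto simp: plateau_product_def coords_def Basis_complex_def partial_deriv_product_Re_Im[OF plateau_has_derivative plateau_has_derivative])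

lemma test_function_plateau_product:
  assumes b: "b \<in> Basis" and pq: "p < q" "m \<ge> 1 / (q - p)" and cd: "c < d" "m \<ge> 1 / (d - c)"
    and U: "coords b ` ({p..q} \<times> {c..d}) \<subseteq> U"
  shows "test_function U (plateau_product b p q c d m)"
proof -
  let ?\<phi> = "plateau_product b p q c d m"
  have cR: "compact (coords b ` ({p..q} \<times> {c..d}))"
    by (intro compact_continuous_image continuous_on_coords compact_Times compact_Icc)
  have "{z. ?\<phi> z \<noteq> 0} \<subseteq> coords b ` ({p..q} \<times> {c..d})"
  proof
    fix z assume z: "z \<in> {z. ?\<phi> z \<noteq> 0}"
    obtain s t where st: "z = coords b (s, t)" using surj_coords[of b] by (metis surj_def surj_pair)
    then have "plateau p q m s \<noteq> 0" "plateau c d m t \<noteq> 0" using z plateau_product_coords(1)[OF b] by auto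
    then have "s \<in> {p<..<q}" "t \<in> {c<..<d}" using plateau_outside(1) pq cd by blast+
    then show "z \<in> coords b ` ({p..q} \<times> {c..d})" unfolding st by (intro imageI) auto
  qed
  then have "closure {z. ?\<phi> z \<noteq> 0} \<subseteq> coords b ` ({p..q} \<times> {c..d})" "bounded {z. ?\<phi> z \<noteq> 0}"
    using cR by (auto intro: closure_minimal[THEN subsetD] compact_imp_closed bounded_subset compact_imp_bounded)
  moreover have "C_k k ?\<phi>" for k
    unfolding plateau_product_def by (cases "b = 1") (auto intro: C_k_product plateau_diff_k)
  ultimately show ?thesis unfolding test_function_def compact_closure using U by blast
qed

text \<open>Local integrability follows from
  \<open>norm (g z) \<le> 1 + (norm (g z))\<^sup>2\<close> and the finite measure of compact
  sets.\<close>

lemma set_integrable_if_L2: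
  fixes g :: "complex \<Rightarrow> 'b::euclidean_space"
  assumes gm: "g \<in> borel_measurable borel" and g: "integrable lborel (\<lambda>z. (norm (g z))\<^sup>2)" and A: "compact A"
  shows "set_integrable lborel A g"
proof -
  have "A \<in> sets borel" using A by (rule borel_compact)
  have "integrable lborel (\<lambda>z. indicator A z *\<^sub>R (1::real))"
    using A by (intro borel_integrable_compact) auto
  then have "integrable lborel (\<lambda>z. indicator A z *\<^sub>R 1 + (norm (g z))\<^sup>2)"
    using g by (rule Bochner_Integration.integrable_add)
  then show ?thesis unfolding set_integrable_def
  proof (rule Bochner_Integration.integrable_bound)
    show "(\<lambda>z. indicator A z *\<^sub>R g z) \<in> borel_measurable lborel"
      using gm \<open>A \<in> sets borel\<close> by auto
    show "AE z in lborel. norm (indicator A z *\<^sub>R g z) \<le> norm (indicator A z *\<^sub>R (1::real) + (norm (g z))\<^sup>2)"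
    proof (rule AE_I2)
      fix z
      have "norm (g z) \<le> 1 + (norm (g z))\<^sup>2"
        using sum_squares_bound[of 1 "norm (g z)"] norm_ge_zero[of "g z"] unfolding one_power2 by linarith
      then show "norm (indicator A z *\<^sub>R g z) \<le> norm (indicator A z *\<^sub>R (1::real) + (norm (g z))\<^sup>2)"
        by (auto simp: indicator_def)
    qed
  qed
qed

abbreviation ac_off :: "complex set \<Rightarrow> complex \<Rightarrow> (complex \<Rightarrow> 'b) \<Rightarrow> (complex \<Rightarrow> 'b::euclidean_space) \<Rightarrow> real \<Rightarrow> bool" where
  "ac_off K b f h t \<equiv> (\<forall>p q. set_integrable lborel {p..q} (\<lambda>s. h (coords b (s, t)))) \<and>
    (\<forall>p q. p \<le> q \<longrightarrow> {p..q} \<times> {t} \<inter> coords b -` K = {} \<longrightarrow>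
       f (coords b (q, t)) - f (coords b (p, t)) = (LINT s:{p..q}|lborel. h (coords b (s, t))))"

text \<open>A product of plateaus on a closed rectangle disjoint from \<open>K\<close> is an
  admissible test function, so the weak identity yields the identity on rectangles, transported to
  the coordinates adapted to \<open>b\<close>.\<close>

lemma AE_absolutely_continuous_if_weak_partial_deriv:
  fixes f g :: "complex \<Rightarrow> 'b::euclidean_space"
  assumes b: "b \<in> Basis" and K: "closed K" and f: "continuous_on UNIV f"
    and weak: "has_weak_partial_deriv (UNIV - K) b f g"
    and hm: "h \<in> borel_measurable borel" and hi: "\<And>A. compact A \<Longrightarrow> set_integrable lborel A h"
    and h: "h = (\<lambda>z. indicator (UNIV - K) z *\<^sub>R g z)"
  shows "AE t in lborel. ac_off K b f h t"
proof (rule AE_absolutely_continuous_on_lines[where F = "\<lambda>w. f (coords b w)" and G = "\<lambda>w. h (coords b w)"])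
  show Fc: "continuous_on UNIV (\<lambda>w. f (coords b w))"
    by (rule continuous_on_compose2[OF f continuous_on_coords]) auto
  show "closed (coords b -` K)"
    using continuous_on_coords K by (rule closed_vimage[rotated])
  show hcm: "(\<lambda>w. h (coords b w)) \<in> borel_measurable borel" using hm by measurable
  show hci: "set_integrable lborel A (\<lambda>w. h (coords b w))" if A: "compact A" for A
  proof -
    have cA: "compact (coords b ` A)" using A by (intro compact_continuous_image continuous_on_coords)
    have "integrable lborel (\<lambda>z. indicator (coords b ` A) z *\<^sub>R h z)"
      using hi[OF cA] unfolding set_integrable_def .
    moreover have "(\<lambda>z. indicator (coords b ` A) z *\<^sub>R h z) \<in> borel_measurable borel"
      using hm borel_compact[OF cA] by auto
    ultimately have "integrable lborel (\<lambda>w. indicator (coords b ` A) (coords b w) *\<^sub>R h (coords b w))"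
      using integral_coords(2) by blast
    moreover have "inj (coords b)" by (intro injI) (metis dist_coords dist_eq_0_iff)
    then have "indicator (coords b ` A) (coords b w) = (indicator A w :: real)" for w
      by (auto simp: indicator_def inj_image_mem_iff)
    ultimately show ?thesis unfolding set_integrable_def by simp
  qed
  fix p q c d :: real assume pq: "p < q" and cd: "c < d" and disj: "{p..q} \<times> {c..d} \<inter> coords b -` K = {}"
  show "(LINT t:{c<..<d}|lborel. f (coords b (q, t)) - f (coords b (p, t))) =
      (LINT z:{p<..<q} \<times> {c<..<d}|lborel. h (coords b z))"
  proof (rule rectangle_identity[OF Fc hcm _ pq cd])
    have "integrable lborel (\<lambda>z. indicator ({p<..<q} \<times> {c<..<d}) z *\<^sub>R (indicator ({p..q} \<times> {c..d}) z *\<^sub>R h (coords b z)))"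
      using hci[OF compact_Times[OF compact_Icc compact_Icc], of p q c d] unfolding set_integrable_def
      by (rule integrable_mult_indicator[rotated]) (auto intro!: borel_open open_Times)
    moreover have "indicator ({p<..<q} \<times> {c<..<d}) z *\<^sub>R (indicator ({p..q} \<times> {c..d}) z *\<^sub>R h (coords b z)) = indicator ({p<..<q} \<times> {c<..<d}) z *\<^sub>R h (coords b z)" for z
      by (auto simp: indicator_def)
    ultimately show "set_integrable lborel ({p<..<q} \<times> {c<..<d}) (\<lambda>w. h (coords b w))"
      unfolding set_integrable_def by (simp only:)
    fix m assume m: "m \<ge> 1 / (q - p)" "m \<ge> 1 / (d - c)"
    let ?\<phi> = "plateau_product b p q c d m"
    have U: "coords b ` ({p..q} \<times> {c..d}) \<subseteq> UNIV - K" using disj by blast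
    have tf: "test_function (UNIV - K) ?\<phi>"
      by (rule test_function_plateau_product[OF b pq m(1) cd m(2) U])
    have "C_k 1 ?\<phi>" using tf unfolding test_function_def by blast
    then have c\<phi>: "continuous_on UNIV (partial_deriv b ?\<phi>)" by (rule partial_deriv_along_coords(2)[OF b])
    have "C_k 0 ?\<phi>" using tf unfolding test_function_def by blast
    then have c\<phi>0: "continuous_on UNIV ?\<phi>" by simp
    have "(LINT x:UNIV - K|lborel. partial_deriv b ?\<phi> x *\<^sub>R f x) = - (LINT x:UNIV - K|lborel. ?\<phi> x *\<^sub>R g x)"
      using weak tf unfolding has_weak_partial_deriv_def by blast
    also have "(LINT x:UNIV - K|lborel. partial_deriv b ?\<phi> x *\<^sub>R f x) = (LINT x|lborel. partial_deriv b ?\<phi> x *\<^sub>R f x)"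
      unfolding set_lebesgue_integral_def
    proof (rule Bochner_Integration.integral_cong[OF refl])
      fix x
      obtain s t where x: "x = coords b (s, t)" using surj_coords[of b] by (metis surj_def surj_pair)
      show "indicat_real (UNIV - K) x *\<^sub>R (partial_deriv b ?\<phi> x *\<^sub>R f x) = partial_deriv b ?\<phi> x *\<^sub>R f x"
      proof (cases "x \<in> K")
        case True
        then have "(s, t) \<in> coords b -` K" using x by simp
        then have "(s, t) \<notin> {p..q} \<times> {c..d}" using disj by blast
        then have "plateau_deriv p q m s = 0 \<or> plateau c d m t = 0"
          using plateau_outside(2)[OF pq m(1), of s] plateau_outside(1)[OF cd m(2), of t] by auto
        then have "partial_deriv b ?\<phi> x = 0" unfolding x plateau_product_coords(2)[OF b] by auto
        then show ?thesis by simp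
      qed simp
    qed
    also have "\<dots> = (LINT w|lborel. partial_deriv b ?\<phi> (coords b w) *\<^sub>R f (coords b w))"
      by (intro integral_coords(1) borel_measurable_scaleR borel_measurable_continuous_onI c\<phi> f)
    also have "(LINT x:UNIV - K|lborel. ?\<phi> x *\<^sub>R g x) = (LINT x|lborel. ?\<phi> x *\<^sub>R h x)"
      unfolding set_lebesgue_integral_def h by (intro Bochner_Integration.integral_cong) auto
    also have "\<dots> = (LINT w|lborel. ?\<phi> (coords b w) *\<^sub>R h (coords b w))"
      by (intro integral_coords(1) borel_measurable_scaleR borel_measurable_continuous_onI c\<phi>0 hm)
    also have "(\<lambda>w. ?\<phi> (coords b w) *\<^sub>R h (coords b w)) = (\<lambda>w. (plateau p q m (fst w) * plateau c d m (snd w)) *\<^sub>R h (coords b w))"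
      using plateau_product_coords(1)[OF b, of p q c d m "fst w" "snd w" for w] by (intro ext) simp
    also have "(\<lambda>w. partial_deriv b ?\<phi> (coords b w) *\<^sub>R f (coords b w)) = (\<lambda>w. (plateau_deriv p q m (fst w) * plateau c d m (snd w)) *\<^sub>R f (coords b w))"
      using plateau_product_coords(2)[OF b, of p q c d m "fst w" "snd w" for w] by (intro ext) simp
    finally show "(LINT z|lborel. (plateau_deriv p q m (fst z) * plateau c d m (snd z)) *\<^sub>R f (coords b z)) =
      - (LINT z|lborel. (plateau p q m (fst z) * plateau c d m (snd z)) *\<^sub>R h (coords b z))"
      .
  qed
qed

text \<open>Fubini splits both integrals into lines in direction \<open>b\<close>; on almost every
  line integration by parts applies.\<close>

lemma has_weak_partial_deriv_if_AE_lines: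
  fixes f h :: "complex \<Rightarrow> 'b::euclidean_space"
  assumes b: "b \<in> Basis" and f: "continuous_on UNIV f"
    and hm: "h \<in> borel_measurable borel" and hi: "\<And>A. compact A \<Longrightarrow> set_integrable lborel A h"
    and lines: "AE t in lborel. (\<forall>p q. set_integrable lborel {p..q} (\<lambda>s. h (coords b (s, t)))) \<and>
      (\<forall>p q. p \<le> q \<longrightarrow> f (coords b (q, t)) - f (coords b (p, t)) = (LINT s:{p..q}|lborel. h (coords b (s, t))))"
  shows "has_weak_partial_deriv UNIV b f h"
  unfolding has_weak_partial_deriv_def
proof (intro allI impI)
  fix \<phi> :: "complex \<Rightarrow> real" assume \<phi>: "test_function UNIV \<phi>"
  have Ck: "C_k k \<phi>" for k using \<phi> unfolding test_function_def by blast
  have c\<phi>: "continuous_on UNIV \<phi>" using Ck[of 0] by simp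
  note pd = partial_deriv_along_coords[OF b Ck[of 1]]
  define S where "S = closure {x. \<phi> x \<noteq> 0}"
  have cS: "compact S" using \<phi> unfolding test_function_def S_def by blast
  have \<phi>0: "\<phi> x = 0" if "x \<notin> S" for x
    using that closure_subset[of "{x. \<phi> x \<noteq> 0}"] unfolding S_def by auto
  have pd0: "partial_deriv b \<phi> x = 0" if x: "x \<notin> S" for x
  proof -
    have "open (- S)" using cS compact_imp_closed by blast
    have "(\<phi> has_derivative (\<lambda>_. 0)) (at x)"
      by (rule has_derivative_transform_within_open[OF has_derivative_const[of 0] \<open>open (- S)\<close>])
         (use x \<phi>0 in auto)
    then show ?thesis by (simp add: frechet_derivative_at[symmetric])
  qed
  have i1: "integrable lborel (\<lambda>x. partial_deriv b \<phi> x *\<^sub>R f x)"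
  proof -
    have "integrable lborel (\<lambda>x. indicator S x *\<^sub>R (partial_deriv b \<phi> x *\<^sub>R f x))"
      by (intro borel_integrable_compact cS continuous_on_scaleR continuous_on_subset[OF pd(2)] continuous_on_subset[OF f]) auto
    moreover have "(\<lambda>x. indicator S x *\<^sub>R (partial_deriv b \<phi> x *\<^sub>R f x)) = (\<lambda>x. partial_deriv b \<phi> x *\<^sub>R f x)"
      using pd0 by (intro ext) (auto simp: indicator_def)
    ultimately show ?thesis by (simp only:)
  qed
  have i2: "integrable lborel (\<lambda>x. \<phi> x *\<^sub>R h x)"
  proof -
    have "compact (\<phi> ` S)" using cS c\<phi> by (intro compact_continuous_image) (auto intro: continuous_on_subset)
    then obtain B where B: "\<And>x. x \<in> S \<Longrightarrow> \<bar>\<phi> x\<bar> \<le> B"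
      using compact_imp_bounded[of "\<phi> ` S"] unfolding bounded_iff real_norm_def by (metis imageI)
    have "integrable lborel (\<lambda>x. B *\<^sub>R (indicator S x *\<^sub>R h x))"
      using hi[OF cS] unfolding set_integrable_def by (rule integrable_scaleR_right)
    then show ?thesis
    proof (rule Bochner_Integration.integrable_bound)
      show "(\<lambda>x. \<phi> x *\<^sub>R h x) \<in> borel_measurable lborel"
        using borel_measurable_scaleR[OF borel_measurable_continuous_onI[OF c\<phi>] hm] by simp
      show "AE x in lborel. norm (\<phi> x *\<^sub>R h x) \<le> norm (B *\<^sub>R (indicator S x *\<^sub>R h x))"
      proof (rule AE_I2)
        fix x
        show "norm (\<phi> x *\<^sub>R h x) \<le> norm (B *\<^sub>R (indicator S x *\<^sub>R h x))"
        proof (cases "x \<in> S")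
          case True
          have "\<bar>\<phi> x\<bar> * norm (h x) \<le> \<bar>B\<bar> * norm (h x)"
            using B[OF True] by (intro mult_right_mono) auto
          then show ?thesis using True by simp
        qed (simp add: \<phi>0)
      qed
    qed
  qed
  obtain R0 where R0: "\<And>x. x \<in> S \<Longrightarrow> cmod x \<le> R0" using compact_imp_bounded[OF cS] unfolding bounded_iff by blast
  \<comment> \<open>The summand 1 puts all points with first coordinate of modulus at least
    \<open>R\<close> outside the support.\<close>
  define R where "R = \<bar>R0\<bar> + 1"
  have supp: "\<phi> (coords b (s, t)) = 0" if "\<bar>s\<bar> \<ge> R" for s t
  proof (rule \<phi>0)
    have "\<bar>s\<bar> \<le> cmod (coords b (s, t))"
      using abs_Re_le_cmod[of "Complex s t"] abs_Im_le_cmod[of "Complex t s"] by (auto simp: coords_def)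
    then show "coords b (s, t) \<notin> S" using R0[of "coords b (s, t)"] that unfolding R_def by fastforce
  qed
  have m1: "(\<lambda>x. partial_deriv b \<phi> x *\<^sub>R f x) \<in> borel_measurable borel" and m2: "(\<lambda>x. \<phi> x *\<^sub>R h x) \<in> borel_measurable borel"
    using i1 i2 by auto
  have j1: "integrable lborel (\<lambda>w. partial_deriv b \<phi> (coords b w) *\<^sub>R f (coords b w))"
    using i1 integral_coords(2)[OF m1] by blast
  have j2: "integrable lborel (\<lambda>w. \<phi> (coords b w) *\<^sub>R h (coords b w))"
    using i2 integral_coords(2)[OF m2] by blast
  have "(LINT x|lborel. partial_deriv b \<phi> x *\<^sub>R f x) =
      (LINT t|lborel. (LINT s|lborel. partial_deriv b \<phi> (coords b (s, t)) *\<^sub>R f (coords b (s, t))))"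
    unfolding integral_coords(1)[OF m1, of b] by (rule lborel_prod_integral_snd(1)[OF j1])
  also have "\<dots> = (LINT t|lborel. - (LINT s|lborel. \<phi> (coords b (s, t)) *\<^sub>R h (coords b (s, t))))"
  proof (rule integral_cong_AE)
    show "(\<lambda>t. LINT s|lborel. partial_deriv b \<phi> (coords b (s, t)) *\<^sub>R f (coords b (s, t))) \<in> borel_measurable lborel"
      using lborel_prod_integral_snd(2)[OF j1] by (rule borel_measurable_integrable)
    have "(\<lambda>t. LINT s|lborel. \<phi> (coords b (s, t)) *\<^sub>R h (coords b (s, t))) \<in> borel_measurable lborel"
      using lborel_prod_integral_snd(2)[OF j2] by (rule borel_measurable_integrable)
    then show "(\<lambda>t. - (LINT s|lborel. \<phi> (coords b (s, t)) *\<^sub>R h (coords b (s, t)))) \<in> borel_measurable lborel"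
      by (rule borel_measurable_uminus)
    show "AE t in lborel. (LINT s|lborel. partial_deriv b \<phi> (coords b (s, t)) *\<^sub>R f (coords b (s, t))) =
        - (LINT s|lborel. \<phi> (coords b (s, t)) *\<^sub>R h (coords b (s, t)))"
      using lines
    proof eventually_elim
      case (elim t)
      have cs: "continuous_on UNIV (\<lambda>s. coords b (s, t))"
        by (rule continuous_on_compose2[OF continuous_on_coords[of UNIV b]]) (auto intro!: continuous_intros)
      show ?case
      proof (rule integration_by_parts_indefinite_integral[where R = R])
        show "continuous_on UNIV (\<lambda>s. f (coords b (s, t)))"
          by (rule continuous_on_compose2[OF f cs]) auto
        show "continuous_on UNIV (\<lambda>s. partial_deriv b \<phi> (coords b (s, t)))"
          by (rule continuous_on_compose2[OF pd(2) cs]) auto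
        show "R > 0" unfolding R_def by simp
      qed (use elim pd(1) supp in auto)
    qed
  qed
  also have "\<dots> = - (LINT t|lborel. (LINT s|lborel. \<phi> (coords b (s, t)) *\<^sub>R h (coords b (s, t))))"
    by (rule integral_minus)
  also have "(LINT t|lborel. (LINT s|lborel. \<phi> (coords b (s, t)) *\<^sub>R h (coords b (s, t)))) = (LINT x|lborel. \<phi> x *\<^sub>R h x)"
    unfolding integral_coords(1)[OF m2, of b] by (rule lborel_prod_integral_snd(1)[OF j2, symmetric])
  finally show "(LINT x:UNIV|lborel. partial_deriv b \<phi> x *\<^sub>R f x) = - (LINT x:UNIV|lborel. \<phi> x *\<^sub>R h x)"
    unfolding set_lebesgue_integral_def by simp
qed

text \<open>Even for a single direction \<open>b\<close> both families of lines are needed, since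
  the vertical arms of the crosses are controlled by the other partial derivative. The null image
  argument concerns real functions and is applied to each component of \<open>f\<close>.\<close>

lemma weak_partial_deriv_across_cone_accessible:
  fixes f :: "complex \<Rightarrow> 'b::euclidean_space" and h :: "complex \<Rightarrow> complex \<Rightarrow> 'b"
  assumes K: "compact K" "K \<noteq> {}" and M: "M > 0" "cone_accessible M K"
    and f: "continuous_on UNIV f"
    and hm: "\<And>b. b \<in> Basis \<Longrightarrow> h b \<in> borel_measurable borel"
    and hi: "\<And>b A. b \<in> Basis \<Longrightarrow> compact A \<Longrightarrow> set_integrable lborel A (h b)"
    and h0: "\<And>b x. x \<in> K \<Longrightarrow> h b x = 0"
    and lines: "\<And>b. b \<in> Basis \<Longrightarrow> AE t in lborel. ac_off K b f (h b) t"
    and b: "b \<in> Basis"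
  shows "has_weak_partial_deriv UNIV b f (h b)"
proof (rule has_weak_partial_deriv_if_AE_lines[OF b f hm[OF b] hi[OF b]])
  define K' where "K' = coords b -` K"
  have inj: "inj (coords b)" by (intro injI) (metis dist_coords dist_eq_0_iff)
  have K'ne: "K' \<noteq> {}" unfolding K'_def using K(2) surj_coords[of b] by (simp add: surj_vimage_empty)
  have K'c: "compact K'"
  proof -
    have "closed K'" unfolding K'_def using continuous_on_coords compact_imp_closed[OF K(1)] by (rule closed_vimage[rotated])
    moreover have "bounded K'"
    proof -
      obtain e where e: "\<And>x. x \<in> K \<Longrightarrow> dist (coords b 0) x \<le> e"
        using compact_imp_bounded[OF K(1)] unfolding bounded_any_center[of _ "coords b 0"] by blast
      have "dist 0 w \<le> e" if "w \<in> K'" for w using e[of "coords b w"] that unfolding K'_def by (simp add: dist_coords)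
      then show ?thesis unfolding bounded_def by blast
    qed
    ultimately show ?thesis by (simp add: compact_eq_bounded_closed)
  qed
  have acc: "cone_accessible M K'" unfolding K'_def
    by (rule cone_accessible_vimage_isometry[OF dist_coords surj_coords M(2)])
  have ob: "other b \<in> Basis" using b by (rule other_Basis)
  \<comment> \<open>The sum of both norms bounds the oscillation along either kind of arm.\<close>
  define H where "H w = ennreal (norm (h b (coords b w)) + norm (h (other b) (coords b w)))" for w
  have [measurable]: "h b \<in> borel_measurable borel" "h (other b) \<in> borel_measurable borel" using hm b ob by auto
  have Hm: "H \<in> borel_measurable borel" unfolding H_def[abs_def] by measurable
  have Hf: "(\<integral>\<^sup>+w\<in>cball 0 r. H w \<partial>lborel) < \<infinity>" for r
  proof -
    have ii: "integrable lborel (\<lambda>w. norm (indicator (cball 0 r) w *\<^sub>R h b' (coords b w)))" if b': "b' \<in> Basis" for b'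
    proof -
      have cA: "compact (coords b ` cball 0 r)" by (intro compact_continuous_image continuous_on_coords compact_cball)
      have "(\<lambda>z. indicator (coords b ` cball 0 r) z *\<^sub>R h b' z) \<in> borel_measurable borel"
        using hm[OF b'] borel_compact[OF cA] by auto
      then have "integrable lborel (\<lambda>w. indicator (coords b ` cball 0 r) (coords b w) *\<^sub>R h b' (coords b w))"
        using hi[OF b' cA] integral_coords(2) unfolding set_integrable_def by blast
      moreover have "indicator (coords b ` cball 0 r) (coords b w) = (indicator (cball 0 r) w :: real)" for w
        using inj by (auto simp: indicator_def inj_image_mem_iff)
      ultimately show ?thesis by (simp only: integrable_norm)
    qed
    have "integrable lborel (\<lambda>w. norm (indicator (cball 0 r) w *\<^sub>R h b (coords b w)) + norm (indicator (cball 0 r) w *\<^sub>R h (other b) (coords b w)))"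
      by (intro Bochner_Integration.integrable_add ii b ob)
    then have "(\<integral>\<^sup>+w. ennreal (norm (norm (indicator (cball 0 r) w *\<^sub>R h b (coords b w)) + norm (indicator (cball 0 r) w *\<^sub>R h (other b) (coords b w)))) \<partial>lborel) < \<infinity>"
      unfolding integrable_iff_bounded by blast
    also have "(\<integral>\<^sup>+w. ennreal (norm (norm (indicator (cball 0 r) w *\<^sub>R h b (coords b w)) + norm (indicator (cball 0 r) w *\<^sub>R h (other b) (coords b w)))) \<partial>lborel)
        = (\<integral>\<^sup>+w\<in>cball 0 r. H w \<partial>lborel)"
      unfolding H_def by (intro nn_integral_cong) (auto simp: indicator_def)
    finally show ?thesis .
  qed
  have osc: "ennreal \<bar>v \<bullet> e\<bar> \<le> (\<integral>\<^sup>+s\<in>{p..q}. k s \<partial>lborel)"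
    if v: "v = (LINT s:{p..q}|lborel. g s)" and i: "set_integrable lborel {p..q} g" and e: "e \<in> Basis"
      and k: "\<And>s. ennreal (norm (g s)) \<le> k s" for v e :: 'b and g :: "real \<Rightarrow> 'b" and p q k
  proof -
    have "ennreal \<bar>v \<bullet> e\<bar> \<le> ennreal (norm v)" using Basis_le_norm[OF e, of v] by (rule ennreal_leI)
    also have "\<dots> \<le> (\<integral>\<^sup>+s. ennreal (norm (indicator {p..q} s *\<^sub>R g s)) \<partial>lborel)"
      unfolding v set_lebesgue_integral_def using i unfolding set_integrable_def
      by (rule integral_norm_bound_ennreal)
    also have "\<dots> \<le> (\<integral>\<^sup>+s\<in>{p..q}. k s \<partial>lborel)"
      using k by (intro nn_integral_mono) (auto simp: indicator_def)
    finally show ?thesis .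
  qed
  have neg: "AE t in lborel. negligible ((\<lambda>w. f (coords b w) \<bullet> e) ` (K' \<inter> UNIV \<times> {t}))" if e: "e \<in> Basis" for e
  proof (rule AE_negligible_image_on_line[OF K'c K'ne _ M(1) acc Hm Hf])
    show "continuous_on UNIV (\<lambda>w. f (coords b w) \<bullet> e)"
      by (intro continuous_intros continuous_on_compose2[OF f continuous_on_coords]) auto
    show "AE t in lborel. osc_bound_x K' H (\<lambda>w. f (coords b w) \<bullet> e) t"
      using lines[OF b]
    proof eventually_elim
      case (elim t)
      show ?case unfolding osc_bound_x_def inner_diff_left[symmetric]
      proof (intro allI impI)
        fix p q assume "p \<le> q" "{p..q} \<times> {t} \<inter> K' = {}"
        then show "ennreal \<bar>(f (coords b (q, t)) - f (coords b (p, t))) \<bullet> e\<bar> \<le> (\<integral>\<^sup>+s\<in>{p..q}. H (s, t) \<partial>lborel)"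
          using elim e unfolding K'_def by (intro osc[where g = "\<lambda>s. h b (coords b (s, t))"]) (auto simp: H_def intro: ennreal_leI)
      qed
    qed
    show "AE s in lborel. osc_bound_y K' H (\<lambda>w. f (coords b w) \<bullet> e) s"
      using lines[OF ob]
    proof eventually_elim
      case (elim s)
      show ?case unfolding osc_bound_y_def inner_diff_left[symmetric]
      proof (intro allI impI)
        fix p q assume pq: "p \<le> q" and disj: "{s} \<times> {p..q} \<inter> K' = {}"
        have "{p..q} \<times> {s} \<inter> coords (other b) -` K = {}"
          using disj unfolding K'_def by (auto simp: coords_swap[OF b])
        then have "f (coords b (s, q)) - f (coords b (s, p)) = (LINT t:{p..q}|lborel. h (other b) (coords b (s, t)))"
          using elim pq by (simp add: coords_swap[OF b])
        moreover have "set_integrable lborel {p..q} (\<lambda>t. h (other b) (coords b (s, t)))"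
          using elim by (simp add: coords_swap[OF b])
        ultimately show "ennreal \<bar>(f (coords b (s, q)) - f (coords b (s, p))) \<bullet> e\<bar> \<le> (\<integral>\<^sup>+t\<in>{p..q}. H (s, t) \<partial>lborel)"
          using e by (intro osc[where g = "\<lambda>t. h (other b) (coords b (s, t))"]) (auto simp: H_def intro: ennreal_leI)
      qed
    qed
  qed
  then have "AE t in lborel. \<forall>e\<in>Basis. negligible ((\<lambda>w. f (coords b w) \<bullet> e) ` (K' \<inter> UNIV \<times> {t}))"
    by (intro AE_finite_allI) auto
  then show "AE t in lborel. (\<forall>p q. set_integrable lborel {p..q} (\<lambda>s. h b (coords b (s, t)))) \<and>
      (\<forall>p q. p \<le> q \<longrightarrow> f (coords b (q, t)) - f (coords b (p, t)) = (LINT s:{p..q}|lborel. h b (coords b (s, t))))"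
    using lines[OF b]
  proof eventually_elim
    case (elim t)
    have "f (coords b (q, t)) - f (coords b (p, t)) = (LINT s:{p..q}|lborel. h b (coords b (s, t)))" if pq: "p \<le> q" for p q
    proof (rule euclidean_eqI)
      fix e :: 'b assume e: "e \<in> Basis"
      have inner: "(LINT s:{p..q}|lborel. h b (coords b (s, t)) \<bullet> e) = (LINT s:{p..q}|lborel. h b (coords b (s, t))) \<bullet> e" for p q
      proof -
        have "integrable lborel (\<lambda>s. indicator {p..q} s *\<^sub>R h b (coords b (s, t)))"
          using elim(2) unfolding set_integrable_def by blast
        then show ?thesis unfolding set_lebesgue_integral_def
          by (subst integral_inner_left[symmetric]) auto
      qed
      have "f (coords b (q, t)) \<bullet> e - f (coords b (p, t)) \<bullet> e = (LINT s:{p..q}|lborel. h b (coords b (s, t)) \<bullet> e)"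
      proof (rule integral_eq_if_negligible_image[where K = "{s. coords b (s, t) \<in> K}"])
        have cs: "continuous_on UNIV (\<lambda>s. coords b (s, t))"
          by (rule continuous_on_compose2[OF continuous_on_coords[of UNIV b]]) (auto intro!: continuous_intros)
        show "continuous_on UNIV (\<lambda>s. f (coords b (s, t)) \<bullet> e)"
          by (intro continuous_intros continuous_on_compose2[OF f cs]) auto
        have "closed ((\<lambda>s. coords b (s, t)) -` K)"
          using cs compact_imp_closed[OF K(1)] by (rule closed_vimage[rotated])
        then show "closed {s. coords b (s, t) \<in> K}" by (simp add: vimage_def)
        show "set_integrable lborel {p..q} (\<lambda>s. h b (coords b (s, t)) \<bullet> e)" for p q
        proof -
          have "integrable lborel (\<lambda>s. (indicator {p..q} s *\<^sub>R h b (coords b (s, t))) \<bullet> e)"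
            using elim(2) unfolding set_integrable_def by (intro integrable_inner_left) blast
          then show ?thesis unfolding set_integrable_def by simp
        qed
        show "h b (coords b (x, t)) \<bullet> e = 0" if "x \<in> {s. coords b (s, t) \<in> K}" for x
          using h0 that by simp
        show "f (coords b (q, t)) \<bullet> e - f (coords b (p, t)) \<bullet> e = (LINT s:{p..q}|lborel. h b (coords b (s, t)) \<bullet> e)"
          if "p \<le> q" "{p..q} \<inter> {s. coords b (s, t) \<in> K} = {}" for p q
        proof -
          have "{p..q} \<times> {t} \<inter> coords b -` K = {}" using that by auto
          then have "f (coords b (q, t)) - f (coords b (p, t)) = (LINT s:{p..q}|lborel. h b (coords b (s, t)))"
            using elim(2) that(1) by blast
          then show ?thesis unfolding inner by (metis inner_diff_left)
        qed
        have "(\<lambda>s. f (coords b (s, t)) \<bullet> e) ` {s. coords b (s, t) \<in> K} = (\<lambda>w. f (coords b w) \<bullet> e) ` (K' \<inter> UNIV \<times> {t})"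
          unfolding K'_def by auto
        then show "negligible ((\<lambda>s. f (coords b (s, t)) \<bullet> e) ` {s. coords b (s, t) \<in> K})"
          using elim(1) e by simp
      qed (rule pq)
      then show "(f (coords b (q, t)) - f (coords b (p, t))) \<bullet> e = (LINT s:{p..q}|lborel. h b (coords b (s, t))) \<bullet> e"
        unfolding inner by (simp add: inner_diff_left)
    qed
    then show ?case using elim(2) by blast
  qed
qed

theorem theorem1:
  fixes \<Omega> :: "riemann_sphere set" and K :: "complex set"
    and f :: "complex \<Rightarrow> 'b::euclidean_space"
  assumes "john_domain \<Omega> Infinity"
    and "K = Finite -` frontier \<Omega>"
    and "continuous_on UNIV f"
    and "W12 (UNIV - K) f"
  shows "W12 UNIV f"
proof -
  have op: "open \<Omega>" "Infinity \<in> \<Omega>" "frontier \<Omega> \<noteq> {}" using assms(1) unfolding john_domain_def by auto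
  have K: "compact K" unfolding assms(2) using op(1,2) by (rule compact_vimage_frontier)
  have "frontier \<Omega> = Finite ` K" unfolding assms(2) using op(1,2) by (rule frontier_eq_Finite_image)
  then have Kne: "K \<noteq> {}" using op(3) by (metis image_empty)
  obtain M where M: "M > 0" "cone_accessible M K" using john_domain_cone_accessible[OF assms(1,2)] .
  obtain g where g: "\<And>b. b \<in> Basis \<Longrightarrow> L2_on (UNIV - K) (g b)"
    "\<And>b. b \<in> Basis \<Longrightarrow> has_weak_partial_deriv (UNIV - K) b f (g b)"
    using assms(4) unfolding W12_def by metis
  \<comment> \<open>The candidate for the weak derivative on the whole plane is the given one
    extended by zero across \<open>K\<close>.\<close>
  define h where "h b = (\<lambda>z. indicator (UNIV - K) z *\<^sub>R g b z)" for b
  have hm: "h b \<in> borel_measurable borel" and h2: "integrable lborel (\<lambda>z. (norm (h b z))\<^sup>2)" if "b \<in> Basis" for b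
  proof -
    show "h b \<in> borel_measurable borel"
      using g(1)[OF that] unfolding L2_on_def set_borel_measurable_def h_def by simp
    have "(norm (h b z))\<^sup>2 = indicator (UNIV - K) z *\<^sub>R (norm (g b z))\<^sup>2" for z
      unfolding h_def by (simp add: indicator_def)
    then show "integrable lborel (\<lambda>z. (norm (h b z))\<^sup>2)"
      using g(1)[OF that] unfolding L2_on_def set_integrable_def by simp
  qed
  have hi: "set_integrable lborel A (h b)" if "b \<in> Basis" "compact A" for b A
    using hm[OF that(1)] h2[OF that(1)] that(2) by (rule set_integrable_if_L2)
  have "has_weak_partial_deriv UNIV b f (h b)" if b: "b \<in> Basis" for b
  proof (rule weak_partial_deriv_across_cone_accessible[OF K Kne M assms(3) hm hi _ _ b])
    show "h b x = 0" if "x \<in> K" for b x using that by (simp add: h_def)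
    show "AE t in lborel. ac_off K b f (h b) t" if b: "b \<in> Basis" for b
      using h_def by (intro AE_absolutely_continuous_if_weak_partial_deriv[OF b compact_imp_closed[OF K] assms(3) g(2)[OF b] hm[OF b] hi[OF b]])
  qed
  moreover have "L2_on UNIV (h b)" if "b \<in> Basis" for b
    using hm[OF that] h2[OF that] unfolding L2_on_def set_borel_measurable_def set_integrable_def by simp
  ultimately show ?thesis unfolding W12_def by blast
qed

end
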